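(* Let $G$ be a finite abelian group and let $\nu$ be a symmetric non-degenerate probability distribution on $G$. Consider the random cochain $F_{n,\nu}\in C^1(K_n,G)$, and the corresponding random cochain graphon $R_n^G=W^G_{F_{n,\nu}}$. (a) For any closed subset $\widetilde{F}$ of $\widetilde{\mathcal{W}}_0^G$, we have \[\limsup_{n\to\infty} \frac{1}{n^2}\log \mathbb{P}(\widetilde{R}_n^G\in \widetilde{F})\le -\inf_{\widetilde{W}^G\in \widetilde{F}} I_\nu(\widetilde{W}^G).\] (b) For any open subset $\widetilde{E}$ of $\widetilde{\mathcal{W}}_0^G$, we have \[\liminf_{n\to\infty} \frac{1}{n^2}\log \mathbb{P}(\widetilde{R}_n^G\in \widetilde{E})\ge -\inf_{\widetilde{W}^G\in \widetilde{E}} I_\nu(\widetilde{W}^G).\]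
   Context: Conventions: $0\cdot\log 0=0$, $\log 0=-\infty$, $\inf\emptyset=+\infty$. Cochain graphons. $S_G=[0,1]^2\times G$ carries the product of Lebesgue measure and counting measure. A function $W^G:S_G\to\mathbb{R}$ is symmetric if $W^G(x,y,g)=W^G(y,x,-g)$ for all $(x,y,g)$. $\mathcal{W}^G$ is the set of symmetric elements of $L^\infty(S_G)$ (cochain kernels), and $\mathcal{W}_0^G=\{W^G\in\mathcal{W}^G: 0\le W^G\le 1\}$ (cochain graphons). Write $W^g(x,y)=W^G(x,y,g)$. Cut metric. For bounded measurable $W:[0,1]^2\to\mathbb{R}$, $\|W\|_\square=\sup_{S,T}\left|\int_{S\times T}W\,dxdy\right|$ over measurable $S,T\subset[0,1]$; for a cochain kernel, $\|W^G\|_\square=\sum_{g\in G}\|W^g\|_\square$. Let $S_{[0,1]}$ be the set of invertible measure preserving maps from $[0,1]$ to itself and $(W^G)^\varphi(x,y,g)=W^G(\varphi(x),\varphi(y),g)$. The cut distance is $\delta_\square(V^G,W^G)=\inf_{\varphi\in S_{[0,1]}}\|V^G-(W^G)^\varphi\|_\square$, a pseudometric. $\widetilde{\mathcal{W}}_0^G$ is the metric space obtained from $\mathcal{W}_0^G$ by identifying elements at $\delta_\square$-distance zero; $\widetilde{W}^G$ is the class of $W^G$. Open and closed refer to $(\widetilde{\mathcal{W}}_0^G,\delta_\square)$. Rate function. $\mathcal{W}_{00}^G=\{W^G\in\mathcal{W}_0^G:\sum_{g\in G}W^g(x,y)=1\text{ for almost all }(x,y)\}$, and for $W^G\in\mathcal{W}_0^G$,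 \[I_\nu(W^G)=\frac12\int_{[0,1]^2}\sum_{g\in G}W^g(x,y)\log\frac{W^g(x,y)}{\nu(g)}\,dxdy\ \text{ if }W^G\in\mathcal{W}_{00}^G,\qquad I_\nu(W^G)=\infty\text{ otherwise.}\] $I_\nu$ is constant on equivalence classes, so it is regarded as a function on $\widetilde{\mathcal{W}}_0^G$. Random cochains. $C^1(K_n,G)$ is the set of functions $f:\{(u,v)\in[n]^2:u\ne v\}\to G$ with $f(u,v)=-f(v,u)$. For $f\in C^1(K_n,G)$, $W_f^G(x,y,g)=1$ if $\lceil nx\rceil\ne\lceil ny\rceil$ and $f(\lceil nx\rceil,\lceil ny\rceil)=g$, and $W_f^G(x,y,g)=0$ otherwise (defined for $x,y\in(0,1]$; the null set where $x=0$ or $y=0$ is irrelevant). A symmetric non-degenerate probability distribution on $G$ is $\nu\in\mathbb{R}^G$ with $\sum_g\nu(g)=1$, $\nu(g)>0$ and $\nu(g)=\nu(-g)$ for all $g$. $F_{n,\nu}\in C^1(K_n,G)$ is the random cochain such that $(F_{n,\nu}(u,v))_{1\le u<v\le n}$ are independent and $\mathbb{P}(F_{n,\nu}(u,v)=g)=\nu(g)$ for all $1\le u<v\le n$, $g\in G$. *)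

theory Defs
  imports "HOL-Probability.Probability"
begin

section \<open>Cochain kernels and cochain graphons\<close>

definition unit_leb :: "real measure" where
  "unit_leb = lebesgue_on {0..1}"

definition square_leb :: "(real \<times> real) measure" where
  "square_leb = unit_leb \<Otimes>\<^sub>M unit_leb"

text \<open>
  The finite abelian group is the type \<open>'g\<close>. The space \<open>[0,1]\<^sup>2 \<times> G\<close> carries the
  product measure; the product is not completed, which does not change the \<open>L\<^sup>\<infinity>\<close>
  classes. Functions on it are represented by functions on \<open>real \<times> real \<times> 'g\<close>;
  their values outside of the unit square are never looked at.
\<close>

type_synonym 'g cochain_fun = "real \<times> real \<times> 'g \<Rightarrow> real"

definition cochain_space :: "(real \<times> real \<times> 'g) measure" where
  "cochain_space = unit_leb \<Otimes>\<^sub>M (unit_leb \<Otimes>\<^sub>M count_space UNIV)"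

definition slice :: "'g cochain_fun \<Rightarrow> 'g \<Rightarrow> real \<times> real \<Rightarrow> real" where
  "slice W g = (\<lambda>(x, y). W (x, y, g))"

definition cochain_symmetric :: "'g::ab_group_add cochain_fun \<Rightarrow> bool" where
  "cochain_symmetric W \<longleftrightarrow> (\<forall>x\<in>{0..1}. \<forall>y\<in>{0..1}. \<forall>g. W (x, y, g) = W (y, x, - g))"

text \<open>
  Elements of \<open>L\<^sup>\<infinity>\<close> are represented by actual functions, and symmetry and the bounds
  \<open>0 \<le> W \<le> 1\<close> are required of the representative at every point of the unit square. Every
  \<open>L\<^sup>\<infinity>\<close> class satisfying them almost everywhere has such a representative, and functions that
  agree almost everywhere are at cut distance zero, hence are identified in the quotient below.
\<close>

definition cochain_kernels :: "'g::ab_group_add cochain_fun set" where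
  "cochain_kernels = {W. W \<in> borel_measurable cochain_space
      \<and> (\<exists>C. AE p in cochain_space. \<bar>W p\<bar> \<le> C) \<and> cochain_symmetric W}"

definition cochain_graphons :: "'g::ab_group_add cochain_fun set" where
  "cochain_graphons = {W \<in> cochain_kernels.
      \<forall>x\<in>{0..1}. \<forall>y\<in>{0..1}. \<forall>g. 0 \<le> W (x, y, g) \<and> W (x, y, g) \<le> 1}"


section \<open>The cut metric\<close>

definition cut_norm :: "(real \<times> real \<Rightarrow> real) \<Rightarrow> real" where
  "cut_norm U = (SUP (S, T) \<in> sets unit_leb \<times> sets unit_leb.
      \<bar>set_lebesgue_integral square_leb (S \<times> T) U\<bar>)"

definition cochain_cut_norm :: "'g::finite cochain_fun \<Rightarrow> real" where
  "cochain_cut_norm W = (\<Sum>g\<in>UNIV. cut_norm (slice W g))"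

text \<open>Measure preservation of the inverse follows from that of the map itself.\<close>

definition unit_automorphisms :: "(real \<Rightarrow> real) set" where
  "unit_automorphisms = {\<phi>. bij_betw \<phi> {0..1} {0..1}
      \<and> \<phi> \<in> unit_leb \<rightarrow>\<^sub>M unit_leb
      \<and> the_inv_into {0..1} \<phi> \<in> unit_leb \<rightarrow>\<^sub>M unit_leb
      \<and> distr unit_leb unit_leb \<phi> = unit_leb}"

definition relabel :: "(real \<Rightarrow> real) \<Rightarrow> 'g cochain_fun \<Rightarrow> 'g cochain_fun" where
  "relabel \<phi> W = (\<lambda>(x, y, g). W (\<phi> x, \<phi> y, g))"

definition cut_distance :: "'g::finite cochain_fun \<Rightarrow> 'g cochain_fun \<Rightarrow> real" where
  "cut_distance V W = (INF \<phi> \<in> unit_automorphisms. cochain_cut_norm (\<lambda>p. V p - relabel \<phi> W p))"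

definition cut_equiv :: "('g::{finite,ab_group_add} cochain_fun \<times> 'g cochain_fun) set" where
  "cut_equiv = {(V, W). V \<in> cochain_graphons \<and> W \<in> cochain_graphons \<and> cut_distance V W = 0}"

definition graphon_classes :: "'g::{finite,ab_group_add} cochain_fun set set" where
  "graphon_classes = cochain_graphons // cut_equiv"

definition graphon_class :: "'g::{finite,ab_group_add} cochain_fun \<Rightarrow> 'g cochain_fun set" where
  "graphon_class W = cut_equiv `` {W}"

text \<open>
  The distance of two classes is the common value of \<^const>\<open>cut_distance\<close> on their
  representatives. The value \<open>0\<close> off \<^const>\<open>graphon_classes\<close> is there because
  \<^locale>\<open>Metric_space\<close> asks for nonnegativity and symmetry on the whole type.
\<close>

definition class_distance ::
    "'g::{finite,ab_group_add} cochain_fun set \<Rightarrow> 'g cochain_fun set \<Rightarrow> real" where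
  "class_distance A B = (if A \<in> graphon_classes \<and> B \<in> graphon_classes
      then the_elem ((\<lambda>(V, W). cut_distance V W) ` (A \<times> B)) else 0)"

definition cut_topology :: "'g::{finite,ab_group_add} cochain_fun set topology" where
  "cut_topology = Metric_space.mtopology graphon_classes class_distance"


section \<open>The rate function\<close>

definition stochastic_graphons :: "'g::{finite,ab_group_add} cochain_fun set" where
  "stochastic_graphons = {W \<in> cochain_graphons.
      AE p in square_leb. (\<Sum>g\<in>UNIV. slice W g p) = 1}"

text \<open>
  The convention \<open>0 \<cdot> log 0 = 0\<close> needs no case distinction, as the first factor vanishes.
\<close>

definition rate :: "('g::{finite,ab_group_add} \<Rightarrow> real) \<Rightarrow> 'g cochain_fun \<Rightarrow> ereal" where
  "rate \<nu> W = (if W \<in> stochastic_graphons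
      then ereal (1 / 2 * (\<integral>p. (\<Sum>g\<in>UNIV. slice W g p * ln (slice W g p / \<nu> g)) \<partial>square_leb))
      else \<infinity>)"

text \<open>The common value of \<^const>\<open>rate\<close> on the representatives of a class.\<close>

definition class_rate ::
    "('g::{finite,ab_group_add} \<Rightarrow> real) \<Rightarrow> 'g cochain_fun set \<Rightarrow> ereal" where
  "class_rate \<nu> A = the_elem (rate \<nu> ` A)"

definition ln_ereal :: "real \<Rightarrow> ereal" where
  "ln_ereal p = (if p = 0 then - \<infinity> else ereal (ln p))"


section \<open>Random cochains\<close>

definition ordered_pairs :: "nat \<Rightarrow> (nat \<times> nat) set" where
  "ordered_pairs n = {(u, v). u \<in> {1..n} \<and> v \<in> {1..n} \<and> u \<noteq> v}"

definition cochains :: "nat \<Rightarrow> (nat \<times> nat \<Rightarrow> 'g::ab_group_add) set" where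
  "cochains n = {f \<in> ordered_pairs n \<rightarrow>\<^sub>E UNIV. \<forall>(u, v)\<in>ordered_pairs n. f (u, v) = - f (v, u)}"

text \<open>
  The value is set to \<open>0\<close> on the null set where one of the coordinates is \<open>0\<close>, so that
  the result is a symmetric function.
\<close>

definition graphon_of :: "nat \<Rightarrow> (nat \<times> nat \<Rightarrow> 'g) \<Rightarrow> 'g cochain_fun" where
  "graphon_of n f = (\<lambda>(x, y, g).
      if 0 < x \<and> 0 < y \<and> \<lceil>real n * x\<rceil> \<noteq> \<lceil>real n * y\<rceil>
        \<and> f (nat \<lceil>real n * x\<rceil>, nat \<lceil>real n * y\<rceil>) = g
      then 1 else 0)"

definition symmetric_nondegenerate :: "('g::{finite,ab_group_add} \<Rightarrow> real) \<Rightarrow> bool" where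
  "symmetric_nondegenerate \<nu> \<longleftrightarrow>
      (\<Sum>g\<in>UNIV. \<nu> g) = 1 \<and> (\<forall>g. 0 < \<nu> g) \<and> (\<forall>g. \<nu> g = \<nu> (- g))"

definition random_cochain :: "('g::{finite,ab_group_add} \<Rightarrow> real) \<Rightarrow> nat \<Rightarrow> 'w measure
    \<Rightarrow> ('w \<Rightarrow> nat \<times> nat \<Rightarrow> 'g) \<Rightarrow> bool" where
  "random_cochain \<nu> n M F \<longleftrightarrow> prob_space M
      \<and> (\<forall>\<omega>\<in>space M. F \<omega> \<in> cochains n)
      \<and> prob_space.indep_vars M (\<lambda>_. count_space UNIV) (\<lambda>e \<omega>. F \<omega> e)
          {(u, v). 1 \<le> u \<and> u < v \<and> v \<le> n}
      \<and> (\<forall>u v g. 1 \<le> u \<and> u < v \<and> v \<le> n \<longrightarrow> measure M {\<omega> \<in> space M. F \<omega> (u, v) = g} = \<nu> g)"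


section \<open>Well-definedness\<close>

text \<open>
  The cut distance is a pseudometric, so the quotient is a metric space and
  \<^const>\<open>cut_topology\<close> is its metric topology; the graphon of a cochain is a cochain graphon;
  and all events about the class of a random cochain graphon are measurable.
\<close>

lemma space_unit_leb [simp]: "space unit_leb = {0..1}"
  by (simp add: unit_leb_def)

lemma prob_space_unit_leb: "prob_space unit_leb"
proof
  show "emeasure unit_leb (space unit_leb) = 1"
    by (simp add: unit_leb_def emeasure_restrict_space)
qed

lemma space_square_leb [simp]: "space square_leb = {0..1} \<times> {0..1}"
  by (simp add: square_leb_def space_pair_measure)

lemma prob_space_square_leb: "prob_space square_leb"
proof -
  interpret pair_prob_space unit_leb unit_leb
    by (simp add: pair_prob_space_def pair_sigma_finite_def prob_space_unit_leb prob_space_imp_sigma_finite)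
  show ?thesis unfolding square_leb_def by unfold_locales
qed

definition bounded_kernel :: "(real \<times> real \<Rightarrow> real) \<Rightarrow> bool" where
  "bounded_kernel U \<longleftrightarrow> U \<in> borel_measurable square_leb \<and> (\<exists>C. \<forall>p\<in>space square_leb. \<bar>U p\<bar> \<le> C)"

lemma bounded_kernel_integrable: "bounded_kernel U \<Longrightarrow> integrable square_leb U"
proof -
  interpret prob_space square_leb by (rule prob_space_square_leb)
  assume "bounded_kernel U"
  then obtain C where "U \<in> borel_measurable square_leb" "\<forall>p\<in>space square_leb. \<bar>U p\<bar> \<le> C"
    unfolding bounded_kernel_def by blast
  then show ?thesis by (intro integrable_const_bound[where B=C]) auto
qed

lemma rectangle_sets: "S \<in> sets unit_leb \<Longrightarrow> T \<in> sets unit_leb \<Longrightarrow> S \<times> T \<in> sets square_leb"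
  by (simp add: square_leb_def)

lemma bounded_kernel_set_integrable: "bounded_kernel U \<Longrightarrow> S \<in> sets unit_leb \<Longrightarrow> T \<in> sets unit_leb \<Longrightarrow>
   set_integrable square_leb (S \<times> T) U"
  unfolding set_integrable_def
  by (rule integrable_mult_indicator) (auto intro: rectangle_sets bounded_kernel_integrable)

lemma cut_norm_bdd_above:
  assumes "bounded_kernel U"
  shows "bdd_above ((\<lambda>(S,T). \<bar>set_lebesgue_integral square_leb (S \<times> T) U\<bar>) ` (sets unit_leb \<times> sets unit_leb))"
proof (rule bdd_aboveI2, clarify)
  fix S T assume st: "S \<in> sets unit_leb" "T \<in> sets unit_leb"
  have "\<bar>set_lebesgue_integral square_leb (S \<times> T) U\<bar> \<le> (LINT p|square_leb. \<bar>indicator (S\<times>T) p *\<^sub>R U p\<bar>)"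
    unfolding set_lebesgue_integral_def by (rule integral_abs_bound)
  also have "\<dots> \<le> (LINT p|square_leb. \<bar>U p\<bar>)"
    using bounded_kernel_set_integrable[OF assms st] bounded_kernel_integrable[OF assms]
    unfolding set_integrable_def
    by (intro integral_mono) (auto simp: indicator_def)
  finally show "\<bar>set_lebesgue_integral square_leb (S \<times> T) U\<bar> \<le> (LINT p|square_leb. \<bar>U p\<bar>)" .
qed

lemma cut_norm_upper:
  assumes "bounded_kernel U" "S \<in> sets unit_leb" "T \<in> sets unit_leb"
  shows "\<bar>set_lebesgue_integral square_leb (S \<times> T) U\<bar> \<le> cut_norm U"
  unfolding cut_norm_def
  by (rule cSUP_upper2[where x="(S,T)", OF cut_norm_bdd_above[OF assms(1)]]) (use assms in auto)

lemma cut_norm_least: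
  assumes "\<And>S T. S \<in> sets unit_leb \<Longrightarrow> T \<in> sets unit_leb \<Longrightarrow>
      \<bar>set_lebesgue_integral square_leb (S \<times> T) U\<bar> \<le> c"
  shows "cut_norm U \<le> c"
  unfolding cut_norm_def
proof (rule cSUP_least)
  show "sets unit_leb \<times> sets unit_leb \<noteq> {}" by auto
qed (use assms in auto)

lemma cut_norm_nonneg: "bounded_kernel U \<Longrightarrow> 0 \<le> cut_norm U"
  using cut_norm_upper[of U "{}" "{}"] by (auto intro: order_trans)

lemma cut_norm_add:
  assumes "bounded_kernel U" "bounded_kernel V" shows "cut_norm (\<lambda>p. U p + V p) \<le> cut_norm U + cut_norm V"
proof (rule cut_norm_least)
  fix S T assume st: "S \<in> sets unit_leb" "T \<in> sets unit_leb"
  show "\<bar>set_lebesgue_integral square_leb (S \<times> T) (\<lambda>p. U p + V p)\<bar> \<le> cut_norm U + cut_norm V"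
    using cut_norm_upper[OF assms(1) st] cut_norm_upper[OF assms(2) st]
    by (subst set_integral_add) (auto intro: bounded_kernel_set_integrable assms st)
qed

lemma cut_norm_uminus: "cut_norm (\<lambda>p. - U p) = cut_norm U"
  unfolding cut_norm_def set_lebesgue_integral_def by simp

lemma cut_norm_cong: "(\<And>p. p \<in> {0..1} \<times> {0..1} \<Longrightarrow> U p = V p) \<Longrightarrow> cut_norm U = cut_norm V"
  unfolding cut_norm_def set_lebesgue_integral_def
  by (intro SUP_cong refl) (auto intro!: arg_cong[where f=abs] Bochner_Integration.integral_cong)

definition pull_pair :: "(real \<Rightarrow> real) \<Rightarrow> real \<times> real \<Rightarrow> real \<times> real" where
  "pull_pair \<phi> = (\<lambda>(x,y). (\<phi> x, \<phi> y))"

lemma unit_automorphismsD: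
  assumes "\<phi> \<in> unit_automorphisms"
  shows "bij_betw \<phi> {0..1} {0..1}" "\<phi> \<in> unit_leb \<rightarrow>\<^sub>M unit_leb"
    "the_inv_into {0..1} \<phi> \<in> unit_leb \<rightarrow>\<^sub>M unit_leb" "distr unit_leb unit_leb \<phi> = unit_leb"
  using assms by (auto simp: unit_automorphisms_def)

lemma pull_pair_measurable: "\<phi> \<in> unit_automorphisms \<Longrightarrow> pull_pair \<phi> \<in> square_leb \<rightarrow>\<^sub>M square_leb"
  unfolding pull_pair_def square_leb_def using unit_automorphismsD(2)[of \<phi>] by measurable

lemma distr_pull_pair: assumes "\<phi> \<in> unit_automorphisms" shows "distr square_leb square_leb (pull_pair \<phi>) = square_leb"
  unfolding pull_pair_def square_leb_def
  by (subst pair_measure_distr[symmetric])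
     (use unit_automorphismsD[OF assms] prob_space_unit_leb in \<open>auto simp: prob_space_imp_sigma_finite\<close>)

lemma bounded_kernel_pull_pair: "\<phi> \<in> unit_automorphisms \<Longrightarrow> bounded_kernel U \<Longrightarrow> bounded_kernel (U \<circ> pull_pair \<phi>)"
  unfolding bounded_kernel_def
  using pull_pair_measurable[of \<phi>] measurable_space[OF pull_pair_measurable[of \<phi>]]
  by (metis comp_apply measurable_comp)

lemma unit_automorphisms_inv: assumes "\<phi> \<in> unit_automorphisms" shows "the_inv_into {0..1} \<phi> \<in> unit_automorphisms"
proof -
  note a = unit_automorphismsD[OF assms]
  let ?p = "the_inv_into {0..1} \<phi>"
  have inj: "inj_on \<phi> {0..1}" using a(1) by (simp add: bij_betw_def)
  have e: "?p (\<phi> x) = x" if "x \<in> {0..1}" for x using the_inv_into_f_f[OF inj that] .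
  have b: "bij_betw ?p {0..1} {0..1}" by (rule bij_betw_the_inv_into[OF a(1)])
  have ii: "the_inv_into {0..1} ?p x = \<phi> x" if "x \<in> {0..1}" for x
    by (rule the_inv_into_f_eq) (use b that e a(1) in \<open>auto simp: bij_betw_def\<close>)
  have "distr unit_leb unit_leb ?p = distr (distr unit_leb unit_leb \<phi>) unit_leb ?p" by (simp only: a(4))
  also have "\<dots> = distr unit_leb unit_leb (?p \<circ> \<phi>)" using distr_distr[OF a(3) a(2)] by (simp only:)
  also have "\<dots> = distr unit_leb unit_leb (\<lambda>x. x)" by (rule distr_cong) (auto simp: e)
  finally have d: "distr unit_leb unit_leb ?p = unit_leb" by simp
  have "the_inv_into {0..1} ?p \<in> unit_leb \<rightarrow>\<^sub>M unit_leb"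
    using a(2) by (subst measurable_cong[of _ _ \<phi>]) (auto simp: ii)
  with b a d show ?thesis by (auto simp: unit_automorphisms_def)
qed

lemma unit_automorphisms_comp: assumes "\<phi> \<in> unit_automorphisms" "\<psi> \<in> unit_automorphisms" shows "\<phi> \<circ> \<psi> \<in> unit_automorphisms"
proof -
  note a = unit_automorphismsD[OF assms(1)] note b = unit_automorphismsD[OF assms(2)]
  have bb: "bij_betw (\<phi> \<circ> \<psi>) {0..1} {0..1}" using a b bij_betw_trans by blast
  have "the_inv_into {0..1} (\<phi> \<circ> \<psi>) x = the_inv_into {0..1} \<psi> (the_inv_into {0..1} \<phi> x)" if "x \<in> {0..1}" for x
    using the_inv_into_comp[of \<phi> \<psi> "{0..1}" x] a(1) b(1) that by (auto simp: bij_betw_def)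
  then have "the_inv_into {0..1} (\<phi> \<circ> \<psi>) \<in> unit_leb \<rightarrow>\<^sub>M unit_leb"
    using measurable_comp[OF a(3) b(3)]
    by (subst measurable_cong[of _ _ "the_inv_into {0..1} \<psi> \<circ> the_inv_into {0..1} \<phi>"]) auto
  moreover have "distr unit_leb unit_leb (\<phi> \<circ> \<psi>) = unit_leb"
    using distr_distr[OF a(2) b(2)] a b by simp
  ultimately show ?thesis using bb measurable_comp[OF b(2) a(2)] by (auto simp: unit_automorphisms_def)
qed

lemma unit_automorphisms_id: "(\<lambda>x. x) \<in> unit_automorphisms"
proof -
  have "the_inv_into {0..1} (\<lambda>x. x) x = x" if "x \<in> {0..1::real}" for x
    using the_inv_into_f_f[of "\<lambda>x::real. x" "{0..1}" x] that by (auto simp: inj_on_def)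
  then have "the_inv_into {0..1} (\<lambda>x. x) \<in> unit_leb \<rightarrow>\<^sub>M unit_leb"
    by (subst measurable_cong[of _ _ "\<lambda>x. x"]) auto
  then show ?thesis by (auto simp: unit_automorphisms_def bij_betw_def inj_on_def)
qed

lemma cut_norm_pull_pair_le: assumes "\<phi> \<in> unit_automorphisms" "bounded_kernel U" shows "cut_norm (U \<circ> pull_pair \<phi>) \<le> cut_norm U"
proof (rule cut_norm_least)
  fix S T assume st: "S \<in> sets unit_leb" "T \<in> sets unit_leb"
  note a = unit_automorphismsD[OF assms(1)]
  let ?q = "the_inv_into {0..1} \<phi>"
  have inj: "inj_on \<phi> {0..1}" using a(1) by (simp add: bij_betw_def)
  let ?S = "?q -` S \<inter> {0..1}" and ?T = "?q -` T \<inter> {0..1}"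
  have ST: "?S \<in> sets unit_leb" "?T \<in> sets unit_leb"
    using measurable_sets[OF a(3) st(1)] measurable_sets[OF a(3) st(2)] by auto
  have m: "(\<lambda>p. indicator (?S \<times> ?T) p *\<^sub>R U p) \<in> borel_measurable square_leb"
    using bounded_kernel_set_integrable[OF assms(2) ST] by (auto simp: set_integrable_def)
  have "set_lebesgue_integral square_leb (S \<times> T) (U \<circ> pull_pair \<phi>)
     = (LINT p|square_leb. indicator (?S \<times> ?T) (pull_pair \<phi> p) *\<^sub>R U (pull_pair \<phi> p))"
    unfolding set_lebesgue_integral_def
    using a(1) the_inv_into_f_f[OF inj]
    by (intro Bochner_Integration.integral_cong) (auto simp: pull_pair_def indicator_def bij_betw_def)
  also have "\<dots> = (LINT p|distr square_leb square_leb (pull_pair \<phi>). indicator (?S \<times> ?T) p *\<^sub>R U p)"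
    by (rule integral_distr[symmetric, OF pull_pair_measurable[OF assms(1)] m])
  also have "\<dots> = set_lebesgue_integral square_leb (?S \<times> ?T) U"
    by (simp add: distr_pull_pair[OF assms(1)] set_lebesgue_integral_def)
  finally show "\<bar>set_lebesgue_integral square_leb (S \<times> T) (U \<circ> pull_pair \<phi>)\<bar> \<le> cut_norm U"
    using cut_norm_upper[OF assms(2) ST] by simp
qed

lemma slice_bounded_kernel:
  assumes "W \<in> cochain_graphons" shows "bounded_kernel (slice W g)"
proof -
  have m: "W \<in> borel_measurable cochain_space" using assms by (simp add: cochain_graphons_def cochain_kernels_def)
  have "(\<lambda>(x,y). (x,y,g)) \<in> square_leb \<rightarrow>\<^sub>M cochain_space"
    unfolding square_leb_def cochain_space_def by measurable
  from measurable_compose[OF this m] have "slice W g \<in> borel_measurable square_leb"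
    by (simp add: slice_def split_beta' )
  moreover have "\<forall>p\<in>space square_leb. \<bar>slice W g p\<bar> \<le> 1"
    using assms by (auto simp: cochain_graphons_def slice_def)
  ultimately show ?thesis unfolding bounded_kernel_def by blast
qed

lemma bounded_kernel_diff: "bounded_kernel U \<Longrightarrow> bounded_kernel V \<Longrightarrow> bounded_kernel (\<lambda>p. U p - V p)"
proof -
  assume "bounded_kernel U" "bounded_kernel V"
  then obtain C D where "U \<in> borel_measurable square_leb" "\<forall>p\<in>space square_leb. \<bar>U p\<bar> \<le> C"
    "V \<in> borel_measurable square_leb" "\<forall>p\<in>space square_leb. \<bar>V p\<bar> \<le> D" unfolding bounded_kernel_def by blast
  then have "(\<lambda>p. U p - V p) \<in> borel_measurable square_leb" "\<forall>p\<in>space square_leb. \<bar>U p - V p\<bar> \<le> C + D"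
    by (auto, smt (verit) SigmaI atLeastAtMost_iff)
  then show ?thesis unfolding bounded_kernel_def by blast
qed

definition cut_distance_via :: "'g::finite cochain_fun \<Rightarrow> 'g cochain_fun \<Rightarrow> (real \<Rightarrow> real) \<Rightarrow> real" where
  "cut_distance_via V W \<phi> = cochain_cut_norm (\<lambda>p. V p - relabel \<phi> W p)"

lemma cut_distance_via_eq: "cut_distance_via V W \<phi> = (\<Sum>g\<in>UNIV. cut_norm (\<lambda>p. slice V g p - (slice W g \<circ> pull_pair \<phi>) p))"
  unfolding cut_distance_via_def cochain_cut_norm_def
  by (intro sum.cong refl cut_norm_cong) (auto simp: slice_def relabel_def pull_pair_def)

lemma cut_distance_via_nonneg: "\<phi> \<in> unit_automorphisms \<Longrightarrow> V \<in> cochain_graphons \<Longrightarrow> W \<in> cochain_graphons \<Longrightarrow> 0 \<le> cut_distance_via V W \<phi>"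
  unfolding cut_distance_via_eq by (intro sum_nonneg cut_norm_nonneg bounded_kernel_diff bounded_kernel_pull_pair slice_bounded_kernel)

lemma cut_distance_via_sym: assumes "\<phi> \<in> unit_automorphisms" "V \<in> cochain_graphons" "W \<in> cochain_graphons"
  shows "cut_distance_via W V (the_inv_into {0..1} \<phi>) \<le> cut_distance_via V W \<phi>"
  unfolding cut_distance_via_eq
proof (rule sum_mono)
  fix g
  let ?q = "the_inv_into {0..1} \<phi>"
  note q = unit_automorphisms_inv[OF assms(1)]
  have inj: "bij_betw \<phi> {0..1} {0..1}" using unit_automorphismsD[OF assms(1)] by simp
  let ?U = "\<lambda>p. slice V g p - (slice W g \<circ> pull_pair \<phi>) p"
  have qq: "?q x \<in> {0..1}" "\<phi> (?q x) = x" if "x \<in> {0..1}" for x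
    using that f_the_inv_into_f_bij_betw[OF inj] bij_betwE[OF bij_betw_the_inv_into[OF inj]] by auto
  have "cut_norm (\<lambda>p. slice W g p - (slice V g \<circ> pull_pair ?q) p) = cut_norm (\<lambda>p. - (slice W g p - (slice V g \<circ> pull_pair ?q) p))"
    by (simp add: cut_norm_uminus del: minus_diff_eq)
  also have "\<dots> = cut_norm (?U \<circ> pull_pair ?q)"
    by (rule cut_norm_cong) (use qq in \<open>auto simp: pull_pair_def\<close>)
  also have "\<dots> \<le> cut_norm ?U"
    by (intro cut_norm_pull_pair_le q bounded_kernel_diff bounded_kernel_pull_pair slice_bounded_kernel assms)
  finally show "cut_norm (\<lambda>p. slice W g p - (slice V g \<circ> pull_pair ?q) p) \<le> cut_norm ?U" .
qed

lemma cut_distance_via_triangle: assumes "\<phi> \<in> unit_automorphisms" "\<psi> \<in> unit_automorphisms" "U \<in> cochain_graphons" "V \<in> cochain_graphons" "W \<in> cochain_graphons"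
  shows "cut_distance_via U W (\<psi> \<circ> \<phi>) \<le> cut_distance_via U V \<phi> + cut_distance_via V W \<psi>"
  unfolding cut_distance_via_eq sum.distrib[symmetric]
proof (rule sum_mono)
  fix g
  let ?A = "\<lambda>p. slice U g p - (slice V g \<circ> pull_pair \<phi>) p"
  let ?B = "\<lambda>p. slice V g p - (slice W g \<circ> pull_pair \<psi>) p"
  have A: "bounded_kernel ?A" "bounded_kernel ?B" by (intro bounded_kernel_diff bounded_kernel_pull_pair slice_bounded_kernel assms)+
  have "cut_norm (\<lambda>p. slice U g p - (slice W g \<circ> pull_pair (\<psi> \<circ> \<phi>)) p) = cut_norm (\<lambda>p. ?A p + (?B \<circ> pull_pair \<phi>) p)"
    by (rule cut_norm_cong) (auto simp: pull_pair_def)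
  also have "\<dots> \<le> cut_norm ?A + cut_norm (?B \<circ> pull_pair \<phi>)" by (intro cut_norm_add bounded_kernel_pull_pair A assms)
  also have "\<dots> \<le> cut_norm ?A + cut_norm ?B" using cut_norm_pull_pair_le[OF assms(1) A(2)] by simp
  finally show "cut_norm (\<lambda>p. slice U g p - (slice W g \<circ> pull_pair (\<psi> \<circ> \<phi>)) p) \<le> cut_norm ?A + cut_norm ?B" .
qed

lemma cut_distance_eq: "cut_distance V W = (INF \<phi>\<in>unit_automorphisms. cut_distance_via V W \<phi>)"
  by (simp add: cut_distance_def cut_distance_via_def)

lemma unit_automorphisms_nonempty: "unit_automorphisms \<noteq> {}" using unit_automorphisms_id by auto

lemma cut_distance_via_bdd_below: "V \<in> cochain_graphons \<Longrightarrow> W \<in> cochain_graphons \<Longrightarrow> bdd_below (cut_distance_via V W ` unit_automorphisms)"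
  by (rule bdd_belowI2[where m=0]) (rule cut_distance_via_nonneg)

lemma cut_distance_nonneg: "V \<in> cochain_graphons \<Longrightarrow> W \<in> cochain_graphons \<Longrightarrow> 0 \<le> cut_distance V W"
  unfolding cut_distance_eq by (rule cINF_greatest[OF unit_automorphisms_nonempty]) (rule cut_distance_via_nonneg)

lemma cut_distance_le_via: "V \<in> cochain_graphons \<Longrightarrow> W \<in> cochain_graphons \<Longrightarrow> \<phi> \<in> unit_automorphisms \<Longrightarrow> cut_distance V W \<le> cut_distance_via V W \<phi>"
  unfolding cut_distance_eq by (rule cINF_lower[OF cut_distance_via_bdd_below])

lemma cut_distance_sym_le: "V \<in> cochain_graphons \<Longrightarrow> W \<in> cochain_graphons \<Longrightarrow> cut_distance W V \<le> cut_distance V W"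
  unfolding cut_distance_eq[of V W]
  by (rule cINF_greatest[OF unit_automorphisms_nonempty]) (meson unit_automorphisms_inv cut_distance_le_via cut_distance_via_sym order_trans)

lemma cut_distance_sym: "V \<in> cochain_graphons \<Longrightarrow> W \<in> cochain_graphons \<Longrightarrow> cut_distance W V = cut_distance V W"
  by (simp add: cut_distance_sym_le antisym)

lemma cut_distance_refl: assumes "V \<in> cochain_graphons" shows "cut_distance V V = 0"
proof -
  have "cut_norm (\<lambda>p. 0) \<le> 0"
    by (rule cut_norm_least) (simp add: set_lebesgue_integral_def)
  moreover have "cut_norm (\<lambda>p. 0) \<ge> 0"
    by (rule cut_norm_nonneg) (auto simp: bounded_kernel_def)
  moreover have "(\<lambda>p. slice V g p - (slice V g \<circ> pull_pair (\<lambda>x. x)) p) = (\<lambda>p. 0)" for g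
    by (auto simp: pull_pair_def)
  ultimately have "cut_distance_via V V (\<lambda>x. x) = 0"
    unfolding cut_distance_via_eq by simp
  then show ?thesis using cut_distance_le_via[OF assms assms unit_automorphisms_id] cut_distance_nonneg[OF assms assms] by simp
qed

lemma cut_distance_triangle: assumes "U \<in> cochain_graphons" "V \<in> cochain_graphons" "W \<in> cochain_graphons"
  shows "cut_distance U W \<le> cut_distance U V + cut_distance V W"
proof -
  have *: "cut_distance U W - cut_distance_via V W \<psi> \<le> cut_distance_via U V \<phi>" if "\<phi> \<in> unit_automorphisms" "\<psi> \<in> unit_automorphisms" for \<phi> \<psi>
    using cut_distance_via_triangle[OF that assms] cut_distance_le_via[OF assms(1,3) unit_automorphisms_comp[OF that(2,1)]] by simp
  have "cut_distance U W - cut_distance_via V W \<psi> \<le> cut_distance U V" if "\<psi> \<in> unit_automorphisms" for \<psi>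
    unfolding cut_distance_eq[of U V] by (rule cINF_greatest[OF unit_automorphisms_nonempty]) (rule *[OF _ that])
  then have "cut_distance U W - cut_distance U V \<le> cut_distance_via V W \<psi>" if "\<psi> \<in> unit_automorphisms" for \<psi>
    using that by (simp add: algebra_simps)
  then have "cut_distance U W - cut_distance U V \<le> cut_distance V W"
    unfolding cut_distance_eq[of V W] by (rule cINF_greatest[OF unit_automorphisms_nonempty])
  then show ?thesis by simp
qed

lemma equiv_cut_equiv: "equiv cochain_graphons cut_equiv"
proof (rule equivI)
  show "refl_on cochain_graphons cut_equiv" by (auto simp: refl_on_def cut_equiv_def cut_distance_refl)
  show "cut_equiv \<subseteq> cochain_graphons \<times> cochain_graphons" by (auto simp: cut_equiv_def)
  show "sym cut_equiv" by (auto simp: sym_def cut_equiv_def cut_distance_sym)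
  show "trans cut_equiv"
  proof (rule transI)
    fix x y z assume "(x, y) \<in> cut_equiv" "(y, z) \<in> cut_equiv"
    then show "(x, z) \<in> cut_equiv" using cut_distance_triangle[of x y z] cut_distance_nonneg[of x z] by (auto simp: cut_equiv_def)
  qed
qed

lemma graphon_class_in_classes: "V \<in> cochain_graphons \<Longrightarrow> graphon_class V \<in> graphon_classes"
  by (simp add: graphon_class_def graphon_classes_def quotientI)

lemma class_distance_eq: assumes "V \<in> cochain_graphons" "W \<in> cochain_graphons"
  shows "class_distance (graphon_class V) (graphon_class W) = cut_distance V W"
proof -
  have "the_elem ((\<lambda>(V, W). cut_distance V W) ` (graphon_class V \<times> graphon_class W)) = cut_distance V W"
  proof (rule the_elem_image_unique)
    show "graphon_class V \<times> graphon_class W \<noteq> {}"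
      using assms by (auto simp: graphon_class_def cut_equiv_def cut_distance_refl)
    fix p assume "p \<in> graphon_class V \<times> graphon_class W"
    then obtain A B where p: "p = (A,B)" "A \<in> cochain_graphons" "B \<in> cochain_graphons" "cut_distance V A = 0" "cut_distance W B = 0"
      by (auto simp: graphon_class_def cut_equiv_def)
    have "cut_distance V W \<le> cut_distance A B"
      using cut_distance_triangle[of V A W] cut_distance_triangle[of A B W] cut_distance_sym[of W B] p assms by simp
    moreover have "cut_distance A B \<le> cut_distance V W"
      using cut_distance_triangle[of A V B] cut_distance_triangle[of V W B] cut_distance_sym[of V A] p assms by simp
    ultimately show "(case p of (V, W) \<Rightarrow> cut_distance V W) = cut_distance V W" using p by simp
  qed
  then show ?thesis using graphon_class_in_classes[OF assms(1)] graphon_class_in_classes[OF assms(2)] by (simp add: class_distance_def)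
qed

lemma graphon_classes_rep: "A \<in> graphon_classes \<Longrightarrow> \<exists>V\<in>cochain_graphons. A = graphon_class V"
  by (auto simp: graphon_classes_def graphon_class_def quotient_def)

lemma Metric_space_graphon_classes: "Metric_space graphon_classes class_distance"
proof
  fix x y :: "'a cochain_fun set"
  have nn: "0 \<le> class_distance x y \<and> class_distance x y = class_distance y x"
  proof (cases "x \<in> graphon_classes \<and> y \<in> graphon_classes")
    case True
    then obtain V W where "V \<in> cochain_graphons" "W \<in> cochain_graphons" "x = graphon_class V" "y = graphon_class W"
      using graphon_classes_rep by blast
    then show ?thesis by (simp add: class_distance_eq cut_distance_nonneg cut_distance_sym)
  qed (auto simp: class_distance_def)
  then show "0 \<le> class_distance x y" "class_distance x y = class_distance y x" by auto
next
  fix x y :: "'a cochain_fun set" assume "x \<in> graphon_classes" "y \<in> graphon_classes"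
  then obtain V W where vw: "V \<in> cochain_graphons" "W \<in> cochain_graphons" "x = graphon_class V" "y = graphon_class W"
      using graphon_classes_rep by blast
  show "class_distance x y = 0 \<longleftrightarrow> x = y"
    using eq_equiv_class_iff[OF equiv_cut_equiv vw(1,2)] vw
    by (simp add: class_distance_eq) (simp add: graphon_class_def cut_equiv_def)
next
  fix x y z :: "'a cochain_fun set" assume "x \<in> graphon_classes" "y \<in> graphon_classes" "z \<in> graphon_classes"
  then obtain U V W where "U \<in> cochain_graphons" "V \<in> cochain_graphons" "W \<in> cochain_graphons" "x = graphon_class U" "y = graphon_class V" "z = graphon_class W"
      using graphon_classes_rep by metis
  then show "class_distance x z \<le> class_distance x y + class_distance y z"
    by (simp add: class_distance_eq cut_distance_triangle)
qed


lemma graphon_of_in_graphons: assumes f: "f \<in> cochains n" shows "graphon_of n f \<in> cochain_graphons"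
proof -
  have [measurable]: "(\<lambda>x. x) \<in> unit_leb \<rightarrow>\<^sub>M borel"
    unfolding unit_leb_def by (intro measurable_restrict_space1 measurable_completion) simp
  have "Measurable.pred cochain_space (\<lambda>(x,y,g). 0 < x \<and> 0 < y \<and> \<lceil>real n * x\<rceil> \<noteq> \<lceil>real n * y\<rceil>
      \<and> f (nat \<lceil>real n * x\<rceil>, nat \<lceil>real n * y\<rceil>) = g)"
    unfolding cochain_space_def by measurable
  then have m: "graphon_of n f \<in> borel_measurable cochain_space"
    unfolding graphon_of_def by (simp add: split_beta')
  have s: "graphon_of n f (x,y,g) = graphon_of n f (y,x,-g)" if "x \<in> {0..1}" "y \<in> {0..1}" for x y g
  proof (cases "0 < x \<and> 0 < y \<and> \<lceil>real n * x\<rceil> \<noteq> \<lceil>real n * y\<rceil>")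
    case True
    then have n: "n > 0" by (cases n) auto
    have "nat \<lceil>real n * z\<rceil> \<in> {1..n} \<and> \<lceil>real n * z\<rceil> > 0" if "0 < z" "z \<le> 1" for z
    proof -
      have p: "real n * z > 0" "real n * z \<le> real n" using n that by (auto simp: mult_le_cancel_left1)
      then have "0 < \<lceil>real n * z\<rceil>" "\<lceil>real n * z\<rceil> \<le> int n" by (simp_all add: ceiling_le_iff)
      then have "nat \<lceil>real n * z\<rceil> \<ge> 1" "nat \<lceil>real n * z\<rceil> \<le> n" by linarith+
      with \<open>0 < \<lceil>real n * z\<rceil>\<close> show ?thesis by (metis atLeastAtMost_iff)
    qed
    from this[of x] this[of y] have "(nat \<lceil>real n * x\<rceil>, nat \<lceil>real n * y\<rceil>) \<in> ordered_pairs n"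
      using that True by (auto simp: ordered_pairs_def)
    then have "f (nat \<lceil>real n * x\<rceil>, nat \<lceil>real n * y\<rceil>) = - f (nat \<lceil>real n * y\<rceil>, nat \<lceil>real n * x\<rceil>)"
      using f by (auto simp: cochains_def)
    then show ?thesis by (auto simp: graphon_of_def)
  qed (auto simp: graphon_of_def)
  have "\<bar>graphon_of n f p\<bar> \<le> 1" for p by (cases p) (auto simp: graphon_of_def)
  then have "\<exists>C. AE p in cochain_space. \<bar>graphon_of n f p\<bar> \<le> C" by blast
  moreover have "cochain_symmetric (graphon_of n f)" unfolding cochain_symmetric_def using s by blast
  ultimately have "graphon_of n f \<in> cochain_kernels" using m unfolding cochain_kernels_def by blast
  moreover have "0 \<le> graphon_of n f p \<and> graphon_of n f p \<le> 1" for p by (cases p) (auto simp: graphon_of_def)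
  ultimately show ?thesis unfolding cochain_graphons_def by blast
qed

lemma random_cochain_measurable: assumes "random_cochain \<nu> n M F" shows "F \<in> M \<rightarrow>\<^sub>M count_space (cochains n)"
proof -
  interpret prob_space M using assms by (simp add: random_cochain_def)
  have fin: "finite (ordered_pairs n)" by (rule finite_subset[of _ "{1..n}\<times>{1..n}"]) (auto simp: ordered_pairs_def)
  have "finite (ordered_pairs n \<rightarrow>\<^sub>E (UNIV::'a set))" by (intro finite_PiE fin) auto
  then have fc: "finite (cochains n :: (nat \<times> nat \<Rightarrow> 'a) set)" by (rule finite_subset[rotated]) (auto simp: cochains_def)
  have C: "F \<omega> \<in> cochains n" if "\<omega> \<in> space M" for \<omega> using assms that by (simp add: random_cochain_def)
  have m1: "(\<lambda>\<omega>. F \<omega> (u,v)) \<in> M \<rightarrow>\<^sub>M count_space UNIV" if "1 \<le> u" "u < v" "v \<le> n" for u v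
    using assms that by (auto simp: random_cochain_def indep_vars_def)
  have m: "(\<lambda>\<omega>. F \<omega> e) \<in> M \<rightarrow>\<^sub>M count_space UNIV" if "e \<in> ordered_pairs n" for e
  proof -
    obtain u v where e: "e = (u,v)" by force
    show ?thesis
    proof (cases "u < v")
      case True then show ?thesis using m1 that e by (auto simp: ordered_pairs_def)
    next
      case False
      then have vu: "v < u" "1 \<le> v" "u \<le> n" using that e by (auto simp: ordered_pairs_def)
      have "(\<lambda>\<omega>. - F \<omega> (v,u)) \<in> M \<rightarrow>\<^sub>M count_space UNIV"
        by (rule measurable_compose[OF m1[OF vu(2,1,3)]]) simp
      moreover have "F \<omega> e = - F \<omega> (v,u)" if "\<omega> \<in> space M" for \<omega>
        using C[OF that] \<open>e \<in> ordered_pairs n\<close> e by (auto simp: cochains_def)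
      ultimately show ?thesis by (subst measurable_cong[where g="\<lambda>\<omega>. - F \<omega> (v,u)"])
    qed
  qed
  show ?thesis
  proof (rule measurableI)
    fix A :: "(nat \<times> nat \<Rightarrow> 'a) set" assume "A \<in> sets (count_space (cochains n))"
    then have A: "A \<subseteq> cochains n" "finite A" using fc finite_subset by auto
    have "F -` A \<inter> space M = (\<Union>f\<in>A. {\<omega>\<in>space M. \<forall>e\<in>ordered_pairs n. F \<omega> e = f e})"
    proof (intro set_eqI iffI)
      fix \<omega> assume "\<omega> \<in> F -` A \<inter> space M" then show "\<omega> \<in> (\<Union>f\<in>A. {\<omega>\<in>space M. \<forall>e\<in>ordered_pairs n. F \<omega> e = f e})" by auto
    next
      fix \<omega> assume "\<omega> \<in> (\<Union>f\<in>A. {\<omega>\<in>space M. \<forall>e\<in>ordered_pairs n. F \<omega> e = f e})"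
      then obtain f where "f \<in> A" "\<omega> \<in> space M" "\<forall>e\<in>ordered_pairs n. F \<omega> e = f e" by auto
      moreover from this have "F \<omega> = f"
        using C[of \<omega>] A(1) by (intro PiE_ext[of _ "ordered_pairs n" "\<lambda>_. UNIV"]) (auto simp: cochains_def)
      ultimately show "\<omega> \<in> F -` A \<inter> space M" by simp
    qed
    also have "\<dots> \<in> sets M"
    proof (intro sets.finite_UN A)
      fix f
      have "{\<omega>\<in>space M. F \<omega> e = f e} \<in> sets M" if "e \<in> ordered_pairs n" for e
        using measurable_sets[OF m[OF that], of "{f e}"] by (simp add: vimage_def Int_def conj_commute)
      then show "{\<omega>\<in>space M. \<forall>e\<in>ordered_pairs n. F \<omega> e = f e} \<in> sets M"
        by (intro sets.sets_Collect_finite_All fin) auto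
    qed
    finally show "F -` A \<inter> space M \<in> sets M" .
  qed (use C in auto)
qed

lemma random_cochain_event_sets: assumes "random_cochain \<nu> n M F"
  shows "{\<omega> \<in> space M. graphon_class (graphon_of n (F \<omega>)) \<in> \<C>} \<in> sets M"
proof -
  have "{\<omega> \<in> space M. graphon_class (graphon_of n (F \<omega>)) \<in> \<C>} = F -` {f\<in>cochains n. graphon_class (graphon_of n f) \<in> \<C>} \<inter> space M"
    using assms by (auto simp: random_cochain_def)
  also have "\<dots> \<in> sets M" by (rule measurable_sets[OF random_cochain_measurable[OF assms]]) auto
  finally show ?thesis .
qed

end

theory Submission
  imports Defs "HOL-Real_Asymp.Real_Asymp"
begin

text \<open>
  The rate function is lower semicontinuous for the cut distance: for \<open>c > 0\<close> the tangent inequality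
  \<open>u ln u \<ge> u ln c + u - c\<close> is affine in \<open>u\<close>, hence passes to weak limits.

  Upper bound. Weak regularity gives every cochain a partition of \<open>[n]\<close> into boundedly many classes whose
  block averages are close to it in the cut norm. There are only \<open>exp(o(n\<^sup>2))\<close> partitions and block
  densities, and a prescribed block average has probability at most \<open>exp(- n\<^sup>2 I + O(n))\<close>, as one sees by
  comparing with the product measure whose edge marginals are the block densities. So it remains to
  pass to a limit of block graphons of bounded rate, which is possible since cochain graphons are totally
  bounded (regularity, then sorting the vertices by their class) and complete (relabel so that the
  sequence is Cauchy in the cut norm, then take the density of the limit of the integrals).

  Lower bound. The averages \<open>W\<^sub>n\<close> of \<open>W\<close> over an \<open>n \<times> n\<close> grid converge to \<open>W\<close>, and their rate is at most
  that of \<open>W\<close> by Jensen's inequality. A cochain with independent edges of marginals \<open>W\<^sub>n\<close> is close to \<open>W\<^sub>n\<close>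
  with high probability, by exponential moments and a union bound over the rectangles, and its relative
  entropy with respect to \<open>F\<^bsub>n,\<nu>\<^esub>\<close> is at most \<open>n\<^sup>2 I(W)\<close>; the data processing inequality concludes.
\<close>

subsection \<open>Weak convergence on the unit square\<close>


text \<open>The cut norm only sees rectangles, whereas the rate function and the construction of
  limits need pairings with arbitrary integrable functions. Boundedness of the kernels closes this
  gap: seminorms that are uniformly dominated by the L1 norm tend to zero on all of L1 as soon as
  they do so on a generating family of sets. On the discrete side the obstacle is the diagonal. The
  graphon of a cochain vanishes on its diagonal blocks, so it is never stochastic and has infinite
  rate. Both bounds therefore work with a filled version at distance at most 1/n, and the diagonal
  enters the entropies only through terms of order n or terms of a favourable sign. Probabilities
  count edges while the integral in the rate counts ordered pairs, which accounts for the factor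
  1/2. In the upper bound the partition is chosen separately for every cochain. In the lower bound a
  tilted probability tending to one is enough: comparing entropies of an event and its complement
  avoids any estimate of the density ratio on individual cochains.\<close>

text \<open>By the uniform domination \<open>bound\<close>, the functions along which the seminorms
  tend to zero form a closed set in L1. The factor 2 in \<open>dom\<close> is the one that
  \<open>integrable_induct\<close> supplies for its approximating functions.\<close>

lemma L1_approx_tendsto_zero:
  fixes N :: "'i \<Rightarrow> ('a \<Rightarrow> real) \<Rightarrow> real"
  assumes nonneg: "\<And>i f. integrable M f \<Longrightarrow> 0 \<le> N i f"
    and add: "\<And>i f g. integrable M f \<Longrightarrow> integrable M g \<Longrightarrow> N i (\<lambda>x. f x + g x) \<le> N i f + N i g"
    and bound: "\<And>i f. integrable M f \<Longrightarrow> N i f \<le> C * (LINT x|M. \<bar>f x\<bar>)"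
    and f: "integrable M f" and s: "\<And>k. integrable M (s k)"
    and lim: "\<And>x. x \<in> space M \<Longrightarrow> (\<lambda>k. s k x) \<longlonglongrightarrow> f x"
    and dom: "\<And>k x. x \<in> space M \<Longrightarrow> \<bar>s k x\<bar> \<le> 2 * \<bar>f x\<bar>"
    and conv: "\<And>k. ((\<lambda>i. N i (s k)) \<longlongrightarrow> 0) Fl"
  shows "((\<lambda>i. N i f) \<longlongrightarrow> 0) Fl"
proof -
  have "(\<lambda>k. LINT x|M. \<bar>f x - s k x\<bar>) \<longlonglongrightarrow> (LINT x|M. 0)"
  proof (rule integral_dominated_convergence[where w="\<lambda>x. 3 * \<bar>f x\<bar>"])
    show "AE x in M. (\<lambda>k. \<bar>f x - s k x\<bar>) \<longlonglongrightarrow> 0"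
    proof (rule AE_I2)
      fix x assume "x \<in> space M"
      then have "(\<lambda>k. f x - s k x) \<longlonglongrightarrow> f x - f x" by (intro tendsto_intros lim)
      then show "(\<lambda>k. \<bar>f x - s k x\<bar>) \<longlonglongrightarrow> 0" by (simp add: tendsto_rabs_zero)
    qed
    show "AE x in M. norm \<bar>f x - s k x\<bar> \<le> 3 * \<bar>f x\<bar>" for k
      using dom by (intro AE_I2) (smt (verit) real_norm_def)
  qed (use f s in auto)
  then have "(\<lambda>k. C * (LINT x|M. \<bar>f x - s k x\<bar>)) \<longlonglongrightarrow> C * 0" by (intro tendsto_intros) simp
  then have Ck: "(\<lambda>k. C * (LINT x|M. \<bar>f x - s k x\<bar>)) \<longlonglongrightarrow> 0" by simp
  show ?thesis
  proof (rule tendstoI)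
    fix e :: real assume e: "e > 0"
    then obtain k where k: "C * (LINT x|M. \<bar>f x - s k x\<bar>) < e / 2"
      using order_tendstoD(2)[OF Ck, of "e/2"] by (auto simp: eventually_sequentially)
    have "\<forall>\<^sub>F i in Fl. N i (s k) < e / 2" using order_tendstoD(2)[OF conv, of "e/2"] e by simp
    then show "\<forall>\<^sub>F i in Fl. dist (N i f) 0 < e"
    proof eventually_elim
      case (elim i)
      have "N i f \<le> N i (s k) + N i (\<lambda>x. f x - s k x)"
        using add[of "s k" "\<lambda>x. f x - s k x" i] f s by simp
      also have "N i (\<lambda>x. f x - s k x) \<le> C * (LINT x|M. \<bar>f x - s k x\<bar>)" using f s by (intro bound) simp
      finally show ?case using nonneg[OF f, of i] k elim by simp
    qed
  qed
qed

text \<open>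
  The seminorms \<open>N i\<close> are later instantiated both by \<open>\<lambda>f. \<bar>\<integral> f \<cdot> D i\<bar>\<close> (weak convergence) and by
  the \<open>L\<^sup>1\<close> distance of a function to its average on a grid.
\<close>

lemma seminorm_tendsto_zero:
  fixes N :: "'i \<Rightarrow> ('a \<Rightarrow> real) \<Rightarrow> real"
  assumes M: "finite_measure M" "sets M = sigma_sets (space M) G" "Int_stable G" "G \<subseteq> Pow (space M)" "space M \<in> G"
    and nonneg: "\<And>i f. integrable M f \<Longrightarrow> 0 \<le> N i f"
    and add: "\<And>i f g. integrable M f \<Longrightarrow> integrable M g \<Longrightarrow> N i (\<lambda>x. f x + g x) \<le> N i f + N i g"
    and scale: "\<And>i f c. integrable M f \<Longrightarrow> N i (\<lambda>x. c * f x) \<le> \<bar>c\<bar> * N i f"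
    and bound: "\<And>i f. integrable M f \<Longrightarrow> N i f \<le> C * (LINT x|M. \<bar>f x\<bar>)"
    and base: "\<And>A. A \<in> G \<Longrightarrow> ((\<lambda>i. N i (indicator A)) \<longlongrightarrow> 0) Fl"
    and f: "integrable M f"
  shows "((\<lambda>i. N i f) \<longlongrightarrow> 0) Fl"
proof -
  interpret finite_measure M by fact
  let ?P = "\<lambda>f. ((\<lambda>i. N i f) \<longlongrightarrow> 0) Fl"
  have P_add: "?P (\<lambda>x. f x + g x)" if "integrable M f" "integrable M g" "?P f" "?P g" for f g
    by (rule tendsto_sandwich[OF _ _ tendsto_const tendsto_add_zero[OF that(3,4)]])
       (use that in \<open>auto intro!: always_eventually nonneg add\<close>)
  have P_scale: "?P (\<lambda>x. c * f x)" if "integrable M f" "?P f" for c f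
    by (rule tendsto_sandwich[OF _ _ tendsto_const tendsto_mult_right_zero[OF that(2), of "\<bar>c\<bar>"]])
       (use that in \<open>auto intro!: always_eventually nonneg scale\<close>)
  note P_lim = L1_approx_tendsto_zero[where N=N and C=C and M=M and Fl=Fl, OF nonneg add bound]
  have int: "integrable M (indicator A :: 'a \<Rightarrow> real)" if "A \<in> sets M" for A
    using that by (simp add: integrable_indicator_iff emeasure_eq_measure)
  have P_empty: "?P (indicator {})"
    using P_scale[OF int base[OF M(5)], of 0] by (simp add: indicator_def[abs_def])
  \<comment> \<open>Dynkin's argument: complements use linearity and \<open>space M \<in> G\<close>,
    and a countable disjoint union is an L1 limit of finite ones, which \<open>P_lim\<close>
    handles.\<close>
  have ind: "?P (indicator A)" if "A \<in> sets M" for A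
    using M(3,4) that[unfolded M(2)]
  proof (induction rule: sigma_sets_induct_disjoint)
    case (basic A) then show ?case by (rule base)
  next
    case empty show ?case by (rule P_empty)
  next
    case (compl A)
    then have A: "A \<in> sets M" by (simp add: M(2))
    have "indicator (space M - A) = (\<lambda>x. indicator (space M) x + (-1) * indicator A x :: real)"
      using sets.sets_into_space[OF A] by (auto simp: indicator_def fun_eq_iff)
    moreover have "?P (\<lambda>x. indicator (space M) x + (-1) * indicator A x)"
      using A by (intro P_add P_scale compl int base M(5)) (auto intro!: int)
    ultimately show ?case by simp
  next
    case (union A)
    then have A: "A i \<in> sets M" for i by (auto simp: M(2))
    have Pn: "?P (indicator (\<Union>i<n. A i))" for n :: nat
    proof (induction n)
      case 0
      have "(\<Union>i<0. A i) = {}" by simp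
      then show ?case using P_empty by (simp only:)
    next
      case (Suc n)
      have "A i \<inter> A n = {}" if "i < n" for i using disjoint_family_onD[OF union(1), of i n] that by simp
      then have "indicator (\<Union>i<Suc n. A i) = (\<lambda>x. indicator (\<Union>i<n. A i) x + indicator (A n) x :: real)"
        by (intro ext) (auto simp: indicator_def less_Suc_eq)
      moreover have "?P (\<lambda>x. indicator (\<Union>i<n. A i) x + indicator (A n) x)"
        using A by (intro P_add Suc union int) auto
      ultimately show ?case by simp
    qed
    show ?case
    proof (rule P_lim[OF _ _ _ _ _ _ _ _ Pn])
      fix x
      show "(\<lambda>n. indicator (\<Union>i<n. A i) x :: real) \<longlonglongrightarrow> indicator (\<Union>i. A i) x"
      proof (cases "x \<in> (\<Union>i. A i)")
        case True
        then obtain i where "x \<in> A i" by auto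
        then have "\<forall>\<^sub>F n in sequentially. indicator (\<Union>i. A i) x = (indicator (\<Union>i<n. A i) x :: real)"
          unfolding eventually_sequentially by (intro exI[of _ "Suc i"]) (auto simp: indicator_def)
        then show ?thesis by (rule Lim_transform_eventually[OF tendsto_const])
      qed (auto simp: indicator_def)
    next
      show "integrable M (indicator (\<Union>i. A i) :: 'a \<Rightarrow> real)" using A by (intro int) auto
      show "integrable M (indicator (\<Union>i<n. A i) :: 'a \<Rightarrow> real)" for n :: nat using A by (intro int) auto
      show "\<bar>indicator (\<Union>i<n. A i) x\<bar> \<le> 2 * \<bar>indicator (\<Union>i. A i) x :: real\<bar>" for n :: nat and x
        by (auto simp: indicator_def)
    qed (auto intro: nonneg add bound)
  qed
  show ?thesis
    using f
  proof (induction rule: integrable_induct)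
    case (base A c)
    have "(\<lambda>x. indicator A x *\<^sub>R c) = (\<lambda>x. c * indicator A x)" by auto
    then show ?case using P_scale[OF int ind] base by simp
  next
    case (add f g) then show ?case by (intro P_add)
  next
    case (lim f s)
    then show ?case by (intro P_lim[of f s]) (auto intro: nonneg assms(7) bound)
  qed
qed

lemma rectangle_generator:
  "sets square_leb = sigma_sets (space square_leb) {S \<times> T |S T. S \<in> sets unit_leb \<and> T \<in> sets unit_leb}"
  "Int_stable {S \<times> T |S T. S \<in> sets unit_leb \<and> T \<in> sets unit_leb}"
  "{S \<times> T |S T. S \<in> sets unit_leb \<and> T \<in> sets unit_leb} \<subseteq> Pow (space square_leb)"
  "space square_leb \<in> {S \<times> T |S T. S \<in> sets unit_leb \<and> T \<in> sets unit_leb}"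
proof -
  have 1: "{0..1} \<in> sets unit_leb" using sets.top[of unit_leb] by simp
  show "sets square_leb = sigma_sets (space square_leb) {S \<times> T |S T. S \<in> sets unit_leb \<and> T \<in> sets unit_leb}"
    by (simp add: square_leb_def sets_pair_measure space_pair_measure)
  show "Int_stable {S \<times> T |S T. S \<in> sets unit_leb \<and> T \<in> sets unit_leb}" by (rule Int_stable_pair_measure_generator)
  show "{S \<times> T |S T. S \<in> sets unit_leb \<and> T \<in> sets unit_leb} \<subseteq> Pow (space square_leb)"
    using sets.sets_into_space[of _ unit_leb] by (auto dest!: subsetD)
  show "space square_leb \<in> {S \<times> T |S T. S \<in> sets unit_leb \<and> T \<in> sets unit_leb}" using 1 by auto
qed

lemma finite_measure_square_leb: "finite_measure square_leb"
  using prob_space_square_leb by (rule prob_space.finite_measure)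

lemma integrable_indicator_square: "A \<in> sets square_leb \<Longrightarrow> integrable square_leb (indicator A :: _ \<Rightarrow> real)"
  using finite_measure.emeasure_finite[OF finite_measure_square_leb, of A]
  by (intro integrable_real_indicator) (auto simp only: infinity_ennreal_def top.not_eq_extremum)

lemma integrable_mult_bounded:
  fixes f D :: "'a \<Rightarrow> real"
  assumes f: "integrable M f" and D: "D \<in> borel_measurable M" "\<And>x. x \<in> space M \<Longrightarrow> \<bar>D x\<bar> \<le> C"
  shows "integrable M (\<lambda>x. f x * D x)"
proof (rule Bochner_Integration.integrable_bound[where f="\<lambda>x. C * f x"])
  show "AE x in M. norm (f x * D x) \<le> norm (C * f x)"
  proof (rule AE_I2)
    fix x assume "x \<in> space M"
    then have "\<bar>D x\<bar> \<le> \<bar>C\<bar>" using D(2) by fastforce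
    then have "\<bar>f x\<bar> * \<bar>D x\<bar> \<le> \<bar>f x\<bar> * \<bar>C\<bar>" by (intro mult_left_mono) auto
    then show "norm (f x * D x) \<le> norm (C * f x)" by (simp add: abs_mult mult.commute)
  qed
qed (use f D in auto)

text \<open>Since the \<open>D i\<close> are bounded by 1, the absolute pairings with them are
  seminorms dominated by the L1 norm. The filter is arbitrary so that double sequences, and with
  them Cauchy properties, are covered.\<close>

lemma rectangles_tendsto_zero:
  fixes D :: "'i \<Rightarrow> real \<times> real \<Rightarrow> real"
  assumes D: "\<And>i. D i \<in> borel_measurable square_leb" "\<And>i p. p \<in> space square_leb \<Longrightarrow> \<bar>D i p\<bar> \<le> 1"
    and rect: "\<And>S T. S \<in> sets unit_leb \<Longrightarrow> T \<in> sets unit_leb \<Longrightarrow>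
      ((\<lambda>i. set_lebesgue_integral square_leb (S \<times> T) (D i)) \<longlongrightarrow> 0) Fl"
    and f: "integrable square_leb f"
  shows "((\<lambda>i. LINT p|square_leb. f p * D i p) \<longlongrightarrow> 0) Fl"
proof -
  have "((\<lambda>i. \<bar>LINT p|square_leb. f p * D i p\<bar>) \<longlongrightarrow> 0) Fl"
  proof (rule seminorm_tendsto_zero[OF finite_measure_square_leb rectangle_generator,
      where N="\<lambda>i f. \<bar>LINT p|square_leb. f p * D i p\<bar>" and C=1 and f=f and Fl=Fl])
    fix i and f g :: "real \<times> real \<Rightarrow> real" and c :: real assume f: "integrable square_leb f"
    note i = integrable_mult_bounded[OF _ D]
    show "\<bar>LINT p|square_leb. c * f p * D i p\<bar> \<le> \<bar>c\<bar> * \<bar>LINT p|square_leb. f p * D i p\<bar>"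
      by (simp add: mult.assoc abs_mult)
    have "\<bar>LINT p|square_leb. f p * D i p\<bar> \<le> (LINT p|square_leb. \<bar>f p * D i p\<bar>)" by (rule integral_abs_bound)
    also have "\<dots> \<le> (LINT p|square_leb. \<bar>f p\<bar>)"
      using D(2) f integrable_abs[OF i[OF f]]
      by (intro integral_mono) (auto simp: abs_mult intro!: mult_left_le simp del: integrable_abs_iff split_paired_All)
    finally show "\<bar>LINT p|square_leb. f p * D i p\<bar> \<le> 1 * (LINT p|square_leb. \<bar>f p\<bar>)" by simp
    assume g: "integrable square_leb g"
    show "\<bar>LINT p|square_leb. (f p + g p) * D i p\<bar> \<le> \<bar>LINT p|square_leb. f p * D i p\<bar> + \<bar>LINT p|square_leb. g p * D i p\<bar>"
      using i[OF f] i[OF g] by (simp add: algebra_simps)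
  next
    fix A assume "A \<in> {S \<times> T |S T. S \<in> sets unit_leb \<and> T \<in> sets unit_leb}"
    then show "((\<lambda>i. \<bar>LINT p|square_leb. indicator A p * D i p\<bar>) \<longlongrightarrow> 0) Fl"
      using rect by (auto simp: set_lebesgue_integral_def intro: tendsto_rabs_zero)
  qed (use f in auto)
  then show ?thesis by (simp add: tendsto_rabs_zero_iff)
qed

text \<open>Set functions that stay below one fixed finite measure have a countably additive limit,
  and the Radon-Nikodym density of this limit is the weak limit. The Cauchy condition takes the
  place of weak compactness.\<close>

lemma weak_limit_exists:
  fixes U :: "nat \<Rightarrow> real \<times> real \<Rightarrow> real"
  assumes U: "\<And>k. U k \<in> borel_measurable square_leb" "\<And>k p. p \<in> space square_leb \<Longrightarrow> 0 \<le> U k p \<and> U k p \<le> 1"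
    and cauchy: "\<And>S T. S \<in> sets unit_leb \<Longrightarrow> T \<in> sets unit_leb \<Longrightarrow>
      Cauchy (\<lambda>k. set_lebesgue_integral square_leb (S \<times> T) (U k))"
  shows "\<exists>V. V \<in> borel_measurable square_leb \<and> (\<forall>p. 0 \<le> V p \<and> V p \<le> 1)
    \<and> (\<forall>A\<in>sets square_leb. (\<lambda>k. set_lebesgue_integral square_leb A (U k)) \<longlonglongrightarrow> set_lebesgue_integral square_leb A V)"
proof -
  interpret prob_space square_leb by (rule prob_space_square_leb)
  have int: "integrable square_leb (\<lambda>p. indicator A p * U k p)" if "A \<in> sets square_leb" for A k
    using U that by (intro integrable_mult_bounded[where C=1] integrable_indicator_square) auto
  define c where "c A k = set_lebesgue_integral square_leb A (U k)" for A k
  have c_eq: "c A k = (LINT p|square_leb. indicator A p * U k p)" for A k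
    by (simp add: c_def set_lebesgue_integral_def)
  have "Cauchy (c A)" if A: "A \<in> sets square_leb" for A
  proof -
    \<comment> \<open>Along the product filter the Cauchy property becomes a limit zero, to which
      the passage from rectangles to arbitrary measurable sets applies.\<close>
    have "((\<lambda>(k,l). LINT p|square_leb. indicator A p * (U k p - U l p)) \<longlongrightarrow> 0) (sequentially \<times>\<^sub>F sequentially)"
      unfolding split_beta'
    proof (rule rectangles_tendsto_zero)
      fix S T assume st: "S \<in> sets unit_leb" "T \<in> sets unit_leb"
      show "((\<lambda>i. LINT p:S\<times>T|square_leb. U (fst i) p - U (snd i) p) \<longlongrightarrow> 0) (sequentially \<times>\<^sub>F sequentially)"
      proof (rule tendstoI)
        fix e :: real assume "e > 0"
        then obtain N where N: "dist (c (S\<times>T) m) (c (S\<times>T) n) < e" if "m \<ge> N" "n \<ge> N" for m n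
          using metric_CauchyD[OF cauchy[OF st], of e] unfolding c_def by blast
        have "(LINT p:S\<times>T|square_leb. U m p - U n p) = c (S\<times>T) m - c (S\<times>T) n" for m n
          unfolding c_eq set_lebesgue_integral_def real_scaleR_def right_diff_distrib
          using int[OF rectangle_sets[OF st]] by (intro Bochner_Integration.integral_diff) auto
        then show "\<forall>\<^sub>F i in sequentially \<times>\<^sub>F sequentially. dist (LINT p:S\<times>T|square_leb. U (fst i) p - U (snd i) p) 0 < e"
          unfolding eventually_prod_sequentially using N by (intro exI[of _ N]) (auto simp: dist_real_def)
      qed
    next
      fix i :: "nat \<times> nat" and p assume "p \<in> space square_leb"
      then show "\<bar>U (fst i) p - U (snd i) p\<bar> \<le> 1" using U(2)[of p "fst i"] U(2)[of p "snd i"] by linarith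
    qed (use U A in \<open>auto intro: integrable_indicator_square\<close>)
    moreover have "(LINT p|square_leb. indicator A p * (U k p - U l p)) = c A k - c A l" for k l
      unfolding c_eq right_diff_distrib using int[OF A] by (intro Bochner_Integration.integral_diff) auto
    ultimately have "((\<lambda>(k,l). c A k - c A l) \<longlongrightarrow> 0) (sequentially \<times>\<^sub>F sequentially)" by simp
    then show ?thesis
      unfolding tendsto_iff eventually_prod_sequentially Cauchy_def by (simp add: dist_real_def) (metis abs_minus_commute)
  qed
  then have conv: "c A \<longlonglongrightarrow> lim (c A)" if "A \<in> sets square_leb" for A
    using that by (simp add: Cauchy_convergent convergent_LIMSEQ_iff[symmetric])
  define \<mu> where "\<mu> A = lim (c A)" for A
  have c0: "0 \<le> c A k" for A k unfolding c_eq using U by (intro integral_nonneg_AE AE_I2) (auto simp: indicator_def)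
  have c1: "c A k \<le> measure square_leb A" if "A \<in> sets square_leb" for A k
  proof -
    have "c A k \<le> (LINT p|square_leb. indicator A p)" 
      unfolding c_eq using int[OF that] integrable_indicator_square[OF that]
      by (rule integral_mono) (use U in \<open>auto simp: indicator_def\<close>)
    then show ?thesis using that by (simp add: sets.Int_space_eq2 del: space_square_leb)
  qed
  have \<mu>0: "0 \<le> \<mu> A" if "A \<in> sets square_leb" for A
    unfolding \<mu>_def using c0 by (intro LIMSEQ_le_const[OF conv[OF that]]) auto
  have \<mu>1: "\<mu> A \<le> measure square_leb A" if "A \<in> sets square_leb" for A
    unfolding \<mu>_def using c1[OF that] by (intro LIMSEQ_le_const2[OF conv[OF that]]) auto
  have \<mu>_add: "\<mu> (A \<union> B) = \<mu> A + \<mu> B" if "A \<in> sets square_leb" "B \<in> sets square_leb" "A \<inter> B = {}" for A B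
  proof -
    have "c (A \<union> B) = (\<lambda>k. c A k + c B k)"
    proof
      fix k
      have "indicator (A \<union> B) p * U k p = indicator A p * U k p + indicator B p * U k p" for p
        using that(3) by (auto simp: indicator_def)
      then show "c (A \<union> B) k = c A k + c B k" unfolding c_eq using int[OF that(1)] int[OF that(2)] by simp
    qed
    moreover have "(\<lambda>k. c A k + c B k) \<longlonglongrightarrow> \<mu> A + \<mu> B" unfolding \<mu>_def by (intro tendsto_add conv that)
    ultimately show ?thesis unfolding \<mu>_def by (simp add: limI)
  qed
  define K where "K = measure_of (space square_leb) (sets square_leb) (\<lambda>A. ennreal (\<mu> A))"
  have pos: "positive (sets square_leb) (\<lambda>A. ennreal (\<mu> A))"
    using \<mu>0[of "{}"] \<mu>1[of "{}"] by (simp add: positive_def)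
  \<comment> \<open>Domination by the measure gives continuity at the empty set, which turns finite
    into countable additivity.\<close>
  have ca: "countably_additive (sets square_leb) (\<lambda>A. ennreal (\<mu> A))"
  proof (rule sets.empty_continuous_imp_countably_additive[OF pos])
    show "additive (sets square_leb) (\<lambda>A. ennreal (\<mu> A))"
      using \<mu>0 by (auto simp: additive_def \<mu>_add ennreal_plus)
    fix A :: "nat \<Rightarrow> _" assume A: "range A \<subseteq> sets square_leb" "decseq A" "(\<Inter>i. A i) = {}"
    then have "(\<lambda>i. measure square_leb (A i)) \<longlonglongrightarrow> 0"
      using finite_Lim_measure_decseq[of A] by simp
    moreover have "0 \<le> \<mu> (A i)" "\<mu> (A i) \<le> measure square_leb (A i)" for i using A(1) by (auto intro: \<mu>0 \<mu>1)
    ultimately have "(\<lambda>i. \<mu> (A i)) \<longlonglongrightarrow> 0"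
      using real_tendsto_sandwich[of "\<lambda>_. 0" "\<lambda>i. \<mu> (A i)" sequentially "\<lambda>i. measure square_leb (A i)" 0] by auto
    then show "(\<lambda>i. ennreal (\<mu> (A i))) \<longlonglongrightarrow> 0"
      using tendsto_ennrealI by fastforce
  qed auto
  have K: "emeasure K A = ennreal (\<mu> A)" if "A \<in> sets square_leb" for A
    unfolding K_def using sets.sigma_algebra_axioms pos ca that by (intro emeasure_measure_of_sigma)
  have setsK: "sets K = sets square_leb" unfolding K_def by (rule sets.sets_measure_of_eq)
  have "absolutely_continuous square_leb K"
    unfolding absolutely_continuous_def
  proof
    fix A assume "A \<in> null_sets square_leb"
    then have "A \<in> sets square_leb" "measure square_leb A = 0" by (auto simp: null_sets_def measure_def)
    then show "A \<in> null_sets K" using K[of A] \<mu>1[of A] setsK by (auto simp: null_sets_def ennreal_neg)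
  qed
  then obtain h where h: "h \<in> borel_measurable square_leb" "density square_leb h = K"
    using Radon_Nikodym[OF _ setsK] by auto
  have hA: "(\<integral>\<^sup>+p. h p * indicator A p \<partial>square_leb) = ennreal (\<mu> A)" if "A \<in> sets square_leb" for A
    using K[OF that] emeasure_density[OF h(1) that] h(2) by simp
  \<comment> \<open>The density is at most 1 only almost everywhere; truncation makes the bounds
    hold at every point, as membership in \<open>cochain_graphons\<close> asks.\<close>
  define V where "V p = min 1 (enn2real (h p))" for p
  have "AE p in square_leb. h p \<le> 1"
  proof (rule AE_upper_bound_inf_ennreal)
    fix e :: real assume e: "e > 0"
    let ?B = "{p \<in> space square_leb. h p > 1 + e}"
    have B: "?B \<in> sets square_leb" using h(1) by measurable
    have "ennreal (1 + e) * emeasure square_leb ?B = (\<integral>\<^sup>+p. ennreal (1 + e) * indicator ?B p \<partial>square_leb)"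
      by (rule nn_integral_cmult_indicator[OF B, symmetric])
    also have "\<dots> \<le> (\<integral>\<^sup>+p. h p * indicator ?B p \<partial>square_leb)"
      using e by (intro nn_integral_mono) (auto simp: indicator_def ennreal_plus)
    also have "\<dots> \<le> ennreal (measure square_leb ?B)" using hA[OF B] \<mu>1[OF B] by (simp add: ennreal_leI)
    finally have "ennreal ((1 + e) * measure square_leb ?B) \<le> ennreal (measure square_leb ?B)"
      using e by (simp add: emeasure_eq_measure ennreal_mult')
    then have "(1 + e) * measure square_leb ?B \<le> measure square_leb ?B"
      by (subst (asm) ennreal_le_iff) auto
    then have "e * measure square_leb ?B \<le> 0" by (simp add: algebra_simps)
    then have "measure square_leb ?B = 0" using e by (simp add: mult_le_0_iff measure_le_0_iff)
    then have "AE p in square_leb. \<not> (p \<in> ?B)"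
      using B by (intro AE_not_in) (auto simp: null_sets_def emeasure_eq_measure)
    then show "AE p in square_leb. h p \<le> 1 + ennreal e" 
      by (rule AE_mp) (use e in \<open>auto intro!: AE_I2 simp: not_less\<close>)
  qed
  then have hV: "AE p in square_leb. h p = ennreal (V p)"
  proof eventually_elim
    case (elim p)
    then have "enn2real (h p) \<le> 1" by (metis enn2real_1 enn2real_mono ennreal_one_less_top)
    then show ?case using elim unfolding V_def
      by (metis ennreal_enn2real_if ennreal_one_less_top infinity_ennreal_def linorder_not_le min.absorb2 top.not_eq_extremum)
  qed
  have Vm: "V \<in> borel_measurable square_leb" unfolding V_def using h(1) by measurable
  have V01: "0 \<le> V p" "V p \<le> 1" for p unfolding V_def by (auto simp: enn2real_nonneg)
  have "set_lebesgue_integral square_leb A V = \<mu> A" if A: "A \<in> sets square_leb" for A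
  proof -
    have "(\<integral>\<^sup>+p. ennreal (indicator A p * V p) \<partial>square_leb) = (\<integral>\<^sup>+p. h p * indicator A p \<partial>square_leb)"
      using hV by (intro nn_integral_cong_AE) (elim eventually_mono, auto simp: indicator_def)
    then have "ennreal (LINT p|square_leb. indicator A p * V p) = ennreal (\<mu> A)"
      using hA[OF A] Vm V01 A
      by (subst nn_integral_eq_integral[symmetric])
         (auto intro!: integrable_mult_bounded[where C=1] integrable_indicator_square)
    then show ?thesis using V01 \<mu>0[OF A] by (simp add: set_lebesgue_integral_def integral_nonneg_AE)
  qed
  then show ?thesis using Vm V01 conv unfolding \<mu>_def c_def by (intro exI[of _ V]) auto
qed

section \<open>Cochain graphons from their slices, and relabelling\<close>

text \<open>Joint measurability follows from that of the slices because the group is finite: the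
  function is a finite sum of slices, each restricted to one group element.\<close>

lemma cochain_graphonsI:
  fixes W :: "'g::{finite,ab_group_add} cochain_fun"
  assumes m: "\<And>g. slice W g \<in> borel_measurable square_leb"
    and b: "\<And>x y g. x \<in> {0..1} \<Longrightarrow> y \<in> {0..1} \<Longrightarrow> 0 \<le> W (x, y, g) \<and> W (x, y, g) \<le> 1"
    and s: "\<And>x y g. x \<in> {0..1} \<Longrightarrow> y \<in> {0..1} \<Longrightarrow> W (x, y, g) = W (y, x, - g)"
  shows "W \<in> cochain_graphons"
proof -
  have [measurable]: "slice W g \<in> borel_measurable (unit_leb \<Otimes>\<^sub>M unit_leb)" for g
    using m unfolding square_leb_def .
  have "(\<lambda>p. \<Sum>h\<in>UNIV. if snd (snd p) = h then slice W h (fst p, fst (snd p)) else 0) \<in> borel_measurable cochain_space"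
    unfolding cochain_space_def by measurable
  moreover have "(\<lambda>p. \<Sum>h\<in>UNIV. if snd (snd p) = h then slice W h (fst p, fst (snd p)) else 0) = W"
    by (auto simp: slice_def fun_eq_iff)
  ultimately have W: "W \<in> borel_measurable cochain_space" by simp
  have "AE p in cochain_space. \<bar>W p\<bar> \<le> 1"
    using b by (intro AE_I2) (auto simp: cochain_space_def space_pair_measure abs_le_iff intro: order_trans[of _ 0])
  then show ?thesis using W b s unfolding cochain_graphons_def cochain_kernels_def cochain_symmetric_def by blast
qed

lemma cochain_graphonsD:
  assumes "W \<in> cochain_graphons"
  shows "slice W g \<in> borel_measurable square_leb"
    "p \<in> space square_leb \<Longrightarrow> 0 \<le> slice W g p \<and> slice W g p \<le> 1"
    "x \<in> {0..1} \<Longrightarrow> y \<in> {0..1} \<Longrightarrow> W (x, y, g) = W (y, x, - g)"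
proof -
  show "slice W g \<in> borel_measurable square_leb" using slice_bounded_kernel[OF assms, of g] by (simp add: bounded_kernel_def)
  show "0 \<le> slice W g p \<and> slice W g p \<le> 1" if "p \<in> space square_leb"
    using that assms by (cases p) (auto simp: cochain_graphons_def slice_def)
  have "cochain_symmetric W" using assms by (simp add: cochain_graphons_def cochain_kernels_def)
  then show "W (x, y, g) = W (y, x, - g)" if "x \<in> {0..1}" "y \<in> {0..1}"
    using that unfolding cochain_symmetric_def by blast
qed

lemma slice_relabel: "slice (relabel \<phi> W) g = slice W g \<circ> pull_pair \<phi>"
  by (auto simp: slice_def relabel_def pull_pair_def)

lemma relabel_graphon:
  fixes W :: "'g::{finite,ab_group_add} cochain_fun"
  assumes "\<phi> \<in> unit_automorphisms" "W \<in> cochain_graphons" shows "relabel \<phi> W \<in> cochain_graphons"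
proof (rule cochain_graphonsI)
  show "slice (relabel \<phi> W) g \<in> borel_measurable square_leb" for g
    unfolding slice_relabel using pull_pair_measurable[OF assms(1)] cochain_graphonsD(1)[OF assms(2)] by (rule measurable_comp)
  fix x y :: real and g assume "x \<in> {0..1}" "y \<in> {0..1}"
  then have "\<phi> x \<in> {0..1}" "\<phi> y \<in> {0..1}" using unit_automorphismsD(1)[OF assms(1)] by (auto simp: bij_betw_def)
  then show "0 \<le> relabel \<phi> W (x, y, g) \<and> relabel \<phi> W (x, y, g) \<le> 1" "relabel \<phi> W (x, y, g) = relabel \<phi> W (y, x, - g)"
    using cochain_graphonsD(3)[OF assms(2), of "\<phi> x" "\<phi> y" g] assms(2)
    by (simp_all add: relabel_def cochain_graphons_def)
qed

lemma relabel_comp: "relabel \<phi> (relabel \<psi> W) = relabel (\<psi> \<circ> \<phi>) W"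
  by (auto simp: relabel_def)

lemma cut_distance_le_sum:
  assumes "V \<in> cochain_graphons" "W \<in> cochain_graphons"
  shows "cut_distance V W \<le> (\<Sum>g\<in>UNIV. cut_norm (\<lambda>p. slice V g p - slice W g p))"
proof -
  have "cut_distance_via V W (\<lambda>x. x) = (\<Sum>g\<in>UNIV. cut_norm (\<lambda>p. slice V g p - slice W g p))"
    unfolding cut_distance_via_eq by (simp add: pull_pair_def comp_def)
  then show ?thesis using cut_distance_le_via[OF assms unit_automorphisms_id] by simp
qed

lemma cut_norm_le_L1: "bounded_kernel U \<Longrightarrow> cut_norm U \<le> (LINT p|square_leb. \<bar>U p\<bar>)"
proof (rule cut_norm_least)
  fix S T assume U: "bounded_kernel U" and st: "S \<in> sets unit_leb" "T \<in> sets unit_leb"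
  have "\<bar>set_lebesgue_integral square_leb (S \<times> T) U\<bar> \<le> (LINT p|square_leb. \<bar>indicator (S\<times>T) p *\<^sub>R U p\<bar>)"
    unfolding set_lebesgue_integral_def by (rule integral_abs_bound)
  also have "\<dots> \<le> (LINT p|square_leb. \<bar>U p\<bar>)"
    using bounded_kernel_set_integrable[OF U st] bounded_kernel_integrable[OF U]
    unfolding set_integrable_def by (intro integral_mono) (auto simp: indicator_def)
  finally show "\<bar>set_lebesgue_integral square_leb (S \<times> T) U\<bar> \<le> (LINT p|square_leb. \<bar>U p\<bar>)" .
qed

lemma bounded_kernel_slice_diff:
  "V \<in> cochain_graphons \<Longrightarrow> W \<in> cochain_graphons \<Longrightarrow> bounded_kernel (\<lambda>p. slice V g p - slice W g p)"
  by (intro bounded_kernel_diff slice_bounded_kernel)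

lemma cut_distance_le_L1:
  assumes "V \<in> cochain_graphons" "W \<in> cochain_graphons"
  shows "cut_distance V W \<le> (\<Sum>g\<in>UNIV. LINT p|square_leb. \<bar>slice V g p - slice W g p\<bar>)"
  by (rule order_trans[OF cut_distance_le_sum[OF assms]])
     (intro sum_mono cut_norm_le_L1 bounded_kernel_slice_diff assms)

lemma cut_distance_relabel:
  assumes "\<phi> \<in> unit_automorphisms" "W \<in> cochain_graphons"
  shows "cut_distance (relabel \<phi> W) W = 0"
proof -
  note r = relabel_graphon[OF assms]
  have "cut_norm (\<lambda>p. 0) \<le> 0"
    by (rule cut_norm_least) (simp add: set_lebesgue_integral_def)
  then have "cut_distance_via (relabel \<phi> W) W \<phi> \<le> 0"
    unfolding cut_distance_via_eq slice_relabel by (simp add: mult_nonneg_nonpos)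
  then show ?thesis using cut_distance_le_via[OF r assms(2,1)] cut_distance_nonneg[OF r assms(2)] by simp
qed

text \<open>The infimum over relabellings may have no minimiser, hence the slack \<open>e\<close>. A
  single slice is controlled because all summands of the cut norm are nonnegative.\<close>

lemma cut_distance_attained:
  assumes "V \<in> cochain_graphons" "W \<in> cochain_graphons" "e > 0"
  obtains \<phi> where "\<phi> \<in> unit_automorphisms"
    "\<And>g. cut_norm (\<lambda>p. slice V g p - slice (relabel \<phi> W) g p) < cut_distance V W + e"
proof -
  have "(INF \<phi>\<in>unit_automorphisms. cut_distance_via V W \<phi>) < cut_distance V W + e"
    using assms(3) by (simp add: cut_distance_eq[symmetric])
  then obtain \<phi> where \<phi>: "\<phi> \<in> unit_automorphisms" "cut_distance_via V W \<phi> < cut_distance V W + e"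
    using cINF_less_iff[OF unit_automorphisms_nonempty cut_distance_via_bdd_below[OF assms(1,2)]] by auto
  have nn: "0 \<le> cut_norm (\<lambda>p. slice V g p - slice (relabel \<phi> W) g p)" for g
    by (intro cut_norm_nonneg bounded_kernel_slice_diff assms relabel_graphon \<phi>(1))
  have "cut_norm (\<lambda>p. slice V g p - slice (relabel \<phi> W) g p) \<le> cut_distance_via V W \<phi>" for g
    unfolding cut_distance_via_eq slice_relabel[symmetric]
    by (rule member_le_sum[of g UNIV]) (auto intro: nn)
  with \<phi> that show thesis by (meson le_less_trans)
qed

subsection \<open>The rate function\<close>

lemma abs_x_ln_x_le: fixes x :: real assumes "0 \<le> x" "x \<le> 1" shows "\<bar>x * ln x\<bar> \<le> 1"
proof (cases "x = 0")
  case False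
  then have "- ln x \<le> 1 / x - 1" using ln_le_minus_one[of "1/x"] assms by (simp add: ln_div)
  then have "x * (- ln x) \<le> x * (1 / x - 1)" using assms by (intro mult_left_mono) auto
  also have "\<dots> \<le> 1" using assms False by (simp add: algebra_simps)
  finally have "- (x * ln x) \<le> 1" by simp
  moreover have "x * ln x \<le> 0" using assms False by (intro mult_nonneg_nonpos) auto
  ultimately show ?thesis by linarith
qed simp

text \<open>Convexity of \<open>x * ln x\<close>, obtained from \<open>ln y \<le> y - 1\<close> at
  \<open>y = c / u\<close>.\<close>

lemma tangent_x_ln_x:
  fixes u c :: real assumes "0 \<le> u" "0 < c"
  shows "u * ln c + u - c \<le> u * ln u"
proof (cases "u = 0")
  case False
  then have u: "u > 0" using assms by simp
  have "ln (c / u) \<le> c / u - 1" using assms u by (intro ln_le_minus_one) simp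
  then have "u * ln (c / u) \<le> u * (c / u - 1)" using u by (intro mult_left_mono) auto
  then show ?thesis using u assms by (simp add: ln_div algebra_simps)
qed (use assms in simp)

definition entropy_density :: "('g::finite \<Rightarrow> real) \<Rightarrow> 'g cochain_fun \<Rightarrow> real \<times> real \<Rightarrow> real" where
  "entropy_density \<nu> W p = (\<Sum>g\<in>UNIV. slice W g p * ln (slice W g p / \<nu> g))"

lemma rate_eq: "rate \<nu> W = (if W \<in> stochastic_graphons
    then ereal (1 / 2 * (LINT p|square_leb. entropy_density \<nu> W p)) else \<infinity>)"
  by (simp add: rate_def entropy_density_def)

lemma entropy_density_eq:
  assumes "\<And>g. 0 < \<nu> g" "W \<in> cochain_graphons" "p \<in> space square_leb"
  shows "entropy_density \<nu> W p = (\<Sum>g\<in>UNIV. slice W g p * ln (slice W g p) - slice W g p * ln (\<nu> g))"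
  unfolding entropy_density_def
proof (rule sum.cong)
  fix g
  show "slice W g p * ln (slice W g p / \<nu> g) = slice W g p * ln (slice W g p) - slice W g p * ln (\<nu> g)"
    using cochain_graphonsD(2)[OF assms(2,3), where g=g] assms(1)[of g]
    by (cases "slice W g p = 0") (auto simp: ln_div algebra_simps)
qed simp

lemma integrable_slice_mult: 
  assumes "W \<in> cochain_graphons" "integrable square_leb f"
  shows "integrable square_leb (\<lambda>p. f p * slice W g p)"
  using cochain_graphonsD(1,2)[OF assms(1)] assms(2) by (intro integrable_mult_bounded[where C=1]) auto

lemma integrable_square_bounded:
  fixes f :: "real \<times> real \<Rightarrow> real"
  assumes "f \<in> borel_measurable square_leb" "\<And>p. p \<in> space square_leb \<Longrightarrow> \<bar>f p\<bar> \<le> C"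
  shows "integrable square_leb f"
  using assms by (intro bounded_kernel_integrable) (auto simp: bounded_kernel_def)

lemma integrable_slice_ln_slice:
  assumes "W \<in> cochain_graphons"
  shows "integrable square_leb (\<lambda>p. slice W g p * ln (slice W g p))"
  using cochain_graphonsD(1,2)[OF assms, where g=g] by (intro integrable_square_bounded[where C=1] abs_x_ln_x_le) auto

lemma integral_entropy_density:
  assumes "\<And>g. 0 < \<nu> g" "W \<in> cochain_graphons"
  shows "integrable square_leb (entropy_density \<nu> W)"
   "(LINT p|square_leb. entropy_density \<nu> W p) = (\<Sum>g\<in>UNIV. (LINT p|square_leb. slice W g p * ln (slice W g p))
      - ln (\<nu> g) * (LINT p|square_leb. slice W g p))"
proof -
  note i = integrable_slice_ln_slice[OF assms(2)] bounded_kernel_integrable[OF slice_bounded_kernel[OF assms(2)]]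
  show "integrable square_leb (entropy_density \<nu> W)"
    by (subst Bochner_Integration.integrable_cong[OF refl entropy_density_eq[OF assms]]) (use i in auto)
  have "(LINT p|square_leb. entropy_density \<nu> W p)
      = (LINT p|square_leb. (\<Sum>g\<in>UNIV. slice W g p * ln (slice W g p) - slice W g p * ln (\<nu> g)))"
    by (intro Bochner_Integration.integral_cong refl entropy_density_eq[OF assms])
  also have "\<dots> = (\<Sum>g\<in>UNIV. (LINT p|square_leb. slice W g p * ln (slice W g p))
      - ln (\<nu> g) * (LINT p|square_leb. slice W g p))"
    using i by (simp add: mult.commute)
  finally show "(LINT p|square_leb. entropy_density \<nu> W p) = (\<Sum>g\<in>UNIV. (LINT p|square_leb. slice W g p * ln (slice W g p))
      - ln (\<nu> g) * (LINT p|square_leb. slice W g p))" .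
qed

lemma rate_relabel:
  assumes "\<And>g. 0 < \<nu> g" "\<phi> \<in> unit_automorphisms" "W \<in> cochain_graphons"
  shows "rate \<nu> (relabel \<phi> W) = rate \<nu> W"
proof -
  note pm = pull_pair_measurable[OF assms(2)]
  note [measurable] = cochain_graphonsD(1)[OF assms(3)]
  have ed: "entropy_density \<nu> (relabel \<phi> W) p = entropy_density \<nu> W (pull_pair \<phi> p)" for p
    by (simp add: entropy_density_def slice_relabel)
  have "(LINT p|square_leb. entropy_density \<nu> W p) = (LINT p|distr square_leb square_leb (pull_pair \<phi>). entropy_density \<nu> W p)"
    by (simp add: distr_pull_pair[OF assms(2)])
  also have "\<dots> = (LINT p|square_leb. entropy_density \<nu> (relabel \<phi> W) p)"
    unfolding ed by (rule integral_distr[OF pm]) (simp add: entropy_density_def[abs_def])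
  finally have 1: "(LINT p|square_leb. entropy_density \<nu> W p) = (LINT p|square_leb. entropy_density \<nu> (relabel \<phi> W) p)" .
  have "(AE p in square_leb. (\<Sum>g\<in>UNIV. slice W g p) = 1)
     \<longleftrightarrow> (AE p in distr square_leb square_leb (pull_pair \<phi>). (\<Sum>g\<in>UNIV. slice W g p) = 1)"
    unfolding distr_pull_pair[OF assms(2)] ..
  also have "\<dots> \<longleftrightarrow> (AE p in square_leb. (\<Sum>g\<in>UNIV. slice (relabel \<phi> W) g p) = 1)"
  proof -
    have "{p \<in> space square_leb. (\<Sum>g\<in>UNIV. slice W g p) = 1} \<in> sets square_leb" by measurable
    from AE_distr_iff[OF pm this] show ?thesis by (simp only: slice_relabel comp_def)
  qed
  finally have "relabel \<phi> W \<in> stochastic_graphons \<longleftrightarrow> W \<in> stochastic_graphons"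
    using relabel_graphon[OF assms(2,3)] assms(3) by (simp add: stochastic_graphons_def)
  with 1 show ?thesis by (simp add: rate_eq)
qed

text \<open>
  Lower semicontinuity for weak convergence: the tangent inequality of \<open>x ln x\<close> at \<open>max V \<delta>\<close> is
  affine in the graphon, so it passes to the limit, and it is sharp up to \<open>O(\<delta> ln \<delta>)\<close>.
\<close>

lemma rate_weakly_lsc:
  fixes W :: "nat \<Rightarrow> 'g::{finite,ab_group_add} cochain_fun"
  assumes \<nu>: "\<And>g. 0 < \<nu> g" and W: "\<And>k. W k \<in> cochain_graphons" and V: "V \<in> cochain_graphons"
    and conv: "\<And>g S T. S \<in> sets unit_leb \<Longrightarrow> T \<in> sets unit_leb \<Longrightarrow>
       (\<lambda>k. set_lebesgue_integral square_leb (S \<times> T) (slice (W k) g)) \<longlonglongrightarrow> set_lebesgue_integral square_leb (S \<times> T) (slice V g)"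
    and rate: "\<And>k. rate \<nu> (W k) \<le> ereal a"
  shows "rate \<nu> V \<le> ereal a"
proof -
  interpret prob_space square_leb by (rule prob_space_square_leb)
  have Wm: "slice (W k) g \<in> borel_measurable square_leb" for k g by (rule cochain_graphonsD(1)[OF W])
  have Vm: "slice V g \<in> borel_measurable square_leb" for g by (rule cochain_graphonsD(1)[OF V])
  have Wb: "0 \<le> slice (W k) g p \<and> slice (W k) g p \<le> 1" if "p \<in> space square_leb" for p k g
    by (rule cochain_graphonsD(2)[OF W that])
  have Vb: "0 \<le> slice V g p \<and> slice V g p \<le> 1" if "p \<in> space square_leb" for p g
    by (rule cochain_graphonsD(2)[OF V that])
  have weak: "(\<lambda>k. LINT p|square_leb. f p * slice (W k) g p) \<longlonglongrightarrow> (LINT p|square_leb. f p * slice V g p)"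
    if f: "integrable square_leb f" for f g
  proof -
    have "(\<lambda>k. LINT p|square_leb. f p * (slice (W k) g p - slice V g p)) \<longlonglongrightarrow> 0"
    proof (rule rectangles_tendsto_zero[OF _ _ _ f])
      fix S T assume st: "S \<in> sets unit_leb" "T \<in> sets unit_leb"
      have "(LINT p:S\<times>T|square_leb. slice (W k) g p - slice V g p)
          = set_lebesgue_integral square_leb (S \<times> T) (slice (W k) g) - set_lebesgue_integral square_leb (S \<times> T) (slice V g)" for k
        by (intro set_integral_diff bounded_kernel_set_integrable st slice_bounded_kernel W V)
      then show "(\<lambda>k. LINT p:S\<times>T|square_leb. slice (W k) g p - slice V g p) \<longlonglongrightarrow> 0"
        using conv[OF st, of g] by (simp add: LIM_zero)
    next
      fix k p assume "p \<in> space square_leb"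
      then show "\<bar>slice (W k) g p - slice V g p\<bar> \<le> 1" using Wb[of p k g] Vb[of p g] by linarith
    qed (use Wm Vm in auto)
    moreover have "(LINT p|square_leb. f p * (slice (W k) g p - slice V g p))
       = (LINT p|square_leb. f p * slice (W k) g p) - (LINT p|square_leb. f p * slice V g p)" for k
      unfolding right_diff_distrib by (intro Bochner_Integration.integral_diff integrable_slice_mult W V f)
    ultimately show ?thesis by (simp add: LIM_zero_iff)
  qed
  have st: "W k \<in> stochastic_graphons" for k using rate[of k] by (auto simp: rate_def split: if_splits)
  have "AE p in square_leb. (\<Sum>g\<in>UNIV. slice V g p) = 1"
  proof -
    \<comment> \<open>\<open>E\<close> is the defect of stochasticity of the limit. Weak convergence
      tested against \<open>E\<close> itself shows that \<open>E\<close> and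
      \<open>E * (1 + E)\<close> have the same integral, so \<open>E * E\<close> integrates to
      zero.\<close>
    define E where "E p = (\<Sum>g\<in>UNIV. slice V g p) - 1" for p
    have Em: "E \<in> borel_measurable square_leb" unfolding E_def using Vm by measurable
    have Eb: "\<bar>E p\<bar> \<le> real CARD('g) + 1" if "p \<in> space square_leb" for p
    proof -
      have "(\<Sum>g\<in>UNIV. slice V g p) \<le> real CARD('g) * 1" using Vb[OF that] by (intro sum_bounded_above) auto
      moreover have "0 \<le> (\<Sum>g\<in>UNIV. slice V g p)" using Vb[OF that] by (intro sum_nonneg) auto
      ultimately show ?thesis unfolding E_def by linarith
    qed
    have Ei: "integrable square_leb E" by (rule integrable_square_bounded[OF Em Eb])
    have "(\<lambda>k. \<Sum>g\<in>UNIV. LINT p|square_leb. E p * slice (W k) g p) \<longlonglongrightarrow> (\<Sum>g\<in>UNIV. LINT p|square_leb. E p * slice V g p)"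
      by (intro tendsto_sum weak Ei)
    moreover have "(\<Sum>g\<in>UNIV. LINT p|square_leb. E p * slice (W k) g p) = (LINT p|square_leb. E p)" for k
    proof -
      have "(\<Sum>g\<in>UNIV. LINT p|square_leb. E p * slice (W k) g p) = (LINT p|square_leb. E p * (\<Sum>g\<in>UNIV. slice (W k) g p))"
        unfolding sum_distrib_left by (intro Bochner_Integration.integral_sum[symmetric] integrable_slice_mult W Ei)
      also have "\<dots> = (LINT p|square_leb. E p)"
      proof (rule integral_cong_AE)
        have "AE p in square_leb. (\<Sum>g\<in>UNIV. slice (W k) g p) = 1" using st[of k] by (simp add: stochastic_graphons_def)
        then show "AE p in square_leb. E p * (\<Sum>g\<in>UNIV. slice (W k) g p) = E p" by eventually_elim simp
      qed (use Em Wm in measurable)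
      finally show ?thesis .
    qed
    ultimately have "(LINT p|square_leb. E p) = (\<Sum>g\<in>UNIV. LINT p|square_leb. E p * slice V g p)"
      by (simp add: LIMSEQ_const_iff)
    also have "\<dots> = (LINT p|square_leb. E p * (\<Sum>g\<in>UNIV. slice V g p))"
      unfolding sum_distrib_left by (intro Bochner_Integration.integral_sum[symmetric] integrable_slice_mult V Ei)
    also have "\<dots> = (LINT p|square_leb. E p + E p * E p)" by (simp add: E_def algebra_simps)
    also have "\<dots> = (LINT p|square_leb. E p) + (LINT p|square_leb. E p * E p)"
      using integrable_mult_bounded[OF Ei Em Eb] Ei by (intro Bochner_Integration.integral_add)
    finally have "(LINT p|square_leb. E p * E p) = 0" by simp
    then have "AE p in square_leb. E p * E p = 0"
      using integrable_mult_bounded[OF Ei Em Eb] by (subst (asm) integral_nonneg_eq_0_iff_AE) auto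
    then show ?thesis by (rule AE_mp) (auto simp: E_def)
  qed
  then have Vst: "V \<in> stochastic_graphons" using V by (simp add: stochastic_graphons_def)
  define H where "H U = (LINT p|square_leb. entropy_density \<nu> U p)" for U :: "'g cochain_fun"
  have HW: "H (W k) \<le> 2 * a" for k using rate[of k] st[of k] by (simp add: rate_eq H_def)
  \<comment> \<open>Below \<open>exp (- 1)\<close> the slope \<open>ln \<delta> + 1\<close> is
    negative. This is used where V is less than \<delta>; there the tangent at \<delta> misses
    \<open>x * ln x\<close> by at most \<open>\<delta> - \<delta> * ln \<delta>\<close>.\<close>
  have main: "H V \<le> 2 * a + real CARD('g) * (\<delta> - \<delta> * ln \<delta>)" if \<delta>: "0 < \<delta>" "\<delta> < exp (- 1)" for \<delta>
  proof -
    have "\<delta> < 1" using \<delta>(2) by (smt (verit) one_le_exp_iff)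
    define c where "c g p = max (slice V g p) \<delta>" for g p
    have cm: "c g \<in> borel_measurable square_leb" for g unfolding c_def using Vm by measurable
    have c1: "\<delta> \<le> c g p" "c g p \<le> 1" if "p \<in> space square_leb" for g p
      using Vb[OF that, of g] \<open>\<delta> < 1\<close> by (auto simp: c_def)
    have lb: "\<bar>ln (c g p) + 1 - ln (\<nu> g)\<bar> \<le> \<bar>ln \<delta>\<bar> + 1 + \<bar>ln (\<nu> g)\<bar>" if "p \<in> space square_leb" for g p
    proof -
      have "ln \<delta> \<le> ln (c g p)" "ln (c g p) \<le> 0" using c1[OF that, of g] \<delta> by auto
      then show ?thesis by linarith
    qed
    have li: "integrable square_leb (\<lambda>p. ln (c g p) + 1 - ln (\<nu> g))" for g
      by (rule integrable_square_bounded[OF _ lb]) (use cm in measurable)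
    have ci: "integrable square_leb (c g)" for g
      by (rule integrable_square_bounded[OF cm, where C=1]) (use c1 \<delta> in \<open>smt (verit)\<close>)
    \<comment> \<open>\<open>L\<close> integrates the tangents at \<open>c g p\<close>: it is affine
      in the graphon, lies below the entropy of every graphon, and nearly touches it at V.\<close>
    define L where "L U = (\<Sum>g\<in>UNIV. (LINT p|square_leb. (ln (c g p) + 1 - ln (\<nu> g)) * slice U g p) - (LINT p|square_leb. c g p))"
      for U :: "'g cochain_fun"
    have L_eq: "L U = (LINT p|square_leb. (\<Sum>g\<in>UNIV. (ln (c g p) + 1 - ln (\<nu> g)) * slice U g p - c g p))"
      if "U \<in> cochain_graphons" for U
      unfolding L_def using integrable_slice_mult[OF that li] ci by simp
    have Li: "integrable square_leb (\<lambda>p. \<Sum>g\<in>UNIV. (ln (c g p) + 1 - ln (\<nu> g)) * slice U g p - c g p)"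
      if "U \<in> cochain_graphons" for U
      using integrable_slice_mult[OF that li] ci by simp
    have "L (W k) \<le> H (W k)" for k
      unfolding L_eq[OF W] H_def
    proof (rule integral_mono[OF Li[OF W] integral_entropy_density(1)[OF \<nu> W]])
      fix p assume p: "p \<in> space square_leb"
      show "(\<Sum>g\<in>UNIV. (ln (c g p) + 1 - ln (\<nu> g)) * slice (W k) g p - c g p) \<le> entropy_density \<nu> (W k) p"
        unfolding entropy_density_eq[OF \<nu> W p]
      proof (rule sum_mono)
        fix g
        show "(ln (c g p) + 1 - ln (\<nu> g)) * slice (W k) g p - c g p \<le> slice (W k) g p * ln (slice (W k) g p) - slice (W k) g p * ln (\<nu> g)"
          using tangent_x_ln_x[of "slice (W k) g p" "c g p"] Wb[OF p, of k g] c1[OF p, of g] \<delta>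
          by (simp add: algebra_simps)
      qed
    qed
    then have "L (W k) \<le> 2 * a" for k using HW order_trans by blast
    moreover have "(\<lambda>k. L (W k)) \<longlonglongrightarrow> L V"
      unfolding L_def by (intro tendsto_sum tendsto_diff tendsto_const weak li)
    ultimately have LV: "L V \<le> 2 * a" by (intro LIMSEQ_le_const2[of "\<lambda>k. L (W k)"]) auto
    have "H V - real CARD('g) * (\<delta> - \<delta> * ln \<delta>) = (LINT p|square_leb. entropy_density \<nu> V p - real CARD('g) * (\<delta> - \<delta> * ln \<delta>))"
      unfolding H_def using integral_entropy_density(1)[OF \<nu> V] by (simp add: prob_space del: space_square_leb)
    also have "\<dots> \<le> L V"
      unfolding L_eq[OF V]
    proof (rule integral_mono[OF _ Li[OF V]])
      show "integrable square_leb (\<lambda>p. entropy_density \<nu> V p - real CARD('g) * (\<delta> - \<delta> * ln \<delta>))"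
        using integral_entropy_density(1)[OF \<nu> V] by simp
      fix p assume p: "p \<in> space square_leb"
      have "(\<Sum>g\<in>UNIV. slice V g p * ln (slice V g p) - slice V g p * ln (\<nu> g) - (\<delta> - \<delta> * ln \<delta>))
         \<le> (\<Sum>g\<in>UNIV. (ln (c g p) + 1 - ln (\<nu> g)) * slice V g p - c g p)"
      proof (rule sum_mono)
        fix g
        let ?v = "slice V g p"
        have v: "0 \<le> ?v" "?v \<le> 1" using Vb[OF p] by auto
        have "?v * ln ?v - (\<delta> - \<delta> * ln \<delta>) \<le> (ln (c g p) + 1) * ?v - c g p"
        proof (cases "?v \<ge> \<delta>")
          case True
          moreover have "\<delta> * ln \<delta> \<le> 0" using \<delta> \<open>\<delta> < 1\<close> by (intro mult_nonneg_nonpos) auto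
          moreover have "(ln ?v + 1) * ?v - ?v = ?v * ln ?v" by (simp add: algebra_simps)
          ultimately show ?thesis using \<delta> unfolding c_def max_absorb1[OF True] by linarith
        next
          case False
          have "ln \<delta> < - 1" using \<delta> by (metis ln_exp ln_less_cancel_iff exp_gt_zero)
          then have "?v * (ln \<delta> + 1) \<ge> \<delta> * (ln \<delta> + 1)" using False v by (intro mult_right_mono_neg) auto
          moreover have "?v * ln ?v \<le> 0" using v by (cases "?v = 0") (auto intro!: mult_nonneg_nonpos)
          ultimately show ?thesis using False \<delta> by (simp add: c_def algebra_simps)
        qed
        then show "?v * ln ?v - ?v * ln (\<nu> g) - (\<delta> - \<delta> * ln \<delta>) \<le> (ln (c g p) + 1 - ln (\<nu> g)) * ?v - c g p"
          by (simp add: algebra_simps)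
      qed
      then show "entropy_density \<nu> V p - real CARD('g) * (\<delta> - \<delta> * ln \<delta>) \<le> (\<Sum>g\<in>UNIV. (ln (c g p) + 1 - ln (\<nu> g)) * slice V g p - c g p)"
        unfolding entropy_density_eq[OF \<nu> V p] by (simp add: sum_subtractf)
    qed
    finally show ?thesis using LV by simp
  qed
  have "((\<lambda>\<delta>::real. 2 * a + real CARD('g) * (\<delta> - \<delta> * ln \<delta>)) \<longlongrightarrow> 2 * a) (at_right 0)"
    by real_asymp
  then have "H V \<le> 2 * a"
  proof (rule tendsto_lowerbound)
    show "\<forall>\<^sub>F \<delta> in at_right 0. H V \<le> 2 * a + real CARD('g) * (\<delta> - \<delta> * ln \<delta>)"
      using eventually_at_right_real[of 0 "exp (-1)"] by (auto elim!: eventually_mono intro: main)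
  qed simp
  then show ?thesis using Vst by (simp add: rate_eq H_def)
qed

lemma rectangle_integral_diff:
  assumes "V \<in> cochain_graphons" "W \<in> cochain_graphons" "S \<in> sets unit_leb" "T \<in> sets unit_leb"
  shows "\<bar>set_lebesgue_integral square_leb (S \<times> T) (slice V g) - set_lebesgue_integral square_leb (S \<times> T) (slice W g)\<bar>
    \<le> cut_norm (\<lambda>p. slice V g p - slice W g p)"
  using cut_norm_upper[OF bounded_kernel_slice_diff[OF assms(1,2)] assms(3,4), of g]
  by (subst (asm) set_integral_diff) (auto intro: bounded_kernel_set_integrable slice_bounded_kernel assms)

text \<open>Near-optimal relabellings turn convergence of the cut distance into convergence on
  rectangles, and they leave the rate unchanged; so the weak statement applies.\<close>

lemma rate_lsc:
  fixes W :: "nat \<Rightarrow> 'g::{finite,ab_group_add} cochain_fun"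
  assumes \<nu>: "\<And>g. 0 < \<nu> g" and W: "\<And>k. W k \<in> cochain_graphons" and V: "V \<in> cochain_graphons"
    and conv: "(\<lambda>k. cut_distance V (W k)) \<longlonglongrightarrow> 0"
    and rate: "\<And>k. rate \<nu> (W k) \<le> ereal a"
  shows "rate \<nu> V \<le> ereal a"
proof -
  have "\<exists>\<phi>\<in>unit_automorphisms. \<forall>g. cut_norm (\<lambda>p. slice V g p - slice (relabel \<phi> (W k)) g p) < cut_distance V (W k) + 1 / real (Suc k)" for k
    by (rule cut_distance_attained[OF V W, of "1 / real (Suc k)" k]) auto
  then obtain \<phi> where \<phi>: "\<And>k. \<phi> k \<in> unit_automorphisms"
    "\<And>k g. cut_norm (\<lambda>p. slice V g p - slice (relabel (\<phi> k) (W k)) g p) < cut_distance V (W k) + 1 / real (Suc k)"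
    by metis
  show ?thesis
  proof (rule rate_weakly_lsc[OF \<nu> _ V, where W="\<lambda>k. relabel (\<phi> k) (W k)"])
    show g: "relabel (\<phi> k) (W k) \<in> cochain_graphons" for k by (rule relabel_graphon[OF \<phi>(1) W])
    show "rate \<nu> (relabel (\<phi> k) (W k)) \<le> ereal a" for k by (simp add: rate_relabel[OF \<nu> \<phi>(1) W] rate)
    fix g S T assume st: "S \<in> sets unit_leb" "T \<in> sets unit_leb"
    have "(\<lambda>k. cut_distance V (W k) + 1 / real (Suc k)) \<longlonglongrightarrow> 0 + 0"
      by (intro tendsto_add conv LIMSEQ_Suc[OF lim_1_over_n])
    then have lim: "(\<lambda>k. cut_distance V (W k) + 1 / real (Suc k)) \<longlonglongrightarrow> 0" by simp
    show "(\<lambda>k. set_lebesgue_integral square_leb (S \<times> T) (slice (relabel (\<phi> k) (W k)) g)) \<longlonglongrightarrow> set_lebesgue_integral square_leb (S \<times> T) (slice V g)"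
    proof (rule LIM_zero_cancel, rule Lim_null_comparison[OF _ lim], rule always_eventually, rule allI)
      fix k
      show "norm (set_lebesgue_integral square_leb (S \<times> T) (slice (relabel (\<phi> k) (W k)) g) - set_lebesgue_integral square_leb (S \<times> T) (slice V g))
        \<le> cut_distance V (W k) + 1 / real (Suc k)"
        using rectangle_integral_diff[OF V g st, of g k] \<phi>(2)[of g k] by (simp add: abs_minus_commute)
    qed
  qed
qed

lemma rate_cases: "rate \<nu> W = \<infinity> \<or> (\<exists>a. rate \<nu> W = ereal a)"
  by (cases "rate \<nu> W") (auto simp: rate_def split: if_splits)

text \<open>Lower semicontinuity along a constant sequence. Used in both directions, it makes the
  rate a function of the class.\<close>

lemma rate_le_of_cut_distance_zero:
  assumes "\<And>g. 0 < \<nu> g" "V \<in> cochain_graphons" "W \<in> cochain_graphons" "cut_distance V W = 0"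
  shows "rate \<nu> V \<le> rate \<nu> W"
  using rate_cases[of \<nu> W] rate_lsc[OF assms(1), of "\<lambda>_. W" V] assms by auto

lemma class_rate_graphon_class:
  assumes "\<And>g. 0 < \<nu> g" "W \<in> cochain_graphons"
  shows "class_rate \<nu> (graphon_class W) = rate \<nu> W"
  unfolding class_rate_def
proof (rule the_elem_image_unique)
  show "graphon_class W \<noteq> {}" using assms(2) by (auto simp: graphon_class_def cut_equiv_def cut_distance_refl)
  fix V assume "V \<in> graphon_class W"
  then have V: "V \<in> cochain_graphons" "cut_distance W V = 0" by (auto simp: graphon_class_def cut_equiv_def)
  then show "rate \<nu> V = rate \<nu> W"
    using rate_le_of_cut_distance_zero[OF assms(1) assms(2) V(1)] rate_le_of_cut_distance_zero[OF assms(1) V(1) assms(2)]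
      cut_distance_sym[OF assms(2) V(1)] by (simp add: antisym)
qed

subsection \<open>Completeness and compactness\<close>

lemma distr_swap_square: "distr square_leb square_leb prod.swap = square_leb"
proof -
  interpret pair_sigma_finite unit_leb unit_leb
    by (simp add: pair_sigma_finite_def prob_space_unit_leb prob_space_imp_sigma_finite)
  have "prod.swap = (\<lambda>(x, y). (y, x) :: real \<times> real)" by auto
  then show ?thesis using distr_pair_swap unfolding square_leb_def by simp
qed

lemma measurable_swap_square: "prod.swap \<in> square_leb \<rightarrow>\<^sub>M square_leb"
proof -
  have e: "prod.swap = (\<lambda>(x, y). (y, x) :: real \<times> real)" by auto
  show ?thesis unfolding square_leb_def e by (rule measurable_pair_swap')
qed

lemma rectangle_integral_swap:
  fixes U :: "real \<times> real \<Rightarrow> real"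
  assumes "U \<in> borel_measurable square_leb" "S \<in> sets unit_leb" "T \<in> sets unit_leb"
  shows "set_lebesgue_integral square_leb (S \<times> T) (\<lambda>p. U (prod.swap p)) = set_lebesgue_integral square_leb (T \<times> S) U"
proof -
  have "set_lebesgue_integral square_leb (T \<times> S) U = (LINT p|distr square_leb square_leb prod.swap. indicator (T \<times> S) p *\<^sub>R U p)"
    by (simp add: distr_swap_square set_lebesgue_integral_def)
  also have "\<dots> = (LINT p|square_leb. indicator (T \<times> S) (prod.swap p) *\<^sub>R U (prod.swap p))"
    by (rule integral_distr[OF measurable_swap_square]) (use assms rectangle_sets in measurable)
  also have "\<dots> = set_lebesgue_integral square_leb (S \<times> T) (\<lambda>p. U (prod.swap p))"
    unfolding set_lebesgue_integral_def by (intro Bochner_Integration.integral_cong refl) (auto simp: indicator_def)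
  finally show ?thesis by simp
qed

lemma geometric_cauchy:
  fixes a :: "nat \<Rightarrow> real"
  assumes "\<And>k. \<bar>a k - a (Suc k)\<bar> \<le> 2 * (1/2)^k"
  shows "\<bar>a k - a (k + m)\<bar> \<le> 4 * (1/2)^k"
proof -
  \<comment> \<open>The subtracted term is the remaining tail of the geometric series; with it the
    bound becomes inductive.\<close>
  have "\<bar>a k - a (k + m)\<bar> \<le> 4 * (1/2)^k - 4 * (1/2)^(k+m)"
  proof (induction m)
    case (Suc m)
    have "\<bar>a k - a (k + Suc m)\<bar> \<le> \<bar>a k - a (k + m)\<bar> + \<bar>a (k + m) - a (Suc (k + m))\<bar>" by simp
    also have "\<dots> \<le> 4 * (1/2)^k - 4 * (1/2)^(k+m) + 2 * (1/2)^(k+m)" using Suc assms by (intro add_mono) auto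
    also have "\<dots> = 4 * (1/2)^k - 4 * (1/2)^(k + Suc m)" by simp
    finally show ?case .
  qed simp
  also have "\<dots> \<le> 4 * (1/2)^k" by simp
  finally show ?thesis .
qed

text \<open>The bounds on consecutive terms are uniform over rectangles. They survive the passage to
  the weak limit of each slice and become a bound in the cut norm.\<close>

lemma cut_norm_Cauchy_limit:
  fixes Y :: "nat \<Rightarrow> 'g::{finite,ab_group_add} cochain_fun"
  assumes Y: "\<And>k. Y k \<in> cochain_graphons"
    and step: "\<And>k g. cut_norm (\<lambda>p. slice (Y k) g p - slice (Y (Suc k)) g p) \<le> 2 * (1/2)^k"
  shows "\<exists>V\<in>cochain_graphons. \<forall>k g. cut_norm (\<lambda>p. slice (Y k) g p - slice V g p) \<le> 4 * (1/2)^k"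
proof -
  define c where "c g A k = set_lebesgue_integral square_leb A (slice (Y k) g)" for g A k
  have c: "\<bar>c g (S \<times> T) k - c g (S \<times> T) (k + m)\<bar> \<le> 4 * (1/2)^k" if "S \<in> sets unit_leb" "T \<in> sets unit_leb" for g S T k m
    by (rule geometric_cauchy) (use rectangle_integral_diff[OF Y Y that] step order_trans in \<open>unfold c_def, blast\<close>)
  have lim0: "(\<lambda>k::nat. 4 * (1/2)^k :: real) \<longlonglongrightarrow> 0"
    by (intro tendsto_mult_right_zero LIMSEQ_power_zero) auto
  have "Cauchy (c g (S \<times> T))" if st: "S \<in> sets unit_leb" "T \<in> sets unit_leb" for g S T
  proof (rule CauchyI')
    fix e :: real assume "e > 0"
    then obtain M where M: "4 * (1/2)^k < e" if "k \<ge> M" for k :: nat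
      using order_tendstoD(2)[OF lim0, of e] by (auto simp: eventually_sequentially)
    have "dist (c g (S \<times> T) m) (c g (S \<times> T) n) < e" if "m \<ge> M" "n > m" for m n
      using c[OF st, of g m "n - m"] M[OF that(1)] that(2) by (simp add: dist_real_def)
    then show "\<exists>M. \<forall>m\<ge>M. \<forall>n>m. dist (c g (S \<times> T) m) (c g (S \<times> T) n) < e" by blast
  qed
  then have "\<exists>V. V \<in> borel_measurable square_leb \<and> (\<forall>p. 0 \<le> V p \<and> V p \<le> 1)
    \<and> (\<forall>A\<in>sets square_leb. c g A \<longlonglongrightarrow> set_lebesgue_integral square_leb A V)" for g
    unfolding c_def by (intro weak_limit_exists cochain_graphonsD[OF Y]) auto
  then obtain v where v: "\<And>g. v g \<in> borel_measurable square_leb" "\<And>g p. 0 \<le> v g p" "\<And>g p. v g p \<le> 1"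
    "\<And>g A. A \<in> sets square_leb \<Longrightarrow> c g A \<longlonglongrightarrow> set_lebesgue_integral square_leb A (v g)"
    by metis
  \<comment> \<open>Weak limits are determined only up to null sets, so the \<open>v g\<close> may
    violate symmetry at some points. Symmetrising repairs this and, by the symmetry of the
    \<open>Y k\<close>, preserves all integrals over rectangles.\<close>
  define V :: "'g cochain_fun" where "V = (\<lambda>(x, y, g). (v g (x, y) + v (- g) (y, x)) / 2)"
  have sV: "slice V g = (\<lambda>p. 1 / 2 * v g p + 1 / 2 * v (- g) (prod.swap p))" for g by (auto simp: slice_def V_def)
  note sm = measurable_compose[OF measurable_swap_square v(1)]
  have V: "V \<in> cochain_graphons"
  proof (rule cochain_graphonsI)
    show "slice V g \<in> borel_measurable square_leb" for g
      unfolding sV using v(1) sm by measurable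
    show "0 \<le> V (x, y, g) \<and> V (x, y, g) \<le> 1" for x y g
      using v(2,3)[of g "(x,y)"] v(2,3)[of "- g" "(y,x)"] by (auto simp: V_def)
  qed (auto simp: V_def)
  have "cut_norm (\<lambda>p. slice (Y k) g p - slice V g p) \<le> 4 * (1/2)^k" for k g
  proof (rule cut_norm_least)
    fix S T assume st: "S \<in> sets unit_leb" "T \<in> sets unit_leb"
    note r = rectangle_sets[OF st] rectangle_sets[OF st(2,1)]
    have cs: "c (- g) (T \<times> S) = c g (S \<times> T)"
    proof
      fix k
      have "c (- g) (T \<times> S) k = set_lebesgue_integral square_leb (S \<times> T) (\<lambda>p. slice (Y k) (- g) (prod.swap p))"
        unfolding c_def by (rule rectangle_integral_swap[symmetric]) (auto intro: cochain_graphonsD[OF Y] st)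
      also have "\<dots> = c g (S \<times> T) k"
        unfolding c_def set_lebesgue_integral_def
      proof (intro Bochner_Integration.integral_cong refl arg_cong2[where f=scaleR])
        fix p assume "p \<in> space square_leb"
        then show "slice (Y k) (- g) (prod.swap p) = slice (Y k) g p"
          using cochain_graphonsD(3)[OF Y[of k], of "fst p" "snd p" g] by (auto simp: slice_def)
      qed
      finally show "c (- g) (T \<times> S) k = c g (S \<times> T) k" .
    qed
    have "set_lebesgue_integral square_leb (S \<times> T) (v g) = set_lebesgue_integral square_leb (T \<times> S) (v (- g))"
      using LIMSEQ_unique[OF v(4)[OF r(1), of g] v(4)[OF r(2), of "- g", unfolded cs]] .
    also have "\<dots> = set_lebesgue_integral square_leb (S \<times> T) (\<lambda>p. v (- g) (prod.swap p))"
      by (rule rectangle_integral_swap[symmetric]) (auto intro: v st)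
    finally have e: "set_lebesgue_integral square_leb (S \<times> T) (\<lambda>p. v (- g) (prod.swap p)) = set_lebesgue_integral square_leb (S \<times> T) (v g)" ..
    have si: "set_integrable square_leb (S \<times> T) (v g)" "set_integrable square_leb (S \<times> T) (\<lambda>p. v (- g) (prod.swap p))"
      using v sm by (auto intro!: bounded_kernel_set_integrable[OF _ st] exI[of _ 1] simp: bounded_kernel_def abs_le_iff order_trans[of _ 0])
    have lim: "c g (S \<times> T) \<longlonglongrightarrow> set_lebesgue_integral square_leb (S \<times> T) (slice V g)"
      using v(4)[OF r(1), of g] si unfolding sV by (subst set_integral_add) (auto simp: e)
    have "(\<lambda>m. \<bar>c g (S \<times> T) k - c g (S \<times> T) (m + k)\<bar>) \<longlonglongrightarrow> \<bar>c g (S \<times> T) k - set_lebesgue_integral square_leb (S \<times> T) (slice V g)\<bar>"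
      by (intro tendsto_intros LIMSEQ_ignore_initial_segment lim)
    then have "\<bar>c g (S \<times> T) k - set_lebesgue_integral square_leb (S \<times> T) (slice V g)\<bar> \<le> 4 * (1/2)^k"
      by (rule LIMSEQ_le_const2) (use c[OF st, of g k] in \<open>auto simp: add.commute\<close>)
    then show "\<bar>LINT p:S \<times> T|square_leb. slice (Y k) g p - slice V g p\<bar> \<le> 4 * (1/2)^k"
      unfolding c_def by (subst set_integral_diff) (auto intro: bounded_kernel_set_integrable slice_bounded_kernel Y V st)
  qed
  with V show ?thesis by blast
qed

lemma cut_distance_complete:
  fixes W :: "nat \<Rightarrow> 'g::{finite,ab_group_add} cochain_fun"
  assumes W: "\<And>k. W k \<in> cochain_graphons"
    and cauchy: "\<And>e. e > 0 \<Longrightarrow> \<exists>N. \<forall>m\<ge>N. \<forall>n\<ge>N. cut_distance (W m) (W n) < e"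
  shows "\<exists>V\<in>cochain_graphons. (\<lambda>k. cut_distance (W k) V) \<longlonglongrightarrow> 0"
proof -
  have "\<exists>N. \<forall>m\<ge>N. \<forall>n\<ge>N. cut_distance (W m) (W n) < (1/2)^k" for k :: nat by (rule cauchy) simp
  then obtain N :: "nat \<Rightarrow> nat" where N: "\<And>k m n. m \<ge> N k \<Longrightarrow> n \<ge> N k \<Longrightarrow> cut_distance (W m) (W n) < (1/2)^k"
    by metis
  \<comment> \<open>Partial sums give indices that are nondecreasing and at least
    \<open>N k\<close>.\<close>
  define r where "r k = (\<Sum>i\<le>k. N i)" for k
  have rN: "N k \<le> r k" for k unfolding r_def by (rule member_le_sum) auto
  have rS: "r k \<le> r (Suc k)" for k by (simp add: r_def)
  define X where "X k = W (r k)" for k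
  have X: "X k \<in> cochain_graphons" for k by (simp add: X_def W)
  have "\<exists>\<phi>\<in>unit_automorphisms. \<forall>g. cut_norm (\<lambda>p. slice (X k) g p - slice (relabel \<phi> (X (Suc k))) g p) \<le> 2 * (1/2)^k" for k
  proof -
    have "cut_distance (X k) (X (Suc k)) < (1/2)^k" unfolding X_def using rN[of k] rS[of k] by (intro N) auto
    moreover obtain \<phi> where \<phi>: "\<phi> \<in> unit_automorphisms"
      "\<And>g. cut_norm (\<lambda>p. slice (X k) g p - slice (relabel \<phi> (X (Suc k))) g p) < cut_distance (X k) (X (Suc k)) + (1/2)^k"
      by (rule cut_distance_attained[OF X[of k] X[of "Suc k"], of "(1/2)^k"]) auto
    ultimately have "cut_norm (\<lambda>p. slice (X k) g p - slice (relabel \<phi> (X (Suc k))) g p) \<le> 2 * (1/2)^k" for g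
      using \<phi>(2)[of g] by linarith
    with \<phi>(1) show ?thesis by blast
  qed
  then obtain \<phi> where \<phi>: "\<And>k. \<phi> k \<in> unit_automorphisms"
    "\<And>k g. cut_norm (\<lambda>p. slice (X k) g p - slice (relabel (\<phi> k) (X (Suc k))) g p) \<le> 2 * (1/2)^k" by metis
  \<comment> \<open>Composed relabellings. The difference of consecutive \<open>Y\<close> is the
    k-th near-optimal difference pulled back by \<open>\<psi> k\<close>, and pulling back does not
    increase the cut norm.\<close>
  define \<psi> where "\<psi> = rec_nat (\<lambda>x. x) (\<lambda>k f. \<phi> k \<circ> f)"
  have \<psi>S: "\<psi> (Suc k) = \<phi> k \<circ> \<psi> k" for k by (simp add: \<psi>_def)
  have \<psi>: "\<psi> k \<in> unit_automorphisms" for k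
  proof (induction k)
    case 0 then show ?case by (simp add: \<psi>_def unit_automorphisms_id)
  next
    case (Suc k) then show ?case unfolding \<psi>S by (rule unit_automorphisms_comp[OF \<phi>(1)])
  qed
  define Y where "Y k = relabel (\<psi> k) (X k)" for k
  have Y: "Y k \<in> cochain_graphons" for k unfolding Y_def by (rule relabel_graphon[OF \<psi> X])
  have "cut_norm (\<lambda>p. slice (Y k) g p - slice (Y (Suc k)) g p) \<le> 2 * (1/2)^k" for k g
  proof -
    have "(\<lambda>p. slice (Y k) g p - slice (Y (Suc k)) g p) = (\<lambda>p. slice (X k) g p - slice (relabel (\<phi> k) (X (Suc k))) g p) \<circ> pull_pair (\<psi> k)"
      unfolding Y_def \<psi>S relabel_comp[symmetric] slice_relabel by auto
    then have "cut_norm (\<lambda>p. slice (Y k) g p - slice (Y (Suc k)) g p) \<le> cut_norm (\<lambda>p. slice (X k) g p - slice (relabel (\<phi> k) (X (Suc k))) g p)"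
      using cut_norm_pull_pair_le[OF \<psi>[of k] bounded_kernel_slice_diff[OF X[of k] relabel_graphon[OF \<phi>(1)[of k] X[of "Suc k"]], of g]] by simp
    then show ?thesis using \<phi>(2) order_trans by blast
  qed
  from cut_norm_Cauchy_limit[OF Y this] obtain V where V: "V \<in> cochain_graphons"
    and YV: "\<And>k g. cut_norm (\<lambda>p. slice (Y k) g p - slice V g p) \<le> 4 * (1/2)^k" by blast
  have XV: "cut_distance (X k) V \<le> real CARD('g) * (4 * (1/2)^k)" for k
  proof -
    have "cut_distance (X k) V \<le> cut_distance (X k) (Y k) + cut_distance (Y k) V" by (rule cut_distance_triangle[OF X Y V])
    also have "cut_distance (X k) (Y k) = 0"
      using cut_distance_relabel[OF \<psi> X] cut_distance_sym[OF X Y] unfolding Y_def by metis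
    also have "cut_distance (Y k) V \<le> (\<Sum>g\<in>UNIV. cut_norm (\<lambda>p. slice (Y k) g p - slice V g p))"
      by (rule cut_distance_le_sum[OF Y V])
    also have "\<dots> \<le> (\<Sum>g\<in>(UNIV::'g set). 4 * (1/2)^k)" by (intro sum_mono YV)
    finally show ?thesis by simp
  qed
  have lim0: "(\<lambda>k::nat. real CARD('g) * (4 * (1/2)^k) + (1/2)^k :: real) \<longlonglongrightarrow> 0"
    by (intro tendsto_add_zero tendsto_mult_right_zero LIMSEQ_power_zero) auto
  have "(\<lambda>k. cut_distance (W k) V) \<longlonglongrightarrow> 0"
  proof (rule LIMSEQ_I)
    fix e :: real assume "e > 0"
    then obtain k where k: "real CARD('g) * (4 * (1/2)^k) + (1/2)^k < e"
      using order_tendstoD(2)[OF lim0, of e] by (auto simp: eventually_sequentially)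
    have "cut_distance (W n) V < e" if "n \<ge> N k" for n
    proof -
      have "cut_distance (W n) V \<le> cut_distance (W n) (X k) + cut_distance (X k) V" by (rule cut_distance_triangle[OF W X V])
      moreover have "cut_distance (W n) (X k) < (1/2)^k" unfolding X_def by (rule N[OF that rN])
      ultimately show ?thesis using XV[of k] k by linarith
    qed
    then show "\<exists>no. \<forall>n\<ge>no. norm (cut_distance (W n) V - 0) < e" using cut_distance_nonneg[OF W V] by auto
  qed
  with V show ?thesis by blast
qed

text \<open>Total boundedness is asked of a subset \<open>S\<close> since nets will be constructed
  for the graphons of cochains. Only completeness concerns the whole space, where the limit
  lives.\<close>

lemma cut_distance_convergent_subsequence:
  fixes W :: "nat \<Rightarrow> 'g::{finite,ab_group_add} cochain_fun"
  assumes S: "S \<subseteq> cochain_graphons"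
    and net: "\<And>e. e > 0 \<Longrightarrow> \<exists>N. finite N \<and> N \<subseteq> cochain_graphons \<and> (\<forall>U\<in>S. \<exists>V\<in>N. cut_distance U V < e)"
    and W: "\<And>k. W k \<in> S"
  shows "\<exists>r V. strict_mono r \<and> V \<in> cochain_graphons \<and> (\<lambda>k. cut_distance (W (r k)) V) \<longlonglongrightarrow> 0"
proof -
  interpret Metric_space "graphon_classes :: 'g cochain_fun set set" class_distance by (rule Metric_space_graphon_classes)
  have "mtotally_bounded (graphon_class ` S)"
    unfolding mtotally_bounded_def
  proof (intro allI impI)
    fix e :: real assume "e > 0"
    then obtain N where N: "finite N" "N \<subseteq> cochain_graphons" "\<forall>U\<in>S. \<exists>V\<in>N. cut_distance U V < e / 2"
      using net[of "e/2"] by auto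
    \<comment> \<open>\<open>mtotally_bounded\<close> wants centres inside the set, so each net
      point that is close to \<open>S\<close> is replaced by a nearby element of \<open>S\<close>;
      this doubles the radius.\<close>
    define rep where "rep V = (SOME U. U \<in> S \<and> cut_distance U V < e / 2)" for V
    let ?N = "{V\<in>N. \<exists>U\<in>S. cut_distance U V < e / 2}"
    have rep: "rep V \<in> S \<and> cut_distance (rep V) V < e / 2" if "V \<in> ?N" for V
      using that someI_ex[of "\<lambda>U. U \<in> S \<and> cut_distance U V < e / 2"] unfolding rep_def by blast
    show "\<exists>K. finite K \<and> K \<subseteq> graphon_class ` S \<and> graphon_class ` S \<subseteq> (\<Union>x\<in>K. mball x e)"
    proof (intro exI[of _ "graphon_class ` rep ` ?N"] conjI)
      show "graphon_class ` S \<subseteq> (\<Union>x\<in>graphon_class ` rep ` ?N. mball x e)"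
      proof
        fix A assume "A \<in> graphon_class ` S"
        then obtain U where U: "U \<in> S" "A = graphon_class U" by auto
        then obtain V where V: "V \<in> N" "cut_distance U V < e / 2" using N(3) by auto
        then have VN: "V \<in> ?N" using U by auto
        have g: "U \<in> cochain_graphons" "V \<in> cochain_graphons" "rep V \<in> cochain_graphons"
          using U V N(2) S rep[OF VN] by auto
        have "cut_distance (rep V) U \<le> cut_distance (rep V) V + cut_distance V U" by (rule cut_distance_triangle[OF g(3,2,1)])
        then have "cut_distance (rep V) U < e" using rep[OF VN] V cut_distance_sym[OF g(1,2)] by simp
        then have "A \<in> mball (graphon_class (rep V)) e"
          using g U by (simp add: graphon_class_in_classes class_distance_eq)
        then show "A \<in> (\<Union>x\<in>graphon_class ` rep ` ?N. mball x e)" using VN by blast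
      qed
    qed (use N(1) rep in auto)
  qed
  moreover have "range (\<lambda>k. graphon_class (W k)) \<subseteq> graphon_class ` S" using W by auto
  ultimately obtain r where r: "strict_mono r" "MCauchy ((\<lambda>k. graphon_class (W k)) \<circ> r)"
    unfolding mtotally_bounded_sequentially by blast
  have Wg: "W k \<in> cochain_graphons" for k using W S by auto
  have "\<exists>N. \<forall>m\<ge>N. \<forall>n\<ge>N. cut_distance (W (r m)) (W (r n)) < e" if "e > 0" for e
    using r(2) that unfolding MCauchy_def by (auto simp: class_distance_eq[OF Wg Wg])
  from cut_distance_complete[OF Wg this] r(1) show ?thesis by blast
qed

subsection \<open>Functions on a grid\<close>

text \<open>The cells are half open, as in \<^const>\<open>graphon_of\<close>, except that the first one contains \<open>0\<close>.\<close>

definition cell :: "nat \<Rightarrow> real \<Rightarrow> nat" where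
  "cell n x = max 1 (nat \<lceil>real n * x\<rceil>)"

definition cell_set :: "nat \<Rightarrow> nat \<Rightarrow> real set" where
  "cell_set n u = {x \<in> {0..1}. cell n x = u}"

lemma cell_eq_iff:
  assumes "n \<ge> 1" "u \<ge> 1" "0 < x"
  shows "cell n x = u \<longleftrightarrow> (real u - 1) / real n < x \<and> x \<le> real u / real n"
proof -
  have p: "real n * x > 0" using assms by simp
  then have "1 \<le> nat \<lceil>real n * x\<rceil>" by linarith
  then have "cell n x = u \<longleftrightarrow> \<lceil>real n * x\<rceil> = int u" unfolding cell_def using assms by auto
  also have "\<dots> \<longleftrightarrow> real u - 1 < real n * x \<and> real n * x \<le> real u" by (simp add: ceiling_eq_iff)
  also have "\<dots> \<longleftrightarrow> (real u - 1) / real n < x \<and> x \<le> real u / real n"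
    using assms by (simp add: field_simps)
  finally show ?thesis .
qed

lemma cell_range: assumes "n \<ge> 1" "x \<in> {0..1}" shows "cell n x \<in> {1..n}"
proof -
  have "real n * x \<le> real n" using assms by (simp add: mult_left_le)
  then have "nat \<lceil>real n * x\<rceil> \<le> n" by (simp add: nat_le_iff ceiling_le_iff)
  moreover have "max 1 k \<in> {1..n}" if "k \<le> n" for k using assms(1) that by auto
  ultimately show ?thesis unfolding cell_def by blast
qed

lemma cell_zero: "cell n 0 = 1" by (simp add: cell_def)

lemma measurable_id_unit_leb: "(\<lambda>x. x) \<in> unit_leb \<rightarrow>\<^sub>M borel"
  unfolding unit_leb_def by (intro measurable_restrict_space1 measurable_completion) simp

lemma measurable_cell [measurable]: "cell n \<in> unit_leb \<rightarrow>\<^sub>M count_space UNIV"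
proof -
  note [measurable] = measurable_id_unit_leb
  show ?thesis unfolding cell_def by measurable
qed

lemma cell_set_sets [simp]: "cell_set n u \<in> sets unit_leb"
proof -
  have "cell_set n u = cell n -` {u} \<inter> space unit_leb" by (auto simp: cell_set_def)
  then show ?thesis using measurable_sets[OF measurable_cell, of "{u}" n] by simp
qed

lemma Int_cell_set [simp]: "{0..1} \<inter> cell_set n u = cell_set n u"
  by (auto simp: cell_set_def)

lemma sets_unit_leb_iff: "A \<in> sets unit_leb \<longleftrightarrow> A \<in> sets lebesgue \<and> A \<subseteq> {0..1}"
  unfolding unit_leb_def by (subst sets_restrict_space_iff) auto

lemma measure_unit_leb: "A \<subseteq> {0..1} \<Longrightarrow> measure unit_leb A = measure lebesgue A"
  unfolding unit_leb_def by (rule measure_restrict_space) auto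

lemma measure_cell_set:
  assumes n: "n \<ge> 1" and u: "u \<in> {1..n}"
  shows "measure unit_leb (cell_set n u) = 1 / real n"
proof -
  have "0 \<le> (real u - 1) / real n" "real u / real n \<le> 1" using assms by auto
  then have sub: "{(real u - 1) / real n<..real u / real n} \<subseteq> {0<..1}" by auto
  have "cell_set n u = {(real u - 1) / real n<..real u / real n} \<union> (if u = 1 then {0} else {})" (is "_ = ?I \<union> ?Z")
  proof (intro set_eqI)
    fix x :: real
    consider "x \<le> 0" | "0 < x" by linarith
    then show "x \<in> cell_set n u \<longleftrightarrow> x \<in> ?I \<union> ?Z"
    proof cases
      case 1
      then have "x \<notin> ?I" using sub by auto
      then show ?thesis using 1 u by (auto simp: cell_set_def cell_zero split: if_splits)
    next
      case 2
      then show ?thesis using sub u cell_eq_iff[OF n _ 2, of u] by (auto simp: cell_set_def)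
    qed
  qed
  moreover have "measure unit_leb (?I \<union> ?Z) = measure lebesgue (?I \<union> ?Z)"
    using sub by (intro measure_unit_leb) auto
  moreover have "measure lebesgue (?I \<union> ?Z) = measure lebesgue ?I"
    by (rule measure_Un_null_set) (auto intro: null_sets_completionI)
  moreover have "measure lebesgue ?I = 1 / real n"
    using n by (simp add: field_simps divide_right_mono)
  ultimately show ?thesis by simp
qed

lemma emeasure_unit_leb: "A \<in> sets unit_leb \<Longrightarrow> emeasure unit_leb A = ennreal (measure unit_leb A)"
  using finite_measure.emeasure_eq_measure prob_space.finite_measure prob_space_unit_leb by blast

lemma measure_rectangle:
  assumes "S \<in> sets unit_leb" "T \<in> sets unit_leb"
  shows "measure square_leb (S \<times> T) = measure unit_leb S * measure unit_leb T"
proof -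
  interpret sigma_finite_measure unit_leb by (rule prob_space_imp_sigma_finite[OF prob_space_unit_leb])
  have "emeasure square_leb (S \<times> T) = emeasure unit_leb S * emeasure unit_leb T"
    unfolding square_leb_def by (rule emeasure_pair_measure_Times) (use assms in auto)
  then show ?thesis by (simp add: measure_def enn2real_mult)
qed

definition grid_fun :: "nat \<Rightarrow> (nat \<Rightarrow> nat \<Rightarrow> real) \<Rightarrow> real \<times> real \<Rightarrow> real" where
  "grid_fun n \<psi> = (\<lambda>(x, y). \<psi> (cell n x) (cell n y))"

lemma measurable_grid_fun [measurable]: "grid_fun n \<psi> \<in> borel_measurable square_leb"
proof -
  have "(\<lambda>p. (cell n (fst p), cell n (snd p))) \<in> square_leb \<rightarrow>\<^sub>M count_space UNIV \<Otimes>\<^sub>M count_space UNIV"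
    unfolding square_leb_def by measurable
  then have "(\<lambda>p. (cell n (fst p), cell n (snd p))) \<in> square_leb \<rightarrow>\<^sub>M count_space UNIV"
    by (simp add: pair_measure_countable)
  from measurable_compose[OF this, of "\<lambda>(u, v). \<psi> u v" borel] show ?thesis
    by (simp add: grid_fun_def split_beta')
qed

lemma grid_fun_decomp:
  assumes n: "n \<ge> 1" and p: "p \<in> space square_leb"
  shows "indicator (S \<times> T) p * grid_fun n \<psi> p
    = (\<Sum>u\<in>{1..n}. \<Sum>v\<in>{1..n}. \<psi> u v * indicator ((S \<inter> cell_set n u) \<times> (T \<inter> cell_set n v)) p)"
proof -
  obtain x y where xy: "p = (x, y)" "x \<in> {0..1}" "y \<in> {0..1}" using p by auto
  note c = cell_range[OF n xy(2)] cell_range[OF n xy(3)]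
  have "(\<Sum>u\<in>{1..n}. \<Sum>v\<in>{1..n}. \<psi> u v * indicator ((S \<inter> cell_set n u) \<times> (T \<inter> cell_set n v)) p)
     = (\<Sum>u\<in>{1..n}. \<Sum>v\<in>{1..n}. if u = cell n x then if v = cell n y then \<psi> u v * indicator (S \<times> T) p else 0 else 0)"
    using xy by (intro sum.cong refl) (auto simp: indicator_def cell_set_def)
  also have "\<dots> = (\<Sum>u\<in>{1..n}. if u = cell n x then (\<Sum>v\<in>{1..n}. if v = cell n y then \<psi> u v * indicator (S \<times> T) p else 0) else 0)"
    by (intro sum.cong refl) auto
  also have "\<dots> = \<psi> (cell n x) (cell n y) * indicator (S \<times> T) p" using c by (simp add: sum.delta)
  finally show ?thesis by (simp add: grid_fun_def xy)
qed

lemma integral_grid_fun_rectangle: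
  assumes n: "n \<ge> 1" and st: "S \<in> sets unit_leb" "T \<in> sets unit_leb"
  shows "set_lebesgue_integral square_leb (S \<times> T) (grid_fun n \<psi>)
    = (\<Sum>u\<in>{1..n}. \<Sum>v\<in>{1..n}. \<psi> u v * (measure unit_leb (S \<inter> cell_set n u) * measure unit_leb (T \<inter> cell_set n v)))"
proof -
  have r: "(S \<inter> cell_set n u) \<times> (T \<inter> cell_set n v) \<in> sets square_leb" for u v
    by (intro rectangle_sets sets.Int st cell_set_sets)
  have "set_lebesgue_integral square_leb (S \<times> T) (grid_fun n \<psi>)
     = (LINT p|square_leb. (\<Sum>u\<in>{1..n}. \<Sum>v\<in>{1..n}. \<psi> u v * indicator ((S \<inter> cell_set n u) \<times> (T \<inter> cell_set n v)) p))"
    unfolding set_lebesgue_integral_def real_scaleR_def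
    by (intro Bochner_Integration.integral_cong refl grid_fun_decomp n)
  also have "\<dots> = (\<Sum>u\<in>{1..n}. \<Sum>v\<in>{1..n}. \<psi> u v * measure square_leb ((S \<inter> cell_set n u) \<times> (T \<inter> cell_set n v)))"
  proof -
    have "(LINT p|square_leb. (\<Sum>u\<in>{1..n}. \<Sum>v\<in>{1..n}. \<psi> u v * f u v p)) = (\<Sum>u\<in>{1..n}. \<Sum>v\<in>{1..n}. \<psi> u v * (LINT p|square_leb. f u v p))"
      if "\<And>u v. integrable square_leb (f u v)" for f using that by simp
    from this[of "\<lambda>u v. indicator ((S \<inter> cell_set n u) \<times> (T \<inter> cell_set n v))", OF integrable_indicator_square[OF r]]
    show ?thesis by (simp add: sets.Int_space_eq2[OF r] del: space_square_leb)
  qed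
  finally show ?thesis
    by (simp add: measure_rectangle[OF sets.Int[OF st(1) cell_set_sets] sets.Int[OF st(2) cell_set_sets]])
qed

lemma integral_grid_fun:
  assumes n: "n \<ge> 1"
  shows "integrable square_leb (grid_fun n \<psi>)"
    "(LINT p|square_leb. grid_fun n \<psi> p) = (\<Sum>u\<in>{1..n}. \<Sum>v\<in>{1..n}. \<psi> u v) / (real n)\<^sup>2"
proof -
  show "integrable square_leb (grid_fun n \<psi>)"
  proof (rule integrable_square_bounded)
    fix p assume "p \<in> space square_leb"
    then show "\<bar>grid_fun n \<psi> p\<bar> \<le> (\<Sum>u\<in>{1..n}. \<Sum>v\<in>{1..n}. \<bar>\<psi> u v\<bar>)"
    proof -
      obtain x y where xy: "p = (x, y)" "x \<in> {0..1}" "y \<in> {0..1}" using \<open>p \<in> space square_leb\<close> by auto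
      have "\<bar>\<psi> (cell n x) (cell n y)\<bar> \<le> (\<Sum>v\<in>{1..n}. \<bar>\<psi> (cell n x) v\<bar>)"
        by (rule member_le_sum) (use cell_range[OF n xy(3)] in auto)
      also have "\<dots> \<le> (\<Sum>u\<in>{1..n}. \<Sum>v\<in>{1..n}. \<bar>\<psi> u v\<bar>)"
        by (rule member_le_sum[of _ _ "\<lambda>u. \<Sum>v\<in>{1..n}. \<bar>\<psi> u v\<bar>"]) (use cell_range[OF n xy(2)] in \<open>auto intro: sum_nonneg\<close>)
      finally show ?thesis by (simp add: grid_fun_def xy)
    qed
  qed measurable
  have 1: "{0..1} \<in> sets unit_leb" using sets.top[of unit_leb] by simp
  have "(LINT p|square_leb. grid_fun n \<psi> p) = set_lebesgue_integral square_leb ({0..1} \<times> {0..1}) (grid_fun n \<psi>)"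
    unfolding set_lebesgue_integral_def by (intro Bochner_Integration.integral_cong refl) auto
  also have "\<dots> = (\<Sum>u\<in>{1..n}. \<Sum>v\<in>{1..n}. \<psi> u v * (1 / real n * (1 / real n)))"
    unfolding integral_grid_fun_rectangle[OF n 1 1]
  proof (intro sum.cong refl arg_cong2[where f="(*)"])
    fix u assume "u \<in> {1..n}"
    then show "measure unit_leb ({0..1} \<inter> cell_set n u) = 1 / real n"
      using measure_cell_set[OF n, of u] by simp
  qed (use measure_cell_set[OF n] in auto)
  also have "\<dots> = (\<Sum>u\<in>{1..n}. \<Sum>v\<in>{1..n}. \<psi> u v) / (real n)\<^sup>2"
    by (simp add: sum_divide_distrib power2_eq_square)
  finally show "(LINT p|square_leb. grid_fun n \<psi> p) = (\<Sum>u\<in>{1..n}. \<Sum>v\<in>{1..n}. \<psi> u v) / (real n)\<^sup>2" .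
qed

lemma linear_cube_le:
  fixes s c :: "'a \<Rightarrow> real"
  assumes "finite I" "\<And>u. u \<in> I \<Longrightarrow> 0 \<le> s u \<and> s u \<le> 1"
  shows "(\<Sum>u\<in>I. s u * c u) \<le> (\<Sum>u\<in>{u\<in>I. c u > 0}. c u)"
proof -
  have "(\<Sum>u\<in>I. s u * c u) \<le> (\<Sum>u\<in>I. if c u > 0 then c u else 0)"
    using assms(2) by (intro sum_mono) (auto simp: mult_le_cancel_right1 mult_nonneg_nonpos)
  also have "\<dots> = (\<Sum>u\<in>{u\<in>I. c u > 0}. c u)" using assms(1) by (simp add: sum.inter_filter)
  finally show ?thesis .
qed

text \<open>A bilinear form on a product of cubes is largest at a pair of vertices: rounding one
  variable with the other frozen keeps exactly the positive coefficients, and the other variable is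
  rounded in the same way.\<close>

lemma bilinear_cube_le:
  fixes s t :: "'a \<Rightarrow> real"
  assumes I: "finite I" and s: "\<And>u. u \<in> I \<Longrightarrow> 0 \<le> s u \<and> s u \<le> 1" and t: "\<And>u. u \<in> I \<Longrightarrow> 0 \<le> t u \<and> t u \<le> 1"
    and B: "\<And>S T. S \<subseteq> I \<Longrightarrow> T \<subseteq> I \<Longrightarrow> (\<Sum>u\<in>S. \<Sum>v\<in>T. \<psi> u v) \<le> B"
  shows "(\<Sum>u\<in>I. \<Sum>v\<in>I. \<psi> u v * (s u * t v)) \<le> B"
proof -
  define S where "S = {u\<in>I. (\<Sum>v\<in>I. \<psi> u v * t v) > 0}"
  define T where "T = {v\<in>I. (\<Sum>u\<in>S. \<psi> u v) > 0}"
  have "(\<Sum>u\<in>I. \<Sum>v\<in>I. \<psi> u v * (s u * t v)) = (\<Sum>u\<in>I. s u * (\<Sum>v\<in>I. \<psi> u v * t v))"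
    by (simp add: sum_distrib_left mult_ac)
  also have "\<dots> \<le> (\<Sum>u\<in>S. \<Sum>v\<in>I. \<psi> u v * t v)" unfolding S_def by (rule linear_cube_le[OF I s])
  also have "\<dots> = (\<Sum>v\<in>I. t v * (\<Sum>u\<in>S. \<psi> u v))" by (subst sum.swap) (simp add: sum_distrib_left mult_ac)
  also have "\<dots> \<le> (\<Sum>v\<in>T. \<Sum>u\<in>S. \<psi> u v)" unfolding T_def by (rule linear_cube_le[OF I t])
  also have "\<dots> = (\<Sum>u\<in>S. \<Sum>v\<in>T. \<psi> u v)" by (rule sum.swap)
  also have "\<dots> \<le> B" by (rule B) (auto simp: S_def T_def)
  finally show ?thesis .
qed

text \<open>A measurable set meets each cell in a fraction between 0 and 1 of its measure. The
  integral is bilinear in these fractions, so unions of whole cells are the worst case.\<close>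

lemma cut_norm_grid_fun_le:
  assumes n: "n \<ge> 1"
    and B: "\<And>S T. S \<subseteq> {1..n} \<Longrightarrow> T \<subseteq> {1..n} \<Longrightarrow> \<bar>\<Sum>u\<in>S. \<Sum>v\<in>T. \<psi> u v\<bar> \<le> c * (real n)\<^sup>2"
  shows "cut_norm (grid_fun n \<psi>) \<le> c"
proof (rule cut_norm_least)
  fix S T assume st: "S \<in> sets unit_leb" "T \<in> sets unit_leb"
  interpret prob_space unit_leb by (rule prob_space_unit_leb)
  have m: "0 \<le> real n * measure unit_leb (A \<inter> cell_set n u) \<and> real n * measure unit_leb (A \<inter> cell_set n u) \<le> 1"
    if "u \<in> {1..n}" "A \<in> sets unit_leb" for u A
  proof -
    have "measure unit_leb (A \<inter> cell_set n u) \<le> 1 / real n"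
      using finite_measure_mono[of "A \<inter> cell_set n u" "cell_set n u"] measure_cell_set[OF n that(1)] by simp
    then show ?thesis using n by (simp add: field_simps)
  qed
  have *: "\<tau> * set_lebesgue_integral square_leb (S \<times> T) (grid_fun n \<psi>) \<le> c" if \<tau>: "\<tau> = 1 \<or> \<tau> = -1" for \<tau>
  proof -
    have "(\<Sum>u\<in>{1..n}. \<Sum>v\<in>{1..n}. (\<tau> * \<psi> u v) * ((real n * measure unit_leb (S \<inter> cell_set n u)) * (real n * measure unit_leb (T \<inter> cell_set n v))))
        \<le> c * (real n)\<^sup>2"
    proof (rule bilinear_cube_le)
      fix S T assume "S \<subseteq> {1..n}" "T \<subseteq> {1..n}"
      from B[OF this] show "(\<Sum>u\<in>S. \<Sum>v\<in>T. \<tau> * \<psi> u v) \<le> c * (real n)\<^sup>2"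
        using \<tau> by (auto simp: sum_distrib_left[symmetric] abs_le_iff)
    qed (use m st in auto)
    also have "(\<Sum>u\<in>{1..n}. \<Sum>v\<in>{1..n}. (\<tau> * \<psi> u v) * ((real n * measure unit_leb (S \<inter> cell_set n u)) * (real n * measure unit_leb (T \<inter> cell_set n v))))
       = (\<tau> * set_lebesgue_integral square_leb (S \<times> T) (grid_fun n \<psi>)) * (real n)\<^sup>2"
      unfolding integral_grid_fun_rectangle[OF n st] by (simp add: sum_distrib_left sum_distrib_right power2_eq_square mult_ac)
    finally show ?thesis using n by (subst (asm) mult_le_cancel_right) auto
  qed
  show "\<bar>set_lebesgue_integral square_leb (S \<times> T) (grid_fun n \<psi>)\<bar> \<le> c"
    using *[of 1] *[of "-1"] by (simp add: abs_le_iff)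
qed

definition grid_graphon :: "nat \<Rightarrow> (nat \<Rightarrow> nat \<Rightarrow> 'g \<Rightarrow> real) \<Rightarrow> 'g cochain_fun" where
  "grid_graphon n w = (\<lambda>(x, y, g). w (cell n x) (cell n y) g)"

lemma slice_grid_graphon: "slice (grid_graphon n w) g = grid_fun n (\<lambda>u v. w u v g)"
  by (auto simp: slice_def grid_graphon_def grid_fun_def)

lemma grid_graphon_in_graphons:
  fixes w :: "nat \<Rightarrow> nat \<Rightarrow> 'g::{finite,ab_group_add} \<Rightarrow> real"
  assumes n: "n \<ge> 1" and w: "\<And>u v g. u \<in> {1..n} \<Longrightarrow> v \<in> {1..n} \<Longrightarrow> 0 \<le> w u v g \<and> w u v g \<le> 1"
    "\<And>u v g. u \<in> {1..n} \<Longrightarrow> v \<in> {1..n} \<Longrightarrow> w u v g = w v u (- g)"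
  shows "grid_graphon n w \<in> cochain_graphons"
proof (rule cochain_graphonsI)
  show "slice (grid_graphon n w) g \<in> borel_measurable square_leb" for g
    unfolding slice_grid_graphon by measurable
  fix x y :: real and g assume "x \<in> {0..1}" "y \<in> {0..1}"
  then show "0 \<le> grid_graphon n w (x, y, g) \<and> grid_graphon n w (x, y, g) \<le> 1"
    "grid_graphon n w (x, y, g) = grid_graphon n w (y, x, - g)"
    using w[OF cell_range[OF n] cell_range[OF n], of x y g] unfolding grid_graphon_def by simp_all
qed

lemma rate_grid_graphon:
  fixes w :: "nat \<Rightarrow> nat \<Rightarrow> 'g::{finite,ab_group_add} \<Rightarrow> real"
  assumes n: "n \<ge> 1" and W: "grid_graphon n w \<in> cochain_graphons"
    and st: "\<And>u v. u \<in> {1..n} \<Longrightarrow> v \<in> {1..n} \<Longrightarrow> (\<Sum>g\<in>UNIV. w u v g) = 1"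
  shows "rate \<nu> (grid_graphon n w) = ereal (1 / 2 * (\<Sum>u\<in>{1..n}. \<Sum>v\<in>{1..n}. \<Sum>g\<in>UNIV. w u v g * ln (w u v g / \<nu> g)) / (real n)\<^sup>2)"
proof -
  have "(\<Sum>g\<in>UNIV. slice (grid_graphon n w) g p) = 1" if "p \<in> space square_leb" for p
    using that st[OF cell_range[OF n] cell_range[OF n]] by (auto simp: slice_grid_graphon grid_fun_def)
  then have "grid_graphon n w \<in> stochastic_graphons" using W unfolding stochastic_graphons_def by (auto intro!: AE_I2 simp del: space_square_leb)
  moreover have "entropy_density \<nu> (grid_graphon n w) = grid_fun n (\<lambda>u v. \<Sum>g\<in>UNIV. w u v g * ln (w u v g / \<nu> g))"
    by (auto simp: entropy_density_def slice_grid_graphon grid_fun_def)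
  ultimately show ?thesis by (simp add: rate_eq integral_grid_fun[OF n])
qed

lemma cut_distance_grid_graphons_le:
  fixes w w' :: "nat \<Rightarrow> nat \<Rightarrow> 'g::{finite,ab_group_add} \<Rightarrow> real"
  assumes n: "n \<ge> 1" and W: "grid_graphon n w \<in> cochain_graphons" "grid_graphon n w' \<in> cochain_graphons"
    and B: "\<And>S T g. S \<subseteq> {1..n} \<Longrightarrow> T \<subseteq> {1..n} \<Longrightarrow> \<bar>\<Sum>u\<in>S. \<Sum>v\<in>T. w u v g - w' u v g\<bar> \<le> c * (real n)\<^sup>2"
  shows "cut_distance (grid_graphon n w) (grid_graphon n w') \<le> real CARD('g) * c"
proof -
  have "cut_distance (grid_graphon n w) (grid_graphon n w') \<le> (\<Sum>g\<in>(UNIV::'g set). cut_norm (grid_fun n (\<lambda>u v. w u v g - w' u v g)))"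
    using cut_distance_le_sum[OF W] by (simp add: slice_grid_graphon grid_fun_def split_beta')
  also have "\<dots> \<le> (\<Sum>g\<in>(UNIV::'g set). c)" by (intro sum_mono cut_norm_grid_fun_le n B)
  finally show ?thesis by simp
qed

subsection \<open>Permuting the cells of a grid\<close>

text \<open>Each half-open cell is translated to its new place. The point 0 stays fixed: it is
  attached to the first cell without belonging to the half-open interval, and moving it along could
  make it collide with the right end of another cell.\<close>

definition shuffle :: "nat \<Rightarrow> (nat \<Rightarrow> nat) \<Rightarrow> real \<Rightarrow> real" where
  "shuffle n \<sigma> x = (if 0 < x then x + (real (\<sigma> (cell n x)) - real (cell n x)) / real n else x)"

lemma shuffle_pos:
  assumes n: "n \<ge> 1" and \<sigma>: "\<sigma> permutes {1..n}" and x: "0 < x" "x \<le> 1"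
  shows "cell n (shuffle n \<sigma> x) = \<sigma> (cell n x)" "0 < shuffle n \<sigma> x" "shuffle n \<sigma> x \<le> 1"
proof -
  let ?u = "cell n x"
  have u: "?u \<in> {1..n}" using cell_range[OF n, of x] x by auto
  then have su: "\<sigma> ?u \<in> {1..n}" using permutes_in_image[OF \<sigma>] by simp
  have "(real ?u - 1) / real n < x \<and> x \<le> real ?u / real n"
    using cell_eq_iff[OF n _ x(1), of ?u] u by simp
  then have *: "(real (\<sigma> ?u) - 1) / real n < shuffle n \<sigma> x \<and> shuffle n \<sigma> x \<le> real (\<sigma> ?u) / real n"
    using x by (simp add: shuffle_def diff_divide_distrib)
  have "0 \<le> (real (\<sigma> ?u) - 1) / real n" "real (\<sigma> ?u) / real n \<le> 1" using su by auto
  then show p: "0 < shuffle n \<sigma> x" "shuffle n \<sigma> x \<le> 1" using * by linarith+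
  show "cell n (shuffle n \<sigma> x) = \<sigma> ?u" using cell_eq_iff[OF n _ p(1), of "\<sigma> ?u"] * su by auto
qed

lemma shuffle_inverse:
  assumes n: "n \<ge> 1" and \<sigma>: "\<sigma> permutes {1..n}" and x: "x \<in> {0..1}"
  shows "shuffle n (inv \<sigma>) (shuffle n \<sigma> x) = x"
proof (cases "0 < x")
  case True
  then show ?thesis
    using shuffle_pos[OF n \<sigma> True] x permutes_inverses(2)[OF \<sigma>, of "cell n x"]
    unfolding shuffle_def[of n "inv \<sigma>"] by (simp add: shuffle_def diff_divide_distrib)
qed (simp add: shuffle_def)

lemma shuffle_range:
  assumes n: "n \<ge> 1" and \<sigma>: "\<sigma> permutes {1..n}" and x: "x \<in> {0..1}"
  shows "shuffle n \<sigma> x \<in> {0..1}"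
  using shuffle_pos[OF n \<sigma>, of x] x by (cases "0 < x") (auto simp: shuffle_def)

text \<open>Up to the null set \<open>{0}\<close>, the preimage is a disjoint union of translates of
  the pieces of A in the cells, and the permutation only reorders the measures of these
  pieces.\<close>

lemma shuffle_vimage:
  assumes n: "n \<ge> 1" and \<sigma>: "\<sigma> permutes {1..n}" and A: "A \<in> sets unit_leb"
  shows "shuffle n \<sigma> -` A \<inter> {0..1} \<in> sets unit_leb" "measure unit_leb (shuffle n \<sigma> -` A \<inter> {0..1}) = measure unit_leb A"
proof -
  interpret prob_space unit_leb by (rule prob_space_unit_leb)
  define s where "s u = (real u - real (\<sigma> u)) / real n" for u
  define J where "J u = cell_set n u - {0}" for u
  have J: "J u \<in> sets unit_leb" for u unfolding J_def using cell_set_sets[of n u]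
    by (auto simp: sets_unit_leb_iff)
  define B where "B u = (\<lambda>x. s u + x) ` (A \<inter> J (\<sigma> u))" for u
  have B_eq: "B u = (shuffle n \<sigma> -` A \<inter> {0..1}) \<inter> J u" if u: "u \<in> {1..n}" for u
  proof (intro set_eqI iffI)
    fix y assume "y \<in> B u"
    then obtain x where x: "x \<in> A" "x \<in> J (\<sigma> u)" "y = s u + x" by (auto simp: B_def)
    then have x1: "0 < x" "x \<le> 1" "cell n x = \<sigma> u" by (auto simp: J_def cell_set_def)
    have y: "y = shuffle n (inv \<sigma>) x"
      using x1 x(3) permutes_inverses(2)[OF \<sigma>, of u] by (simp add: shuffle_def s_def diff_divide_distrib)
    note sp = shuffle_pos[OF n permutes_inv[OF \<sigma>] x1(1,2)]
    have "shuffle n \<sigma> y = x"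
      using shuffle_inverse[OF n permutes_inv[OF \<sigma>], of x] x1 by (simp add: y permutes_inv_inv[OF \<sigma>])
    then show "y \<in> (shuffle n \<sigma> -` A \<inter> {0..1}) \<inter> J u"
      using sp x x1 permutes_inverses(2)[OF \<sigma>, of u] by (simp add: y J_def cell_set_def)
  next
    fix y assume "y \<in> (shuffle n \<sigma> -` A \<inter> {0..1}) \<inter> J u"
    then have y: "shuffle n \<sigma> y \<in> A" "0 < y" "y \<le> 1" "cell n y = u" by (auto simp: J_def cell_set_def)
    have "shuffle n \<sigma> y \<in> A \<inter> J (\<sigma> u)" using shuffle_pos[OF n \<sigma> y(2,3)] y by (auto simp: J_def cell_set_def)
    moreover have "y = s u + shuffle n \<sigma> y" using y by (simp add: shuffle_def s_def diff_divide_distrib)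
    ultimately show "y \<in> B u" unfolding B_def by (rule rev_image_eqI)
  qed
  have AJ: "A \<inter> J u \<in> sets lebesgue" "A \<inter> J u \<subseteq> {0..1}" for u
    using A J[of u] by (auto simp: sets_unit_leb_iff)
  have Bs: "B u \<in> sets unit_leb" if "u \<in> {1..n}" for u
    using lebesgue_sets_translation[OF AJ(1), of "s u" "\<sigma> u"] B_eq[OF that] by (auto simp: sets_unit_leb_iff B_def)
  have Bm: "measure unit_leb (B u) = measure unit_leb (A \<inter> J (\<sigma> u))" if "u \<in> {1..n}" for u
    using Bs[OF that] AJ(2)[of "\<sigma> u"] measure_translation[of "s u" "A \<inter> J (\<sigma> u)"]
    by (simp add: measure_unit_leb sets_unit_leb_iff B_def)
  have decomp: "X - {0} = (\<Union>u\<in>{1..n}. X \<inter> J u)" if "X \<subseteq> {0..1}" for X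
    using that cell_range[OF n] by (fastforce simp: J_def cell_set_def)
  have null: "{0} \<in> null_sets unit_leb"
    unfolding unit_leb_def by (subst null_sets_restrict_space) (auto intro: null_sets_completionI)
  have msum: "measure unit_leb X = (\<Sum>u\<in>{1..n}. measure unit_leb (X \<inter> J u))" if X: "X \<in> sets unit_leb" for X
  proof -
    have "measure unit_leb X = measure unit_leb (X - {0})" using measure_Diff_null_set[OF X null] by simp
    also have "X - {0} = (\<Union>u\<in>{1..n}. X \<inter> J u)" using X by (intro decomp) (simp add: sets_unit_leb_iff)
    also have "measure unit_leb (\<Union>u\<in>{1..n}. X \<inter> J u) = (\<Sum>u\<in>{1..n}. measure unit_leb (X \<inter> J u))"
      by (rule finite_measure_finite_Union) (use X J in \<open>auto simp: disjoint_family_on_def J_def cell_set_def\<close>)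
    finally show ?thesis .
  qed
  let ?X = "shuffle n \<sigma> -` A \<inter> {0..1}"
  have "?X - {0} = (\<Union>u\<in>{1..n}. B u)" using decomp[of ?X] B_eq by auto
  moreover have "?X = (?X - {0}) \<union> (A \<inter> {0})" using A by (auto simp: shuffle_def)
  moreover have "A \<inter> {0} \<in> sets unit_leb" using A null by auto
  moreover have "(\<Union>u\<in>{1..n}. B u) \<in> sets unit_leb" using Bs by (intro sets.finite_UN) auto
  ultimately show X: "?X \<in> sets unit_leb" by (metis sets.Un)
  have "measure unit_leb ?X = (\<Sum>u\<in>{1..n}. measure unit_leb (B u))"
    unfolding msum[OF X] by (intro sum.cong refl) (simp only: B_eq)
  also have "\<dots> = (\<Sum>u\<in>{1..n}. measure unit_leb (A \<inter> J (\<sigma> u)))" by (intro sum.cong refl Bm)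
  also have "\<dots> = (\<Sum>u\<in>{1..n}. measure unit_leb (A \<inter> J u))"
    using sum.permute[OF \<sigma>, of "\<lambda>u. measure unit_leb (A \<inter> J u)"] by (simp add: comp_def)
  finally show "measure unit_leb ?X = measure unit_leb A" unfolding msum[OF A] .
qed

lemma shuffle_automorphism:
  assumes n: "n \<ge> 1" and \<sigma>: "\<sigma> permutes {1..n}"
  shows "shuffle n \<sigma> \<in> unit_automorphisms"
proof -
  note i = permutes_inv[OF \<sigma>]
  have inv1: "shuffle n \<sigma> (shuffle n (inv \<sigma>) x) = x" if "x \<in> {0..1}" for x
    using shuffle_inverse[OF n i that] by (simp add: permutes_inv_inv[OF \<sigma>])
  have bij: "bij_betw (shuffle n \<sigma>) {0..1} {0..1}"
    by (rule bij_betw_byWitness[where f'="shuffle n (inv \<sigma>)"])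
       (use shuffle_range[OF n \<sigma>] shuffle_range[OF n i] shuffle_inverse[OF n \<sigma>] inv1 in \<open>auto simp del: atLeastAtMost_iff\<close>)
  have meas: "shuffle n \<sigma>' \<in> unit_leb \<rightarrow>\<^sub>M unit_leb" if "\<sigma>' permutes {1..n}" for \<sigma>'
    by (rule measurableI) (use shuffle_range[OF n that] shuffle_vimage(1)[OF n that] in auto)
  have the: "the_inv_into {0..1} (shuffle n \<sigma>) x = shuffle n (inv \<sigma>) x" if "x \<in> {0..1}" for x
    by (rule the_inv_into_f_eq) (use bij inv1 that shuffle_range[OF n i that] in \<open>auto simp: bij_betw_def\<close>)
  have "the_inv_into {0..1} (shuffle n \<sigma>) \<in> unit_leb \<rightarrow>\<^sub>M unit_leb"
    by (subst measurable_cong[of _ _ "shuffle n (inv \<sigma>)"]) (use the meas[OF i] in auto)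
  moreover have "distr unit_leb unit_leb (shuffle n \<sigma>) = unit_leb"
  proof (rule measure_eqI)
    fix A assume "A \<in> sets (distr unit_leb unit_leb (shuffle n \<sigma>))"
    then have A: "A \<in> sets unit_leb" by simp
    then show "emeasure (distr unit_leb unit_leb (shuffle n \<sigma>)) A = emeasure unit_leb A"
      using emeasure_unit_leb[OF A] emeasure_unit_leb[OF shuffle_vimage(1)[OF n \<sigma> A]] shuffle_vimage(2)[OF n \<sigma> A] meas[OF \<sigma>]
      by (simp add: emeasure_distr)
  qed simp
  ultimately show ?thesis using bij meas[OF \<sigma>] by (simp add: unit_automorphisms_def)
qed

subsection \<open>Weak regularity\<close>

text \<open>Conditional expectation given the label, for the uniform distribution on
  \<open>X\<close>.\<close>

definition fiber_avg :: "'x set \<Rightarrow> ('x \<Rightarrow> 'l) \<Rightarrow> ('x \<Rightarrow> real) \<Rightarrow> 'x \<Rightarrow> real" where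
  "fiber_avg X \<l> a x = (\<Sum>y\<in>{y\<in>X. \<l> y = \<l> x}. a y) / real (card {y\<in>X. \<l> y = \<l> x})"

lemma fiber_avg_cong: "\<l> x = \<l> y \<Longrightarrow> fiber_avg X \<l> a x = fiber_avg X \<l> a y"
  by (simp add: fiber_avg_def)

text \<open>On each fiber the weight \<open>c\<close> is constant, so there it only sees the total
  of \<open>a\<close>, which averaging preserves.\<close>

lemma fiber_avg_adjoint:
  assumes X: "finite X" and c: "\<And>x y. x \<in> X \<Longrightarrow> y \<in> X \<Longrightarrow> \<l> x = \<l> y \<Longrightarrow> c x = c y"
  shows "(\<Sum>x\<in>X. fiber_avg X \<l> a x * c x) = (\<Sum>x\<in>X. a x * c x)"
proof -
  have "(\<Sum>x\<in>{x\<in>X. \<l> x = l}. fiber_avg X \<l> a x * c x) = (\<Sum>x\<in>{x\<in>X. \<l> x = l}. a x * c x)" if l: "l \<in> \<l> ` X" for l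
  proof -
    let ?F = "{x\<in>X. \<l> x = l}"
    obtain z where z: "z \<in> X" "\<l> z = l" using l by auto
    have "card ?F > 0" using X z by (auto simp: card_gt_0_iff)
    have "(\<Sum>x\<in>?F. fiber_avg X \<l> a x * c x) = (\<Sum>x\<in>?F. ((\<Sum>y\<in>?F. a y) / real (card ?F)) * c z)"
    proof (intro sum.cong refl)
      fix x assume x: "x \<in> ?F"
      then have "c x = c z" using c[of x z] z by simp
      moreover have "fiber_avg X \<l> a x = (\<Sum>y\<in>?F. a y) / real (card ?F)" using x by (simp add: fiber_avg_def)
      ultimately show "fiber_avg X \<l> a x * c x = ((\<Sum>y\<in>?F. a y) / real (card ?F)) * c z" by simp
    qed
    also have "\<dots> = (\<Sum>y\<in>?F. a y) * c z" using \<open>card ?F > 0\<close> by simp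
    also have "\<dots> = (\<Sum>x\<in>?F. a x * c x)"
      unfolding sum_distrib_right
    proof (intro sum.cong refl)
      fix x assume "x \<in> ?F"
      then show "a x * c z = a x * c x" using c[of x z] z by simp
    qed
    finally show ?thesis .
  qed
  then have "(\<Sum>l\<in>\<l> ` X. \<Sum>x\<in>{x\<in>X. \<l> x = l}. fiber_avg X \<l> a x * c x) = (\<Sum>l\<in>\<l> ` X. \<Sum>x\<in>{x\<in>X. \<l> x = l}. a x * c x)"
    by (rule sum.cong[OF refl])
  then show ?thesis using X by (simp add: sum.group)
qed

lemma fiber_avg_bound:
  assumes "finite X" "x \<in> X" "\<And>y. y \<in> X \<Longrightarrow> l \<le> a y \<and> a y \<le> h"
  shows "l \<le> fiber_avg X \<l> a x" "fiber_avg X \<l> a x \<le> h"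
proof -
  let ?F = "{y\<in>X. \<l> y = \<l> x}"
  have c: "real (card ?F) > 0" using assms(1,2) by (auto simp: card_gt_0_iff)
  have "real (card ?F) * l \<le> (\<Sum>y\<in>?F. a y)" "(\<Sum>y\<in>?F. a y) \<le> real (card ?F) * h"
    using assms(3) by (auto intro!: sum_bounded_below sum_bounded_above)
  then show "l \<le> fiber_avg X \<l> a x" "fiber_avg X \<l> a x \<le> h"
    using c by (auto simp: fiber_avg_def field_simps)
qed

text \<open>
  Energy increment: a violated rectangle \<open>S \<times> T\<close> has correlation more than \<open>\<epsilon> n\<^sup>2\<close> with the error of
  the current average, so by Cauchy-Schwarz refining by \<open>S\<close> and \<open>T\<close> gains \<open>\<epsilon>\<^sup>2 n\<^sup>2\<close> in squared norm.
\<close>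

lemma weak_regularity:
  fixes a :: "'g::finite \<Rightarrow> nat \<times> nat \<Rightarrow> real"
  assumes n: "n \<ge> 1" and \<epsilon>: "\<epsilon> > 0" and a: "\<And>g p. \<bar>a g p\<bar> \<le> 1"
  defines "X \<equiv> {1..n} \<times> {1..n}"
  defines "E \<equiv> \<lambda>b::nat \<Rightarrow> nat. \<lambda>g. fiber_avg X (\<lambda>(u, v). (b u, b v)) (a g)"
  shows "\<exists>b. (\<forall>u. b u < 4 ^ (nat \<lceil>real CARD('g) / \<epsilon>\<^sup>2\<rceil> + 1))
    \<and> (\<forall>g S T. S \<subseteq> {1..n} \<longrightarrow> T \<subseteq> {1..n} \<longrightarrow> \<bar>\<Sum>p\<in>S \<times> T. a g p - E b g p\<bar> \<le> \<epsilon> * (real n)\<^sup>2)"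
proof -
  have X: "finite X" "card X = n ^ 2" by (auto simp: X_def power2_eq_square)
  define good where "good b \<longleftrightarrow> (\<forall>g S T. S \<subseteq> {1..n} \<longrightarrow> T \<subseteq> {1..n} \<longrightarrow> \<bar>\<Sum>p\<in>S \<times> T. a g p - E b g p\<bar> \<le> \<epsilon> * (real n)\<^sup>2)" for b
  define energy where "energy b = (\<Sum>g\<in>UNIV. \<Sum>p\<in>X. (E b g p)\<^sup>2)" for b
  have E_adj: "(\<Sum>p\<in>X. E b g p * c p) = (\<Sum>p\<in>X. a g p * c p)"
    if "\<And>u v u' v'. (u, v) \<in> X \<Longrightarrow> (u', v') \<in> X \<Longrightarrow> b u = b u' \<Longrightarrow> b v = b v' \<Longrightarrow> c (u, v) = c (u', v')" for b g c
    unfolding E_def by (rule fiber_avg_adjoint[OF X(1)]) (use that in auto)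
  have E_cong: "E b g (u, v) = E b g (u', v')" if "b u = b u'" "b v = b v'" for b g u v u' v'
    unfolding E_def by (rule fiber_avg_cong) (use that in simp)
  have step: "good b \<or> (\<exists>b'. (\<forall>u. b' u < 4 ^ Suc i) \<and> energy b' \<ge> energy b + \<epsilon>\<^sup>2 * (real n)\<^sup>2)" if b: "\<forall>u. b u < 4 ^ i" for b i
  proof (cases "good b")
    case False
    then obtain h S T where st: "S \<subseteq> {1..n}" "T \<subseteq> {1..n}" and d: "\<bar>\<Sum>p\<in>S \<times> T. a h p - E b h p\<bar> > \<epsilon> * (real n)\<^sup>2"
      by (auto simp: good_def not_le)
    \<comment> \<open>Appends a base-four digit that records membership in S and in T. The new
      labelling refines the old one by both sets, and the bound on the labels grows by a factor
      4.\<close>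
    define b' where "b' u = 4 * b u + (if u \<in> S then 2 else 0) + (if u \<in> T then 1 else 0)" for u
    have b': "b' u = b' v \<Longrightarrow> b u = b v \<and> (u \<in> S \<longleftrightarrow> v \<in> S) \<and> (u \<in> T \<longleftrightarrow> v \<in> T)" for u v
      unfolding b'_def by (auto split: if_splits; presburger)
    have lt: "b' u < 4 ^ Suc i" for u using b[rule_format, of u] unfolding b'_def by auto
    \<comment> \<open>\<open>E b\<close> is constant on the finer blocks as well, so averaging over
      either partition leaves its inner product with \<open>a g\<close> unchanged. This is the
      orthogonality behind Pythagoras.\<close>
    have EE: "(\<Sum>p\<in>X. E b' g p * E b g p) = (\<Sum>p\<in>X. (E b g p)\<^sup>2)" for g
    proof -
      have "(\<Sum>p\<in>X. E b' g p * E b g p) = (\<Sum>p\<in>X. a g p * E b g p)"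
        by (rule E_adj) (use b' in \<open>blast intro: E_cong\<close>)
      also have "\<dots> = (\<Sum>p\<in>X. E b g p * E b g p)" by (rule E_adj[symmetric]) (blast intro: E_cong)
      finally show ?thesis by (simp add: power2_eq_square)
    qed
    have pyth: "(\<Sum>p\<in>X. (E b' g p)\<^sup>2) = (\<Sum>p\<in>X. (E b g p)\<^sup>2) + (\<Sum>p\<in>X. (E b' g p - E b g p)\<^sup>2)" for g
    proof -
      have "(\<Sum>p\<in>X. (E b' g p - E b g p)\<^sup>2) = (\<Sum>p\<in>X. (E b' g p)\<^sup>2) + (\<Sum>p\<in>X. (E b g p)\<^sup>2) - 2 * (\<Sum>p\<in>X. E b' g p * E b g p)"
        by (simp add: power2_diff sum.distrib sum_subtractf sum_distrib_left mult_ac)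
      then show ?thesis by (simp add: EE)
    qed
    let ?c = "\<lambda>p. indicator (S \<times> T) p :: real"
    have sub: "S \<times> T \<subseteq> X" using st by (auto simp: X_def)
    have cs: "(\<Sum>p\<in>X. f p * ?c p) = (\<Sum>p\<in>S \<times> T. f p)" for f :: "nat \<times> nat \<Rightarrow> real"
      by (rule sum.mono_neutral_cong_right[OF X(1) sub]) (simp_all add: indicator_def)
    have "(\<Sum>p\<in>X. E b' h p * ?c p) = (\<Sum>p\<in>X. a h p * ?c p)"
    proof (rule E_adj)
      fix u v u' v' assume "b' u = b' u'" "b' v = b' v'"
      from b'[OF this(1)] b'[OF this(2)] show "?c (u, v) = ?c (u', v')" by (simp add: indicator_def)
    qed
    then have "(\<Sum>p\<in>S \<times> T. a h p - E b h p) = (\<Sum>p\<in>X. (E b' h p - E b h p) * ?c p)"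
      unfolding cs by (simp add: sum_subtractf)
    then have "(\<epsilon> * (real n)\<^sup>2)\<^sup>2 \<le> (\<Sum>p\<in>X. (E b' h p - E b h p) * ?c p)\<^sup>2"
      using d \<epsilon> by (simp add: abs_le_square_iff[symmetric])
    also have "\<dots> \<le> (\<Sum>p\<in>X. (E b' h p - E b h p)\<^sup>2) * (\<Sum>p\<in>X. (?c p)\<^sup>2)" by (rule Cauchy_Schwarz_ineq_sum)
    also have "\<dots> \<le> (\<Sum>p\<in>X. (E b' h p - E b h p)\<^sup>2) * (real n)\<^sup>2"
    proof (rule mult_left_mono)
      have "(\<Sum>p\<in>X. (?c p)\<^sup>2) \<le> (\<Sum>p\<in>X. 1)" by (intro sum_mono) (auto simp: indicator_def)
      then show "(\<Sum>p\<in>X. (?c p)\<^sup>2) \<le> (real n)\<^sup>2" using X by simp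
    qed (auto intro: sum_nonneg)
    finally have "(\<epsilon> * (real n)\<^sup>2)\<^sup>2 \<le> (\<Sum>p\<in>X. (E b' h p - E b h p)\<^sup>2) * (real n)\<^sup>2" .
    moreover have "(\<epsilon> * (real n)\<^sup>2)\<^sup>2 = (\<epsilon>\<^sup>2 * (real n)\<^sup>2) * (real n)\<^sup>2" by (simp add: power2_eq_square mult_ac)
    ultimately have "(\<epsilon>\<^sup>2 * (real n)\<^sup>2) * (real n)\<^sup>2 \<le> (\<Sum>p\<in>X. (E b' h p - E b h p)\<^sup>2) * (real n)\<^sup>2" by (simp only:)
    then have inc: "\<epsilon>\<^sup>2 * (real n)\<^sup>2 \<le> (\<Sum>p\<in>X. (E b' h p - E b h p)\<^sup>2)"
      by (rule mult_right_le_imp_le) (use n in simp)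
    have "energy b' = energy b + (\<Sum>g\<in>UNIV. \<Sum>p\<in>X. (E b' g p - E b g p)\<^sup>2)"
      unfolding energy_def pyth by (simp add: sum.distrib)
    also have "\<dots> \<ge> energy b + (\<Sum>p\<in>X. (E b' h p - E b h p)\<^sup>2)"
      by (intro add_left_mono member_le_sum[of h UNIV "\<lambda>g. \<Sum>p\<in>X. (E b' g p - E b g p)\<^sup>2"]) (auto intro: sum_nonneg)
    finally show ?thesis using inc lt by (intro disjI2 exI[of _ b']) auto
  qed simp
  have iter: "(\<exists>b. (\<forall>u. b u < 4 ^ i) \<and> good b) \<or> (\<exists>b. (\<forall>u. b u < 4 ^ i) \<and> energy b \<ge> real i * (\<epsilon>\<^sup>2 * (real n)\<^sup>2))" for i
  proof (induction i)
    case 0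
    show ?case by (intro disjI2 exI[of _ "\<lambda>_. 0"]) (auto simp: energy_def intro!: sum_nonneg)
  next
    case (Suc i)
    have lift: "\<forall>u. b u < 4 ^ i \<Longrightarrow> \<forall>u. b u < 4 ^ Suc i" for b :: "nat \<Rightarrow> nat"
      by (fastforce intro: less_le_trans)
    show ?case using Suc.IH
    proof
      assume "\<exists>b. (\<forall>u. b u < 4 ^ i) \<and> good b"
      then show ?thesis using lift by blast
    next
      assume "\<exists>b. (\<forall>u. b u < 4 ^ i) \<and> energy b \<ge> real i * (\<epsilon>\<^sup>2 * (real n)\<^sup>2)"
      then obtain b where b: "\<forall>u. b u < 4 ^ i" "energy b \<ge> real i * (\<epsilon>\<^sup>2 * (real n)\<^sup>2)" by blast
      from step[OF b(1)] show ?thesis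
      proof
        assume "good b" then show ?thesis using lift b(1) by blast
      next
        assume "\<exists>b'. (\<forall>u. b' u < 4 ^ Suc i) \<and> energy b' \<ge> energy b + \<epsilon>\<^sup>2 * (real n)\<^sup>2"
        then obtain b' where "\<forall>u. b' u < 4 ^ Suc i" "energy b' \<ge> energy b + \<epsilon>\<^sup>2 * (real n)\<^sup>2" by blast
        then show ?thesis using b(2) by (intro disjI2 exI[of _ b']) (simp add: algebra_simps)
      qed
    qed
  qed
  \<comment> \<open>The energy is at most \<open>CARD('g) * n^2\<close>, and every round that finds
    no good labelling adds \<open>\<epsilon>^2 * n^2\<close>. This many rounds would exceed the
    maximum.\<close>
  let ?i = "nat \<lceil>real CARD('g) / \<epsilon>\<^sup>2\<rceil> + 1"
  have ub: "energy b \<le> real CARD('g) * (real n)\<^sup>2" for b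
  proof -
    have "(E b g p)\<^sup>2 \<le> 1" if "p \<in> X" for g p
    proof -
      have "- 1 \<le> E b g p" "E b g p \<le> 1"
        unfolding E_def using fiber_avg_bound[OF X(1) that, of "- 1" "a g" 1] a[of g] by (simp_all add: abs_le_iff minus_le_iff)
      then show ?thesis by (simp add: abs_le_iff abs_square_le_1)
    qed
    then have "(\<Sum>p\<in>X. (E b g p)\<^sup>2) \<le> (\<Sum>p\<in>X. 1)" for g by (intro sum_mono)
    then have "energy b \<le> (\<Sum>g\<in>(UNIV::'g set). (real n)\<^sup>2)" unfolding energy_def using X by (intro sum_mono) auto
    then show ?thesis by simp
  qed
  have "real CARD('g) / \<epsilon>\<^sup>2 < real ?i" by linarith
  then have "real CARD('g) < real ?i * \<epsilon>\<^sup>2" using \<epsilon> by (simp add: divide_less_eq)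
  then have "real CARD('g) * (real n)\<^sup>2 < real ?i * \<epsilon>\<^sup>2 * (real n)\<^sup>2" using n by (intro mult_strict_right_mono) auto
  then have "\<not> energy b \<ge> real ?i * (\<epsilon>\<^sup>2 * (real n)\<^sup>2)" for b using ub[of b] by (simp add: mult_ac del: of_nat_add)
  then show ?thesis using iter[of ?i] unfolding good_def by blast
qed

text \<open>\<^const>\<open>graphon_of\<close> leaves the diagonal blocks empty; filling them with the value \<open>0\<close> of the group
  makes all averages stochastic.\<close>

definition cochain_weight :: "(nat \<times> nat \<Rightarrow> 'g::zero) \<Rightarrow> nat \<Rightarrow> nat \<Rightarrow> 'g \<Rightarrow> real" where
  "cochain_weight f u v g = (if (if u = v then 0 else f (u, v)) = g then 1 else 0)"

text \<open>The average of \<open>cochain_weight\<close> over a block. A block without pairs gets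
  density 0 through division by zero, so the densities sum to one only for labels that
  occur.\<close>

definition block_density :: "nat \<Rightarrow> (nat \<Rightarrow> nat) \<Rightarrow> (nat \<times> nat \<Rightarrow> 'g::zero) \<Rightarrow> nat \<Rightarrow> nat \<Rightarrow> 'g \<Rightarrow> real" where
  "block_density n b f i j g = (\<Sum>(u, v)\<in>{p \<in> {1..n} \<times> {1..n}. (case p of (u, v) \<Rightarrow> (b u, b v)) = (i, j)}. cochain_weight f u v g)
     / real (card {p \<in> {1..n} \<times> {1..n}. (case p of (u, v) \<Rightarrow> (b u, b v)) = (i, j)})"

lemma block_density_fiber_avg:
  "block_density n b f (b u) (b v) g
    = fiber_avg ({1..n} \<times> {1..n}) (\<lambda>(u, v). (b u, b v)) (\<lambda>(u, v). cochain_weight f u v g) (u, v)"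
  by (simp add: block_density_def fiber_avg_def)

lemma cochain_weight_01: "0 \<le> cochain_weight f u v g" "cochain_weight f u v g \<le> 1" by (simp_all add: cochain_weight_def)

lemma cochain_weight_sum: "(\<Sum>g\<in>UNIV. cochain_weight f u v g) = (1::real)" for f :: "nat \<times> nat \<Rightarrow> 'g::{finite,zero}"
  by (simp add: cochain_weight_def)

lemma cochain_weight_sym:
  assumes "f \<in> cochains n" "u \<in> {1..n}" "v \<in> {1..n}"
  shows "cochain_weight f u v g = cochain_weight f v u (- g)"
proof (cases "u = v")
  case False
  then have "(u, v) \<in> ordered_pairs n" using assms(2,3) by (simp add: ordered_pairs_def)
  then have "f (u, v) = - f (v, u)" using assms(1) unfolding cochains_def by blast
  then have "f (u, v) = g \<longleftrightarrow> f (v, u) = - g" by (metis minus_minus)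
  then show ?thesis using False by (simp add: cochain_weight_def)
qed (simp add: cochain_weight_def)

lemma block_density_01: "0 \<le> block_density n b f i j g" "block_density n b f i j g \<le> 1"
proof -
  let ?F = "{p \<in> {1..n} \<times> {1..n}. (case p of (u, v) \<Rightarrow> (b u, b v)) = (i, j)}"
  have div: "x \<le> real m \<Longrightarrow> x / real m \<le> 1" for x m by (cases "m = 0") auto
  have "(\<Sum>(u, v)\<in>?F. cochain_weight f u v g) \<le> (\<Sum>p\<in>?F. 1)" by (intro sum_mono) (auto simp: cochain_weight_01)
  then show "block_density n b f i j g \<le> 1" 
    unfolding block_density_def using div by simp
  show "0 \<le> block_density n b f i j g"
    unfolding block_density_def by (intro divide_nonneg_nonneg sum_nonneg) (auto simp: cochain_weight_01)
qed

lemma block_density_sym: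
  assumes f: "f \<in> cochains n"
  shows "block_density n b f i j g = block_density n b f j i (- g)"
proof -
  let ?F = "\<lambda>i j. {p \<in> {1..n} \<times> {1..n}. (case p of (u, v) \<Rightarrow> (b u, b v)) = (i, j)}"
  have bij: "bij_betw prod.swap (?F j i) (?F i j)"
    by (rule bij_betw_byWitness[where f'=prod.swap]) auto
  have "(\<Sum>(u, v)\<in>?F i j. cochain_weight f u v g) = (\<Sum>p\<in>?F j i. case prod.swap p of (u, v) \<Rightarrow> cochain_weight f u v g)"
    by (rule sum.reindex_bij_betw[OF bij, symmetric])
  also have "\<dots> = (\<Sum>(u, v)\<in>?F j i. cochain_weight f u v (- g))"
    by (intro sum.cong refl) (auto intro: cochain_weight_sym[OF f])
  finally show ?thesis unfolding block_density_def using bij_betw_same_card[OF bij] by simp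
qed

lemma block_density_sum:
  fixes f :: "nat \<times> nat \<Rightarrow> 'g::{finite,zero}"
  assumes "u \<in> {1..n}" "v \<in> {1..n}"
  shows "(\<Sum>g\<in>UNIV. block_density n b f (b u) (b v) g) = 1"
proof -
  let ?F = "{p \<in> {1..n} \<times> {1..n}. (case p of (u, v) \<Rightarrow> (b u, b v)) = (b u, b v)}"
  have "(u, v) \<in> ?F" using assms by auto
  then have c: "card ?F \<noteq> 0" by (auto simp: card_eq_0_iff)
  have "(\<Sum>g\<in>UNIV. \<Sum>(u, v)\<in>?F. cochain_weight f u v g) = (\<Sum>p\<in>?F. \<Sum>g\<in>UNIV. case p of (u, v) \<Rightarrow> cochain_weight f u v g)"
    by (rule sum.swap)
  also have "\<dots> = (\<Sum>p\<in>?F. 1)" by (intro sum.cong refl) (auto simp: cochain_weight_sum)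
  finally show ?thesis using c unfolding block_density_def by (simp add: sum_divide_distrib[symmetric])
qed

definition filled_graphon :: "nat \<Rightarrow> (nat \<times> nat \<Rightarrow> 'g::zero) \<Rightarrow> 'g cochain_fun" where
  "filled_graphon n f = grid_graphon n (cochain_weight f)"

definition block_graphon :: "nat \<Rightarrow> (nat \<Rightarrow> nat) \<Rightarrow> (nat \<times> nat \<Rightarrow> 'g::zero) \<Rightarrow> 'g cochain_fun" where
  "block_graphon n b f = grid_graphon n (\<lambda>u v. block_density n b f (b u) (b v))"

lemma filled_graphon_in: "n \<ge> 1 \<Longrightarrow> f \<in> cochains n \<Longrightarrow> filled_graphon n f \<in> cochain_graphons"
  for f :: "nat \<times> nat \<Rightarrow> 'g::{finite,ab_group_add}"
  unfolding filled_graphon_def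
  by (rule grid_graphon_in_graphons) (auto simp: cochain_weight_01 intro: cochain_weight_sym)

lemma block_graphon_in: "n \<ge> 1 \<Longrightarrow> f \<in> cochains n \<Longrightarrow> block_graphon n b f \<in> cochain_graphons"
  for f :: "nat \<times> nat \<Rightarrow> 'g::{finite,ab_group_add}"
  unfolding block_graphon_def
  by (rule grid_graphon_in_graphons) (auto simp: block_density_01 intro: block_density_sym)

text \<open>Weak regularity with accuracy \<open>e / CARD('g)\<close> in each slice. That
  \<open>K\<close> is fixed before \<open>n\<close> and \<open>f\<close> keeps both the net and the
  number of partitions under control.\<close>

lemma regular_blocks_exist:
  assumes "e > 0"
  shows "\<exists>K::nat. \<forall>n\<ge>1. \<forall>f\<in>cochains n :: (nat \<times> nat \<Rightarrow> 'g::{finite,ab_group_add}) set.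
    \<exists>b. (\<forall>u. b u < K) \<and> cut_distance (filled_graphon n f) (block_graphon n b f) \<le> e"
proof -
  define \<epsilon> where "\<epsilon> = e / real CARD('g)"
  have \<epsilon>: "\<epsilon> > 0" using assms by (simp add: \<epsilon>_def)
  let ?K = "4 ^ (nat \<lceil>real CARD('g) / \<epsilon>\<^sup>2\<rceil> + 1) :: nat"
  show ?thesis
  proof (intro exI[of _ ?K] allI impI ballI)
    fix n :: nat and f :: "nat \<times> nat \<Rightarrow> 'g" assume n: "n \<ge> 1" and f: "f \<in> cochains n"
    let ?X = "{1..n} \<times> {1..n}"
    have "\<exists>b. (\<forall>u. b u < ?K) \<and> (\<forall>g S T. S \<subseteq> {1..n} \<longrightarrow> T \<subseteq> {1..n} \<longrightarrow>
      \<bar>\<Sum>p\<in>S \<times> T. (case p of (u, v) \<Rightarrow> cochain_weight f u v g) - fiber_avg ?X (\<lambda>(u, v). (b u, b v)) (\<lambda>(u, v). cochain_weight f u v g) p\<bar> \<le> \<epsilon> * (real n)\<^sup>2)"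
      by (rule weak_regularity[OF n \<epsilon>]) (auto simp: cochain_weight_01 abs_le_iff intro: order_trans[of _ 0] split: prod.split)
    then obtain b where b: "\<forall>u. b u < ?K"
      and reg: "\<And>g S T. S \<subseteq> {1..n} \<Longrightarrow> T \<subseteq> {1..n} \<Longrightarrow>
      \<bar>\<Sum>p\<in>S \<times> T. (case p of (u, v) \<Rightarrow> cochain_weight f u v g) - fiber_avg ?X (\<lambda>(u, v). (b u, b v)) (\<lambda>(u, v). cochain_weight f u v g) p\<bar> \<le> \<epsilon> * (real n)\<^sup>2"
      by blast
    have "cut_distance (filled_graphon n f) (block_graphon n b f) \<le> real CARD('g) * \<epsilon>"
      unfolding filled_graphon_def block_graphon_def
    proof (rule cut_distance_grid_graphons_le[OF n])
      fix S T g assume st: "S \<subseteq> {1..n}" "T \<subseteq> {1..n}"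
      show "\<bar>\<Sum>u\<in>S. \<Sum>v\<in>T. cochain_weight f u v g - block_density n b f (b u) (b v) g\<bar> \<le> \<epsilon> * (real n)\<^sup>2"
        using reg[OF st, of g] unfolding block_density_fiber_avg by (simp add: sum.cartesian_product split_beta')
    qed (use filled_graphon_in[OF n f] block_graphon_in[OF n f] in \<open>simp_all add: filled_graphon_def block_graphon_def\<close>)
    then show "\<exists>b. (\<forall>u. b u < ?K) \<and> cut_distance (filled_graphon n f) (block_graphon n b f) \<le> e"
      using b by (intro exI[of _ b]) (simp add: \<epsilon>_def)
  qed
qed

subsection \<open>Total boundedness\<close>

lemma sorting_permutation:
  fixes b :: "nat \<Rightarrow> nat"
  shows "\<exists>\<sigma>. \<sigma> permutes {1..n} \<and> (\<forall>u\<in>{1..n}. \<forall>v\<in>{1..n}. u \<le> v \<longrightarrow> b (\<sigma> u) \<le> b (\<sigma> v))"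
proof -
  define xs where "xs = sort_key b [1..<Suc n]"
  have xs: "length xs = n" "distinct xs" "set xs = {1..n}" "sorted (map b xs)"
    by (auto simp: xs_def)
  define \<sigma> where "\<sigma> u = (if u \<in> {1..n} then xs ! (u - 1) else u)" for u
  have "bij_betw \<sigma> {1..n} {1..n}"
  proof (rule bij_betw_imageI)
    show "inj_on \<sigma> {1..n}" using xs(1,2) by (auto simp: inj_on_def \<sigma>_def nth_eq_iff_index_eq)
    show "\<sigma> ` {1..n} = {1..n}"
    proof -
      have "\<sigma> ` {1..n} = (!) xs ` (\<lambda>u. u - 1) ` {1..n}" by (auto simp: \<sigma>_def image_image)
      also have "(\<lambda>u. u - 1) ` {1..n} = {0..<n}" by (force simp: image_iff)
      also have "(!) xs ` {0..<n} = set xs" by (auto simp: set_conv_nth xs(1))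
      finally show ?thesis using xs(3) by simp
    qed
  qed
  then have "\<sigma> permutes {1..n}" by (rule bij_imp_permutes) (auto simp: \<sigma>_def)
  moreover have "b (\<sigma> u) \<le> b (\<sigma> v)" if "u \<in> {1..n}" "v \<in> {1..n}" "u \<le> v" for u v
    using sorted_nth_mono[OF xs(4), of "u - 1" "v - 1"] that xs(1) by (auto simp: \<sigma>_def)
  ultimately show ?thesis by blast
qed

lemma cell_mono: "x \<le> y \<Longrightarrow> cell n x \<le> cell n y"
  unfolding cell_def by (intro max.mono nat_mono ceiling_mono mult_left_mono) auto

text \<open>A monotone function jumps only to new values, so it is injective on its jumps. This
  bounds the number of coarse cells on which a sorted labelling may change. The index 1, whose cell
  contains the exceptional point 0, is always counted.\<close>

lemma card_jumps_le:
  fixes c :: "nat \<Rightarrow> nat"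
  assumes mono: "\<And>i j. 1 \<le> i \<Longrightarrow> i \<le> j \<Longrightarrow> j \<le> M \<Longrightarrow> c i \<le> c j" and K: "\<And>i. c i < K"
  shows "card {i \<in> {1..M}. i = 1 \<or> c (i - 1) \<noteq> c i} \<le> K + 1"
proof -
  let ?D = "{i \<in> {2..M}. c (i - 1) \<noteq> c i}"
  have "inj_on c ?D"
  proof (rule linorder_inj_onI')
    fix i j assume ij: "i \<in> ?D" "j \<in> ?D" "i < j"
    have "c i \<le> c (j - 1)" "c (j - 1) \<le> c j" using ij by (auto intro!: mono)
    then show "c i \<noteq> c j" using ij by auto
  qed
  then have "card ?D \<le> card {..<K}" by (rule card_inj_on_le) (use K in auto)
  moreover have "card {i \<in> {1..M}. i = 1 \<or> c (i - 1) \<noteq> c i} \<le> card (insert 1 ?D)"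
    by (rule card_mono) auto
  ultimately show ?thesis by (simp add: card_insert_if split: if_splits)
qed

text \<open>
  After sorting the cells by their label, a step graphon with \<open>K\<close> labels is constant on most of the
  cells of a grid whose mesh depends only on \<open>K\<close> and on the accuracy.
\<close>

lemma step_graphons_net:
  fixes K :: nat
  assumes e: "e > 0"
  shows "\<exists>N :: 'g::{finite,ab_group_add} cochain_fun set. finite N \<and> N \<subseteq> cochain_graphons \<and>
    (\<forall>n\<ge>1. \<forall>b w. (\<forall>u. b u < K) \<longrightarrow> (\<forall>i j g. 0 \<le> w i j g \<and> w i j g \<le> 1 \<and> w i j g = w j i (- g)) \<longrightarrow>
      (\<exists>V\<in>N. cut_distance (grid_graphon n (\<lambda>u v. w (b u) (b v))) V < e))"
proof -
  \<comment> \<open>\<open>(2 * K + 3) / M\<close> will be the L1 error per group element: rounding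
    contributes \<open>1 / M\<close>, and at most \<open>K + 1\<close> bad rows and as many bad
    columns of cells contribute \<open>1 / M\<close> each.\<close>
  obtain M :: nat where M: "real CARD('g) * (2 * real K + 3) / e < real M" using reals_Archimedean2 by blast
  have "real CARD('g) * (2 * real K + 3) / e \<ge> 0" using e by simp
  then have M1: "M \<ge> 1" using M by (cases M) auto
  have Me: "real CARD('g) * ((2 * real K + 3) / real M) < e" using M M1 e by (simp add: field_simps)
  define R where "R = (\<lambda>k u v (g::'g). real (k (u, v, g)) / real M) ` (PiE ({1..M} \<times> {1..M} \<times> UNIV) (\<lambda>_. {0..M}))"
  define N where "N = grid_graphon M ` R \<inter> cochain_graphons"
  have "finite R" unfolding R_def by (intro finite_imageI finite_PiE) auto
  then have "finite N" by (simp add: N_def)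
  moreover have "\<exists>V\<in>N. cut_distance (grid_graphon n (\<lambda>u v. w (b u) (b v))) V < e"
    if n: "n \<ge> 1" and b: "\<forall>u. b u < K" and w: "\<forall>i j g. 0 \<le> w i j g \<and> w i j g \<le> 1 \<and> w i j g = w j i (- g)"
    for n b and w :: "nat \<Rightarrow> nat \<Rightarrow> 'g \<Rightarrow> real"
  proof -
    obtain \<sigma> where \<sigma>: "\<sigma> permutes {1..n}" and sorted: "\<And>u v. u \<in> {1..n} \<Longrightarrow> v \<in> {1..n} \<Longrightarrow> u \<le> v \<Longrightarrow> b (\<sigma> u) \<le> b (\<sigma> v)"
      using sorting_permutation[of n b] by blast
    define \<phi> where "\<phi> = shuffle n \<sigma>"
    have \<phi>: "\<phi> \<in> unit_automorphisms" unfolding \<phi>_def by (rule shuffle_automorphism[OF n \<sigma>])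
    define U where "U = grid_graphon n (\<lambda>u v. w (b u) (b v))"
    have U: "U \<in> cochain_graphons" unfolding U_def using n w by (intro grid_graphon_in_graphons) auto
    define \<beta> where "\<beta> x = b (\<sigma> (cell n x))" for x
    have \<beta>_mono: "\<beta> x \<le> \<beta> y" if "0 \<le> x" "x \<le> y" "y \<le> 1" for x y
      unfolding \<beta>_def using that by (intro sorted cell_range n cell_mono) auto
    \<comment> \<open>The label at the right end of coarse cell i. The sorted labels on that cell
      lie between \<open>c (i - 1)\<close> and \<open>c i\<close>, so the label is constant there
      unless \<open>c\<close> jumps.\<close>
    define c where "c i = \<beta> (real i / real M)" for i
    \<comment> \<open>Rounding down to multiples of \<open>1 / M\<close> respects symmetry because
      symmetric entries agree before rounding; \<open>restrict\<close> places \<open>k\<close> in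
      the finite function space behind \<open>R\<close>.\<close>
    define k where "k = restrict (\<lambda>(i, j, g). nat \<lfloor>real M * w (c i) (c j) g\<rfloor>) ({1..M} \<times> {1..M} \<times> (UNIV :: 'g set))"
    define v where "v i j g = real (k (i, j, g)) / real M" for i j g
    define V where "V = grid_graphon M v"
    have k: "k (i, j, g) = nat \<lfloor>real M * w (c i) (c j) g\<rfloor>" if "i \<in> {1..M}" "j \<in> {1..M}" for i j g
      using that by (simp add: k_def)
    have v: "0 \<le> v i j g" "v i j g \<le> w (c i) (c j) g" "w (c i) (c j) g \<le> v i j g + 1 / real M"
      if "i \<in> {1..M}" "j \<in> {1..M}" for i j g
    proof -
      have p: "0 \<le> real M * w (c i) (c j) g" using w by simp
      then have "real (nat \<lfloor>real M * w (c i) (c j) g\<rfloor>) \<le> real M * w (c i) (c j) g"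
        "real M * w (c i) (c j) g \<le> real (nat \<lfloor>real M * w (c i) (c j) g\<rfloor>) + 1" by linarith+
      then show "v i j g \<le> w (c i) (c j) g" "w (c i) (c j) g \<le> v i j g + 1 / real M"
        unfolding v_def k[OF that] using M1 by (auto simp: field_simps)
    qed (simp add: v_def)
    have v1: "v i j g \<le> 1" if "i \<in> {1..M}" "j \<in> {1..M}" for i j g using v(2)[OF that, of g] w order_trans by blast
    have V: "V \<in> cochain_graphons" unfolding V_def
    proof (rule grid_graphon_in_graphons[OF M1])
      fix i j g assume ij: "i \<in> {1..M}" "j \<in> {1..M}"
      show "0 \<le> v i j g \<and> v i j g \<le> 1" using v(1)[OF ij] v1[OF ij] by blast
      have "w (c i) (c j) g = w (c j) (c i) (- g)" using w by blast
      then show "v i j g = v j i (- g)" unfolding v_def k[OF ij] k[OF ij(2,1)] by (simp only:)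
    qed
    have "nat \<lfloor>real M * w (c i) (c j) g\<rfloor> \<le> M" for i j g
    proof -
      have "real M * w (c i) (c j) g \<le> real M" using w by (simp add: mult_left_le)
      then show ?thesis by (simp add: nat_le_iff floor_le_iff)
    qed
    then have "k \<in> PiE ({1..M} \<times> {1..M} \<times> UNIV) (\<lambda>_. {0..M})" unfolding k_def by auto
    then have "v \<in> R" unfolding R_def v_def by (intro image_eqI[of _ _ k]) auto
    then have "V \<in> N" using V unfolding N_def V_def by blast
    define D where "D = {i \<in> {1..M}. i = 1 \<or> c (i - 1) \<noteq> c i}"
    have "card D \<le> K + 1" unfolding D_def
    proof (rule card_jumps_le)
      show "c i < K" for i unfolding c_def \<beta>_def using b by blast
      show "c i \<le> c j" if "1 \<le> i" "i \<le> j" "j \<le> M" for i j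
        unfolding c_def using that M1 by (intro \<beta>_mono) (auto simp: divide_right_mono)
    qed
    have \<beta>c: "\<beta> x = c (cell M x)" "0 < x" if x: "x \<in> {0..1}" "cell M x \<notin> D" for x
    proof -
      let ?i = "cell M x"
      have i: "?i \<in> {1..M}" "?i \<noteq> 1" "c (?i - 1) = c ?i" using x cell_range[OF M1 x(1)] by (auto simp: D_def)
      show x0: "0 < x" using x(1) i(2) cell_zero by (cases "x = 0") auto
      have "(real ?i - 1) / real M < x \<and> x \<le> real ?i / real M" using cell_eq_iff[OF M1 _ x0, of ?i] i by simp
      then have "c (?i - 1) \<le> \<beta> x" "\<beta> x \<le> c ?i"
        unfolding c_def using i x by (auto intro!: \<beta>_mono simp: of_nat_diff)
      then show "\<beta> x = c ?i" using i(3) by simp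
    qed
    define \<psi> where "\<psi> i j = 1 / real M + indicator D i + indicator D j" for i j :: nat
    have close: "\<bar>slice (relabel \<phi> U) g p - slice V g p\<bar> \<le> grid_fun M \<psi> p" if p: "p \<in> space square_leb" for g p
    proof -
      obtain x y where xy: "p = (x, y)" "x \<in> {0..1}" "y \<in> {0..1}" using p by auto
      have sU: "slice (relabel \<phi> U) g p = w (b (cell n (\<phi> x))) (b (cell n (\<phi> y))) g"
        by (simp add: slice_def relabel_def U_def grid_graphon_def xy)
      have sV: "slice V g p = v (cell M x) (cell M y) g" by (simp add: slice_def V_def grid_graphon_def xy)
      show ?thesis
      proof (cases "cell M x \<in> D \<or> cell M y \<in> D")
        case True
        have "\<bar>slice (relabel \<phi> U) g p - slice V g p\<bar> \<le> 1"
          unfolding sU sV using w[rule_format, of "b (cell n (\<phi> x))" "b (cell n (\<phi> y))" g]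
            v(1)[OF cell_range[OF M1 xy(2)] cell_range[OF M1 xy(3)], of g] v1[OF cell_range[OF M1 xy(2)] cell_range[OF M1 xy(3)], of g]
          by linarith
        also have "\<dots> \<le> grid_fun M \<psi> p" using True by (auto simp: grid_fun_def xy \<psi>_def indicator_def)
        finally show ?thesis .
      next
        case False
        then have "0 < x" "0 < y" "\<beta> x = c (cell M x)" "\<beta> y = c (cell M y)" using \<beta>c xy by auto
        then have "slice (relabel \<phi> U) g p = w (c (cell M x)) (c (cell M y)) g"
          using shuffle_pos(1)[OF n \<sigma>] xy unfolding sU by (simp add: \<beta>_def \<phi>_def)
        then have "\<bar>slice (relabel \<phi> U) g p - slice V g p\<bar> \<le> 1 / real M"
          unfolding sV using v(2,3)[OF cell_range[OF M1 xy(2)] cell_range[OF M1 xy(3)], of g] by (simp add: abs_le_iff algebra_simps)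
        then show ?thesis using False by (simp add: grid_fun_def xy \<psi>_def)
      qed
    qed
    have D_sum: "(\<Sum>i\<in>{1..M}. indicator D i) = real (card D)"
    proof -
      have "D \<subseteq> {1..M}" by (auto simp: D_def)
      then have "(\<Sum>i\<in>{1..M}. indicator D i) = (\<Sum>i\<in>D. 1 :: real)"
        by (intro sum.mono_neutral_cong_right) auto
      then show ?thesis by simp
    qed
    have "(\<Sum>i\<in>{1..M}. \<Sum>j\<in>{1..M}. \<psi> i j) = real M + 2 * real M * real (card D)"
      unfolding \<psi>_def using M1
      by (simp add: sum.distrib D_sum[simplified] sum_distrib_left[symmetric]) (simp add: algebra_simps)
    also have "\<dots> \<le> real M + 2 * real M * (real K + 1)" using \<open>card D \<le> K + 1\<close> by (intro add_left_mono mult_left_mono) auto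
    finally have sum\<psi>: "(\<Sum>i\<in>{1..M}. \<Sum>j\<in>{1..M}. \<psi> i j) / (real M)\<^sup>2 \<le> (2 * real K + 3) / real M"
      using M1 by (simp add: field_simps power2_eq_square)
    have "(LINT p|square_leb. \<bar>slice (relabel \<phi> U) g p - slice V g p\<bar>) \<le> (2 * real K + 3) / real M" for g
    proof -
      have "(LINT p|square_leb. \<bar>slice (relabel \<phi> U) g p - slice V g p\<bar>) \<le> (LINT p|square_leb. grid_fun M \<psi> p)"
        by (intro integral_mono integrable_abs integral_grid_fun(1)[OF M1] bounded_kernel_integrable bounded_kernel_slice_diff
            relabel_graphon \<phi> U V close)
      then show ?thesis using sum\<psi> unfolding integral_grid_fun(2)[OF M1] by linarith
    qed
    then have "(\<Sum>g\<in>UNIV. LINT p|square_leb. \<bar>slice (relabel \<phi> U) g p - slice V g p\<bar>) \<le> (\<Sum>g\<in>(UNIV::'g set). (2 * real K + 3) / real M)"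
      by (intro sum_mono)
    then have "cut_distance (relabel \<phi> U) V < e"
      using cut_distance_le_L1[OF relabel_graphon[OF \<phi> U] V] Me by simp
    moreover have "cut_distance U V \<le> cut_distance U (relabel \<phi> U) + cut_distance (relabel \<phi> U) V"
      by (rule cut_distance_triangle[OF U relabel_graphon[OF \<phi> U] V])
    moreover have "cut_distance U (relabel \<phi> U) = 0"
      using cut_distance_relabel[OF \<phi> U] cut_distance_sym[OF U relabel_graphon[OF \<phi> U]] by simp
    ultimately have "cut_distance U V < e" by linarith
    then show ?thesis using \<open>V \<in> N\<close> unfolding U_def by blast
  qed
  ultimately show ?thesis unfolding N_def by (intro exI[of _ N]) (auto simp: N_def)
qed

text \<open>Half of the accuracy is spent on passing to block averages. This fixes the number
  \<open>K\<close> of labels, and the net for step graphons with \<open>K\<close> labels takes the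
  other half.\<close>

lemma filled_graphons_net:
  assumes e: "e > 0"
  shows "\<exists>N. finite N \<and> N \<subseteq> cochain_graphons \<and>
    (\<forall>U\<in>(\<Union>n\<in>{1..}. filled_graphon n ` cochains n) :: 'g::{finite,ab_group_add} cochain_fun set. \<exists>V\<in>N. cut_distance U V < e)"
proof -
  have half: "e / 2 > 0" using e by simp
  obtain K where K: "\<And>n f. n \<ge> 1 \<Longrightarrow> f \<in> (cochains n :: (nat \<times> nat \<Rightarrow> 'g) set) \<Longrightarrow>
    \<exists>b. (\<forall>u. b u < K) \<and> cut_distance (filled_graphon n f) (block_graphon n b f) \<le> e / 2"
    using regular_blocks_exist[OF half, where 'g='g] by blast
  obtain N :: "'g cochain_fun set" where N: "finite N" "N \<subseteq> cochain_graphons"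
    "\<forall>n\<ge>1. \<forall>b w. (\<forall>u. b u < K) \<longrightarrow> (\<forall>i j g. 0 \<le> w i j g \<and> w i j g \<le> 1 \<and> w i j g = w j i (- g)) \<longrightarrow>
      (\<exists>V\<in>N. cut_distance (grid_graphon n (\<lambda>u v. w (b u) (b v))) V < e / 2)"
    using step_graphons_net[OF half, of K] by (elim exE conjE) (rule that)
  have "\<exists>V\<in>N. cut_distance (filled_graphon n f) V < e" if n: "n \<ge> 1" and f: "f \<in> cochains n" for n f
  proof -
    obtain b where b: "\<forall>u. b u < K" "cut_distance (filled_graphon n f) (block_graphon n b f) \<le> e / 2"
      using K[OF n f] by blast
    have "\<forall>i j g. 0 \<le> block_density n b f i j g \<and> block_density n b f i j g \<le> 1 \<and> block_density n b f i j g = block_density n b f j i (- g)"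
      using block_density_01 block_density_sym[OF f] by blast
    then obtain V where V: "V \<in> N" "cut_distance (block_graphon n b f) V < e / 2"
      using N(3)[rule_format, OF n, of b "block_density n b f"] b(1) unfolding block_graphon_def by blast
    have "cut_distance (filled_graphon n f) V \<le> cut_distance (filled_graphon n f) (block_graphon n b f) + cut_distance (block_graphon n b f) V"
      using V N(2) by (intro cut_distance_triangle filled_graphon_in block_graphon_in n f) auto
    with V b show ?thesis by force
  qed
  with N(1,2) show ?thesis by (intro exI[of _ N]) auto
qed

subsection \<open>The law of a random cochain\<close>

definition edges :: "nat \<Rightarrow> (nat \<times> nat) set" where
  "edges n = {(u, v). 1 \<le> u \<and> u < v \<and> v \<le> n}"

lemma finite_edges [simp]: "finite (edges n)"
  by (rule finite_subset[of _ "{1..n} \<times> {1..n}"]) (auto simp: edges_def)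

lemma finite_ordered_pairs [simp]: "finite (ordered_pairs n)"
  by (rule finite_subset[of _ "{1..n} \<times> {1..n}"]) (auto simp: ordered_pairs_def)

lemma finite_cochains [simp]: "finite (cochains n :: (nat \<times> nat \<Rightarrow> 'g::{finite,ab_group_add}) set)"
proof -
  have "finite (ordered_pairs n \<rightarrow>\<^sub>E (UNIV::'g set))" by (intro finite_PiE) auto
  then show ?thesis by (rule finite_subset[rotated]) (auto simp: cochains_def)
qed

lemma cochains_antisym:
  assumes "f \<in> cochains n" "(u, v) \<in> ordered_pairs n" shows "f (u, v) = - f (v, u)"
  using assms unfolding cochains_def by blast

text \<open>Cochains live on ordered pairs, while independence is stated for the pairs with
  \<open>u < v\<close>. The values there are free and antisymmetry fixes the others, so sums over
  cochains become sums over a product space.\<close>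

lemma bij_betw_restrict_edges:
  "bij_betw (\<lambda>f. restrict f (edges n)) (cochains n) (PiE (edges n) (\<lambda>_. UNIV :: 'g::ab_group_add set))"
proof (rule bij_betwI')
  fix f g :: "nat \<times> nat \<Rightarrow> 'g" assume fg: "f \<in> cochains n" "g \<in> cochains n"
  show "restrict f (edges n) = restrict g (edges n) \<longleftrightarrow> f = g"
  proof
    assume eq: "restrict f (edges n) = restrict g (edges n)"
    have e: "f e = g e" if "e \<in> edges n" for e using fun_cong[OF eq, of e] that by simp
    show "f = g"
    proof (rule PiE_ext[of _ "ordered_pairs n" "\<lambda>_. UNIV"])
      fix p assume "p \<in> ordered_pairs n"
      then obtain u v where p: "p = (u, v)" "(u, v) \<in> ordered_pairs n" "u \<noteq> v" by (auto simp: ordered_pairs_def)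
      show "f p = g p"
      proof (cases "u < v")
        case True then show ?thesis using e p by (auto simp: edges_def ordered_pairs_def)
      next
        case False
        then have "(v, u) \<in> edges n" using p by (auto simp: edges_def ordered_pairs_def)
        then show ?thesis using e cochains_antisym[OF fg(1) p(2)] cochains_antisym[OF fg(2) p(2)] p(1) by simp
      qed
    qed (use fg in \<open>auto simp: cochains_def\<close>)
  qed simp
next
  fix h :: "nat \<times> nat \<Rightarrow> 'g" assume h: "h \<in> PiE (edges n) (\<lambda>_. UNIV)"
  define f where "f = restrict (\<lambda>(u, v). if u < v then h (u, v) else - h (v, u)) (ordered_pairs n)"
  have "f (u, v) = - f (v, u)" if "(u, v) \<in> ordered_pairs n" for u v
    using that by (simp add: f_def ordered_pairs_def)
  then have "f \<in> cochains n" unfolding cochains_def f_def by auto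
  moreover have "h = restrict f (edges n)"
  proof (rule PiE_ext[OF h])
    fix e assume e: "e \<in> edges n"
    then obtain u v where "e = (u, v)" "u < v" "(u, v) \<in> ordered_pairs n" by (auto simp: edges_def ordered_pairs_def)
    then show "h e = restrict f (edges n) e" using e by (simp add: f_def)
  qed auto
  ultimately show "\<exists>f\<in>cochains n. h = restrict f (edges n)" by blast
qed auto

lemma sum_cochains_prod:
  fixes k :: "nat \<times> nat \<Rightarrow> 'g::{finite,ab_group_add} \<Rightarrow> real"
  shows "(\<Sum>f\<in>cochains n. \<Prod>e\<in>edges n. k e (f e)) = (\<Prod>e\<in>edges n. \<Sum>g\<in>UNIV. k e g)"
proof -
  have "(\<Prod>e\<in>edges n. \<Sum>g\<in>UNIV. k e g) = (\<Sum>h\<in>PiE (edges n) (\<lambda>_. UNIV). \<Prod>e\<in>edges n. k e (h e))"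
    by (rule prod_sum_PiE) auto
  also have "\<dots> = (\<Sum>f\<in>cochains n. \<Prod>e\<in>edges n. k e (restrict f (edges n) e))"
    by (rule sum.reindex_bij_betw[OF bij_betw_restrict_edges, symmetric])
  also have "\<dots> = (\<Sum>f\<in>cochains n. \<Prod>e\<in>edges n. k e (f e))" by (intro sum.cong prod.cong) auto
  finally show ?thesis ..
qed

text \<open>The product law with edge marginals \<open>q\<close>. A constant \<open>q\<close> equal
  to \<nu> gives the law of the random cochain; other \<open>q\<close> give the tilted laws of both
  bounds.\<close>

definition cochain_prob :: "(nat \<Rightarrow> nat \<Rightarrow> 'g \<Rightarrow> real) \<Rightarrow> nat \<Rightarrow> (nat \<times> nat \<Rightarrow> 'g) \<Rightarrow> real" where
  "cochain_prob q n f = (\<Prod>e\<in>edges n. q (fst e) (snd e) (f e))"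

lemma cochain_prob_sum:
  fixes q :: "nat \<Rightarrow> nat \<Rightarrow> 'g::{finite,ab_group_add} \<Rightarrow> real"
  assumes "\<And>u v. (u, v) \<in> edges n \<Longrightarrow> (\<Sum>g\<in>UNIV. q u v g) = 1"
  shows "(\<Sum>f\<in>cochains n. cochain_prob q n f) = 1"
  unfolding cochain_prob_def
  by (subst sum_cochains_prod[of "\<lambda>e. q (fst e) (snd e)"]) (rule prod.neutral, use assms in auto)

lemma random_cochain_prob:
  assumes rc: "random_cochain \<nu> n M F" and A: "A \<subseteq> cochains n"
  shows "measure M {\<omega> \<in> space M. F \<omega> \<in> A} = (\<Sum>f\<in>A. cochain_prob (\<lambda>_ _. \<nu>) n f)"
proof -
  interpret prob_space M using rc by (simp add: random_cochain_def)
  note Fm = random_cochain_measurable[OF rc]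
  have single: "prob {\<omega> \<in> space M. F \<omega> = f} = cochain_prob (\<lambda>_ _. \<nu>) n f" if f: "f \<in> cochains n" for f
  proof -
    have "F \<omega> = f \<longleftrightarrow> (\<forall>e\<in>edges n. F \<omega> e = f e)" if "\<omega> \<in> space M" for \<omega>
    proof
      assume e: "\<forall>e\<in>edges n. F \<omega> e = f e"
      have "F \<omega> \<in> cochains n" using rc that by (simp add: random_cochain_def)
      moreover have "restrict (F \<omega>) (edges n) = restrict f (edges n)" using e by (intro restrict_ext) auto
      ultimately show "F \<omega> = f"
        using bij_betw_imp_inj_on[OF bij_betw_restrict_edges] f by (auto dest: inj_onD)
    qed simp
    then have eq: "{\<omega> \<in> space M. F \<omega> = f} = {\<omega> \<in> space M. \<forall>e\<in>edges n. F \<omega> e = f e}" by auto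
    show ?thesis
    proof (cases "edges n = {}")
      \<comment> \<open>For n at most 1 there are no edges and the event is sure, whereas
        \<open>indep_varsD_finite\<close> speaks of nonempty index sets.\<close>
      case True
      then show ?thesis unfolding eq by (simp add: cochain_prob_def prob_space)
    next
      case False
      have iv: "indep_vars (\<lambda>_. count_space UNIV) (\<lambda>e \<omega>. F \<omega> e) (edges n)"
        using rc by (simp add: random_cochain_def edges_def)
      have "{\<omega> \<in> space M. \<forall>e\<in>edges n. F \<omega> e = f e} = (\<Inter>e\<in>edges n. (\<lambda>\<omega>. F \<omega> e) -` {f e} \<inter> space M)"
        using False by auto
      then have "prob {\<omega> \<in> space M. F \<omega> = f} = (\<Prod>e\<in>edges n. prob ((\<lambda>\<omega>. F \<omega> e) -` {f e} \<inter> space M))"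
        unfolding eq using indep_varsD_finite[OF iv False, of "\<lambda>e. {f e}"] by simp
      also have "\<dots> = (\<Prod>e\<in>edges n. \<nu> (f e))"
      proof (rule prod.cong[OF refl])
        fix e assume "e \<in> edges n"
        then obtain u v where e: "e = (u, v)" "1 \<le> u" "u < v" "v \<le> n" by (auto simp: edges_def)
        then have "prob {\<omega> \<in> space M. F \<omega> (u, v) = f e} = \<nu> (f e)" using rc by (simp add: random_cochain_def)
        moreover have "(\<lambda>\<omega>. F \<omega> e) -` {f e} \<inter> space M = {\<omega> \<in> space M. F \<omega> (u, v) = f e}" using e by auto
        ultimately show "prob ((\<lambda>\<omega>. F \<omega> e) -` {f e} \<inter> space M) = \<nu> (f e)" by simp
      qed
      finally show ?thesis by (simp add: cochain_prob_def)
    qed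
  qed
  have fin: "finite A" using A finite_subset finite_cochains by blast
  have "{\<omega> \<in> space M. F \<omega> \<in> A} = (\<Union>f\<in>A. {\<omega> \<in> space M. F \<omega> = f})" by auto
  also have "prob \<dots> = (\<Sum>f\<in>A. prob {\<omega> \<in> space M. F \<omega> = f})"
  proof (rule finite_measure_finite_Union[OF fin])
    show "(\<lambda>f. {\<omega> \<in> space M. F \<omega> = f}) ` A \<subseteq> events"
    proof
      fix B assume "B \<in> (\<lambda>f. {\<omega> \<in> space M. F \<omega> = f}) ` A"
      then obtain f where f: "f \<in> A" "B = {\<omega> \<in> space M. F \<omega> = f}" by auto
      have "B = F -` {f} \<inter> space M" using f by auto
      then show "B \<in> events" using measurable_sets[OF Fm, of "{f}"] f A by auto
    qed
  qed (auto simp: disjoint_family_on_def)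
  also have "\<dots> = (\<Sum>f\<in>A. cochain_prob (\<lambda>_ _. \<nu>) n f)" using A by (intro sum.cong refl single) auto
  finally show ?thesis .
qed

lemma sum_square_edges:
  fixes s :: "nat \<Rightarrow> nat \<Rightarrow> real"
  shows "(\<Sum>u\<in>{1..n}. \<Sum>v\<in>{1..n}. s u v)
    = (\<Sum>e\<in>edges n. s (fst e) (snd e) + s (snd e) (fst e)) + (\<Sum>u\<in>{1..n}. s u u)"
proof -
  let ?s = "\<lambda>e. s (fst e) (snd e)"
  have dec: "{1..n} \<times> {1..n} = (edges n \<union> prod.swap ` edges n) \<union> (\<lambda>u. (u, u)) ` {1..n}"
  proof (rule set_eqI)
    fix p :: "nat \<times> nat"
    obtain u v where p: "p = (u, v)" by force
    show "p \<in> {1..n} \<times> {1..n} \<longleftrightarrow> p \<in> (edges n \<union> prod.swap ` edges n) \<union> (\<lambda>u. (u, u)) ` {1..n}"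
      unfolding p by (cases u v rule: linorder_cases) (auto simp: edges_def image_iff)
  qed
  have "(\<Sum>u\<in>{1..n}. \<Sum>v\<in>{1..n}. s u v) = (\<Sum>e\<in>{1..n} \<times> {1..n}. ?s e)"
    by (simp add: sum.cartesian_product split_beta')
  also have "\<dots> = (\<Sum>e\<in>edges n \<union> prod.swap ` edges n. ?s e) + (\<Sum>e\<in>(\<lambda>u. (u, u)) ` {1..n}. ?s e)"
    unfolding dec by (rule sum.union_disjoint) (simp, simp, auto simp: edges_def)
  also have "(\<Sum>e\<in>edges n \<union> prod.swap ` edges n. ?s e) = (\<Sum>e\<in>edges n. ?s e) + (\<Sum>e\<in>prod.swap ` edges n. ?s e)"
    by (rule sum.union_disjoint) (simp, simp, auto simp: edges_def)
  also have "(\<Sum>e\<in>prod.swap ` edges n. ?s e) = (\<Sum>e\<in>edges n. s (snd e) (fst e))"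
    by (subst sum.reindex) auto
  also have "(\<Sum>e\<in>(\<lambda>u. (u, u)) ` {1..n}. ?s e) = (\<Sum>u\<in>{1..n}. s u u)"
    by (subst sum.reindex) (auto simp: inj_on_def)
  finally show ?thesis by (simp add: sum.distrib)
qed

text \<open>Each edge is met twice in the square, the source of the factor 1/2 in the rate function.
  The diagonal has only n terms and is treated apart in both bounds.\<close>

lemma sum_symmetric_square:
  fixes s :: "nat \<Rightarrow> nat \<Rightarrow> real"
  assumes "\<And>u v. u \<in> {1..n} \<Longrightarrow> v \<in> {1..n} \<Longrightarrow> s u v = s v u"
  shows "(\<Sum>u\<in>{1..n}. \<Sum>v\<in>{1..n}. s u v) = 2 * (\<Sum>e\<in>edges n. s (fst e) (snd e)) + (\<Sum>u\<in>{1..n}. s u u)"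
proof -
  have "(\<Sum>e\<in>edges n. s (fst e) (snd e) + s (snd e) (fst e)) = (\<Sum>e\<in>edges n. 2 * s (fst e) (snd e))"
  proof (rule sum.cong[OF refl])
    fix e assume "e \<in> edges n"
    then show "s (fst e) (snd e) + s (snd e) (fst e) = 2 * s (fst e) (snd e)"
      using assms[of "fst e" "snd e"] by (auto simp: edges_def)
  qed
  then show ?thesis unfolding sum_square_edges by (simp add: sum_distrib_left)
qed

subsection \<open>The upper bound\<close>

definition fill :: "(nat \<times> nat \<Rightarrow> 'g::zero) \<Rightarrow> nat \<Rightarrow> nat \<Rightarrow> 'g" where
  "fill f u v = (if u = v then 0 else f (u, v))"

lemma cochain_weight_fill: "cochain_weight f u v g = (if fill f u v = g then 1 else 0)"
  by (simp add: cochain_weight_def fill_def)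

lemma fill_antisym:
  fixes f :: "nat \<times> nat \<Rightarrow> 'g::{finite,ab_group_add}"
  assumes "f \<in> cochains n" "u \<in> {1..n}" "v \<in> {1..n}" shows "fill f u v = - fill f v u"
proof (cases "u = v")
  case False
  then show ?thesis using cochains_antisym[OF assms(1), of u v] assms by (simp add: fill_def ordered_pairs_def)
qed (simp add: fill_def)

definition block_rate :: "('g::{finite,zero} \<Rightarrow> real) \<Rightarrow> nat \<Rightarrow> (nat \<Rightarrow> nat) \<Rightarrow> (nat \<times> nat \<Rightarrow> 'g) \<Rightarrow> real" where
  "block_rate \<nu> n b f = 1 / 2 * (\<Sum>u\<in>{1..n}. \<Sum>v\<in>{1..n}. \<Sum>g\<in>UNIV.
     block_density n b f (b u) (b v) g * ln (block_density n b f (b u) (b v) g / \<nu> g)) / (real n)\<^sup>2"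

lemma rate_block_graphon:
  fixes f :: "nat \<times> nat \<Rightarrow> 'g::{finite,ab_group_add}"
  assumes "n \<ge> 1" "f \<in> cochains n"
  shows "rate \<nu> (block_graphon n b f) = ereal (block_rate \<nu> n b f)"
  unfolding block_graphon_def block_rate_def
  by (rule rate_grid_graphon) (use block_graphon_in[OF assms] assms block_density_sum in \<open>simp_all add: block_graphon_def\<close>)

text \<open>Averaging over blocks is self-adjoint, so against block-constant weights a cochain may
  be replaced by its block densities.\<close>

lemma sum_weight_block_const:
  fixes f :: "nat \<times> nat \<Rightarrow> 'g::{finite,ab_group_add}"
  assumes "\<And>u v u' v'. b u = b u' \<Longrightarrow> b v = b v' \<Longrightarrow> c u v = c u' v'"
  shows "(\<Sum>u\<in>{1..n}. \<Sum>v\<in>{1..n}. cochain_weight f u v g * c u v)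
    = (\<Sum>u\<in>{1..n}. \<Sum>v\<in>{1..n}. block_density n b f (b u) (b v) g * c u v)"
proof -
  let ?X = "{1..n} \<times> {1..n}"
  have "(\<Sum>p\<in>?X. fiber_avg ?X (\<lambda>(u, v). (b u, b v)) (\<lambda>(u, v). cochain_weight f u v g) p * (case p of (u, v) \<Rightarrow> c u v))
     = (\<Sum>p\<in>?X. (case p of (u, v) \<Rightarrow> cochain_weight f u v g) * (case p of (u, v) \<Rightarrow> c u v))"
    by (rule fiber_avg_adjoint) (auto intro: assms)
  then show ?thesis by (simp add: sum.cartesian_product split_beta' block_density_fiber_avg)
qed

text \<open>Compare with the product measure whose edge marginals are the block densities.\<close>

lemma cochain_prob_tilt_le:
  fixes f :: "nat \<times> nat \<Rightarrow> 'g::{finite,ab_group_add}"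
  assumes \<nu>: "symmetric_nondegenerate \<nu>" and n: "n \<ge> 1" and f: "f \<in> cochains n"
  shows "cochain_prob (\<lambda>_ _. \<nu>) n f \<le> cochain_prob (\<lambda>u v. block_density n b f (b u) (b v)) n f
     * exp (real n * (ln (1 / \<nu> 0) / 2) - (real n)\<^sup>2 * block_rate \<nu> n b f)"
proof -
  define w where "w u v = block_density n b f (b u) (b v)" for u v
  have \<nu>0: "0 < \<nu> g" and \<nu>s: "\<nu> (- g) = \<nu> g" for g using \<nu> by (auto simp: symmetric_nondegenerate_def)
  have w1: "w u v g \<le> 1" for u v g unfolding w_def by (rule block_density_01)
  \<comment> \<open>A pair belongs to its own block, so the value of \<open>f\<close> on it has
    positive density there; the logarithms below are of positive numbers.\<close>
  have wpos: "0 < w u v (fill f u v)" if "u \<in> {1..n}" "v \<in> {1..n}" for u v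
  proof -
    let ?F = "{p \<in> {1..n} \<times> {1..n}. (case p of (u, v) \<Rightarrow> (b u, b v)) = (b u, b v)}"
    have m: "(u, v) \<in> ?F" "finite ?F" using that by auto
    have "1 \<le> (\<Sum>(u', v')\<in>?F. cochain_weight f u' v' (fill f u v))"
      using member_le_sum[OF m(1), of "\<lambda>(u', v'). cochain_weight f u' v' (fill f u v)"] m(2)
      by (auto simp: cochain_weight_fill)
    moreover have "real (card ?F) > 0" using m by (auto simp: card_gt_0_iff)
    ultimately show ?thesis unfolding w_def block_density_def by (intro divide_pos_pos) auto
  qed
  \<comment> \<open>For a block-constant cost, the total along \<open>f\<close> is its expectation
    under the block densities. With \<open>ln w\<close> and \<open>ln \<nu>\<close> as costs, this
    expresses the log-probabilities, apart from the diagonal, by the densities alone.\<close>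
  have block: "(\<Sum>u\<in>{1..n}. \<Sum>v\<in>{1..n}. c u v (fill f u v)) = (\<Sum>u\<in>{1..n}. \<Sum>v\<in>{1..n}. \<Sum>g\<in>UNIV. w u v g * c u v g)"
    if c: "\<And>u v u' v' g. b u = b u' \<Longrightarrow> b v = b v' \<Longrightarrow> c u v g = c u' v' g" for c :: "nat \<Rightarrow> nat \<Rightarrow> 'g \<Rightarrow> real"
  proof -
    have "(\<Sum>u\<in>{1..n}. \<Sum>v\<in>{1..n}. c u v (fill f u v)) = (\<Sum>u\<in>{1..n}. \<Sum>v\<in>{1..n}. \<Sum>g\<in>UNIV. cochain_weight f u v g * c u v g)"
      by (simp add: cochain_weight_fill if_distrib[of "\<lambda>x. x * _"] cong: if_cong)
    also have "\<dots> = (\<Sum>g\<in>UNIV. \<Sum>u\<in>{1..n}. \<Sum>v\<in>{1..n}. cochain_weight f u v g * c u v g)"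
      by (subst (2) sum.swap) (subst sum.swap, rule refl)
    also have "\<dots> = (\<Sum>g\<in>UNIV. \<Sum>u\<in>{1..n}. \<Sum>v\<in>{1..n}. w u v g * c u v g)"
      unfolding w_def by (intro sum.cong refl sum_weight_block_const c)
    also have "\<dots> = (\<Sum>u\<in>{1..n}. \<Sum>v\<in>{1..n}. \<Sum>g\<in>UNIV. w u v g * c u v g)"
      by (subst (2) sum.swap) (subst sum.swap, rule refl)
    finally show ?thesis .
  qed
  have lw_sym: "ln (w u v (fill f u v)) = ln (w v u (fill f v u))" if "u \<in> {1..n}" "v \<in> {1..n}" for u v
    using block_density_sym[OF f, of b "b u" "b v" "fill f u v"] fill_antisym[OF f that(2,1)] by (simp add: w_def)
  have l\<nu>_sym: "ln (\<nu> (fill f u v)) = ln (\<nu> (fill f v u))" if "u \<in> {1..n}" "v \<in> {1..n}" for u v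
    using fill_antisym[OF f that(2,1)] by (simp add: \<nu>s)
  have e: "fst e \<in> {1..n}" "snd e \<in> {1..n}" "fill f (fst e) (snd e) = f e" if "e \<in> edges n" for e
    using that by (auto simp: edges_def fill_def)
  have lnQ: "ln (cochain_prob w n f) = (\<Sum>e\<in>edges n. ln (w (fst e) (snd e) (fill f (fst e) (snd e))))"
    unfolding cochain_prob_def by (subst ln_prod) (use wpos e in \<open>auto intro!: sum.cong, fastforce+\<close>)
  have lnP: "ln (cochain_prob (\<lambda>_ _. \<nu>) n f) = (\<Sum>e\<in>edges n. ln (\<nu> (fill f (fst e) (snd e))))"
    unfolding cochain_prob_def by (subst ln_prod) (use \<nu>0 e in \<open>auto intro!: sum.cong simp: less_imp_neq[THEN not_sym]\<close>)
  have diag: "(\<Sum>u\<in>{1..n}. ln (w u u (fill f u u))) \<le> 0"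
    using w1 wpos by (intro sum_nonpos) auto
  have "2 * ln (cochain_prob w n f) = (\<Sum>u\<in>{1..n}. \<Sum>v\<in>{1..n}. ln (w u v (fill f u v))) - (\<Sum>u\<in>{1..n}. ln (w u u (fill f u u)))"
    unfolding lnQ using sum_symmetric_square[OF lw_sym] by simp
  also have "(\<Sum>u\<in>{1..n}. \<Sum>v\<in>{1..n}. ln (w u v (fill f u v))) = (\<Sum>u\<in>{1..n}. \<Sum>v\<in>{1..n}. \<Sum>g\<in>UNIV. w u v g * ln (w u v g))"
    by (rule block[of "\<lambda>u v g. ln (w u v g)"]) (simp add: w_def)
  finally have Q: "2 * ln (cochain_prob w n f) \<ge> (\<Sum>u\<in>{1..n}. \<Sum>v\<in>{1..n}. \<Sum>g\<in>UNIV. w u v g * ln (w u v g))" using diag by simp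
  have "2 * ln (cochain_prob (\<lambda>_ _. \<nu>) n f) = (\<Sum>u\<in>{1..n}. \<Sum>v\<in>{1..n}. ln (\<nu> (fill f u v))) - real n * ln (\<nu> 0)"
    unfolding lnP using sum_symmetric_square[OF l\<nu>_sym] by (simp add: fill_def)
  also have "(\<Sum>u\<in>{1..n}. \<Sum>v\<in>{1..n}. ln (\<nu> (fill f u v))) = (\<Sum>u\<in>{1..n}. \<Sum>v\<in>{1..n}. \<Sum>g\<in>UNIV. w u v g * ln (\<nu> g))"
    by (rule block[of "\<lambda>u v g. ln (\<nu> g)"]) simp
  finally have P: "2 * ln (cochain_prob (\<lambda>_ _. \<nu>) n f) = (\<Sum>u\<in>{1..n}. \<Sum>v\<in>{1..n}. \<Sum>g\<in>UNIV. w u v g * ln (\<nu> g)) - real n * ln (\<nu> 0)" .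
  have "2 * (real n)\<^sup>2 * block_rate \<nu> n b f = (\<Sum>u\<in>{1..n}. \<Sum>v\<in>{1..n}. \<Sum>g\<in>UNIV. w u v g * ln (w u v g / \<nu> g))"
    using n by (simp add: block_rate_def w_def)
  also have "\<dots> = (\<Sum>u\<in>{1..n}. \<Sum>v\<in>{1..n}. \<Sum>g\<in>UNIV. w u v g * ln (w u v g) - w u v g * ln (\<nu> g))"
  proof (intro sum.cong refl)
    fix u v g
    show "w u v g * ln (w u v g / \<nu> g) = w u v g * ln (w u v g) - w u v g * ln (\<nu> g)"
      using block_density_01(1)[of n b f "b u" "b v" g] \<nu>0[of g]
      by (cases "w u v g = 0") (auto simp: w_def ln_div algebra_simps)
  qed
  finally have "ln (cochain_prob (\<lambda>_ _. \<nu>) n f) \<le> ln (cochain_prob w n f) + (real n * (ln (1 / \<nu> 0) / 2) - (real n)\<^sup>2 * block_rate \<nu> n b f)"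
    using P Q \<nu>0[of 0] by (simp add: sum_subtractf ln_div)
  moreover have pos: "0 < cochain_prob (\<lambda>_ _. \<nu>) n f" "0 < cochain_prob w n f"
    unfolding cochain_prob_def using \<nu>0 wpos e by (auto intro!: prod_pos, metis e(1,2,3) wpos)
  ultimately have "cochain_prob (\<lambda>_ _. \<nu>) n f \<le> exp (ln (cochain_prob w n f) + (real n * (ln (1 / \<nu> 0) / 2) - (real n)\<^sup>2 * block_rate \<nu> n b f))"
    by (metis exp_le_cancel_iff exp_ln)
  also have "\<dots> = cochain_prob w n f * exp (real n * (ln (1 / \<nu> 0) / 2) - (real n)\<^sup>2 * block_rate \<nu> n b f)"
    using pos by (simp add: exp_add)
  finally show ?thesis unfolding w_def .
qed

section \<open>Counting block types\<close>

text \<open>The labelling on \<open>{1..n}\<close> together with the number of occurrences of every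
  group element in every block. The restrictions are there to make the set of types finite.\<close>

definition block_type :: "nat \<Rightarrow> nat \<Rightarrow> (nat \<Rightarrow> nat) \<Rightarrow> (nat \<times> nat \<Rightarrow> 'g::zero) \<Rightarrow> (nat \<Rightarrow> nat) \<times> (nat \<times> nat \<times> 'g \<Rightarrow> nat)" where
  "block_type K n b f = (restrict b {1..n}, restrict (\<lambda>(i, j, g).
     card {p \<in> {p \<in> {1..n} \<times> {1..n}. (case p of (u, v) \<Rightarrow> (b u, b v)) = (i, j)}. fill f (fst p) (snd p) = g})
     ({..<K} \<times> {..<K} \<times> UNIV))"

lemma block_type_range:
  fixes f :: "nat \<times> nat \<Rightarrow> 'g::{finite,zero}"
  assumes "\<And>u. b u < K"
  shows "block_type K n b f \<in> PiE {1..n} (\<lambda>_. {..<K}) \<times> PiE ({..<K} \<times> {..<K} \<times> UNIV) (\<lambda>_. {..n\<^sup>2})"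
proof -
  have "card {p \<in> {p \<in> {1..n} \<times> {1..n}. P p}. Q p} \<le> n\<^sup>2" for P Q :: "nat \<times> nat \<Rightarrow> bool"
    using card_mono[of "{1..n} \<times> {1..n}" "{p \<in> {p \<in> {1..n} \<times> {1..n}. P p}. Q p}"] by (auto simp: power2_eq_square)
  then show ?thesis using assms unfolding block_type_def
    by (intro SigmaI restrict_PiE_iff[THEN iffD2] ballI) (simp_all add: split_beta')
qed

text \<open>A block density is a count recorded in the type divided by a block size, and block sizes
  depend on the labelling of \<open>{1..n}\<close> alone.\<close>

lemma block_type_determines:
  fixes f f' :: "nat \<times> nat \<Rightarrow> 'g::{finite,zero}"
  assumes eq: "block_type K n b f = block_type K n b' f'" and b: "\<And>u. b u < K" "\<And>u. b' u < K"
    and uv: "u \<in> {1..n}" "v \<in> {1..n}"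
  shows "block_density n b f (b u) (b v) g = block_density n b' f' (b' u) (b' v) g"
proof -
  let ?F = "\<lambda>b i j. {p \<in> {1..n} \<times> {1..n}. (case p of (u, v) \<Rightarrow> (b u, b v)) = (i, j)}"
  have bb: "b x = b' x" if "x \<in> {1..n}" for x
  proof -
    have "fst (block_type K n b f) x = fst (block_type K n b' f') x" using eq by simp
    then show ?thesis using that by (simp add: block_type_def)
  qed
  have F: "?F b i j = ?F b' i j" for i j using bb by auto
  have "card {p \<in> ?F b (b u) (b v). fill f (fst p) (snd p) = g} = card {p \<in> ?F b' (b u) (b v). fill f' (fst p) (snd p) = g}"
  proof -
    have "snd (block_type K n b f) (b u, b v, g) = snd (block_type K n b' f') (b u, b v, g)" using eq by simp
    then show ?thesis using b by (simp add: block_type_def)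
  qed
  moreover have "(\<Sum>(u, v)\<in>A. cochain_weight f u v g) = real (card {p \<in> A. fill f (fst p) (snd p) = g})"
    if "finite A" for A and f :: "nat \<times> nat \<Rightarrow> 'g"
    using that by (simp add: cochain_weight_fill split_beta' sum.If_cases Int_def)
  ultimately show ?thesis
    unfolding block_density_def bb[OF uv(1), symmetric] bb[OF uv(2), symmetric] F by simp
qed

text \<open>The method of types. Cochains of one type share one tilted law, of total mass one, so
  each type contributes at most the exponential factor; what precedes it bounds the number of types.
  The labelling \<open>b f\<close> may vary with the cochain since it is part of the type.\<close>

lemma cochain_event_prob_le:
  fixes A :: "(nat \<times> nat \<Rightarrow> 'g::{finite,ab_group_add}) set"
  assumes \<nu>: "symmetric_nondegenerate \<nu>" and n: "n \<ge> 1" and A: "A \<subseteq> cochains n" "A \<noteq> {}"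
    and b: "\<And>f u. b f u < (K::nat)"
  shows "\<exists>f\<in>A. (\<Sum>f\<in>A. cochain_prob (\<lambda>_ _. \<nu>) n f) \<le> real K ^ n * (real n ^ 2 + 1) ^ (K * (K * CARD('g)))
    * exp (real n * (ln (1 / \<nu> 0) / 2) - (real n)\<^sup>2 * block_rate \<nu> n (b f) f)"
proof -
  have fin: "finite A" using A finite_subset finite_cochains by blast
  \<comment> \<open>A minimiser of the block rate over the event: its exponential factor serves for
    all types at once.\<close>
  obtain f0 where f0: "f0 \<in> A" "\<And>f. f \<in> A \<Longrightarrow> block_rate \<nu> n (b f0) f0 \<le> block_rate \<nu> n (b f) f"
    using ex_is_arg_min_if_finite[OF fin A(2), of "\<lambda>f. block_rate \<nu> n (b f) f"] by (auto simp: is_arg_min_linorder)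
  define \<kappa> where "\<kappa> f = block_type K n (b f) f" for f :: "nat \<times> nat \<Rightarrow> 'g"
  let ?R = "PiE {1..n} (\<lambda>_. {..<K}) \<times> PiE ({..<K} \<times> {..<K} \<times> (UNIV :: 'g set)) (\<lambda>_. {..n\<^sup>2})"
  let ?B = "exp (real n * (ln (1 / \<nu> 0) / 2) - (real n)\<^sup>2 * block_rate \<nu> n (b f0) f0)"
  have sub: "\<kappa> ` A \<subseteq> ?R" 
    by (rule image_subsetI, unfold \<kappa>_def, rule block_type_range, rule b)
  have finR: "finite ?R" by (intro finite_cartesian_product finite_PiE) auto
  have "card ?R = K ^ n * (n\<^sup>2 + 1) ^ (K * (K * CARD('g)))"
    by (simp add: card_cartesian_product card_PiE)
  then have card: "real (card (\<kappa> ` A)) \<le> real K ^ n * (real n ^ 2 + 1) ^ (K * (K * CARD('g)))"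
  proof -
    have "real (card (\<kappa> ` A)) \<le> real (card ?R)" using card_mono[OF finR sub] by simp
    also have "real (card ?R) = real K ^ n * (real n ^ 2 + 1) ^ (K * (K * CARD('g)))"
      unfolding \<open>card ?R = _\<close> by (simp add: add.commute)
    finally show ?thesis .
  qed
  have group: "(\<Sum>f\<in>{f\<in>A. \<kappa> f = k}. cochain_prob (\<lambda>_ _. \<nu>) n f) \<le> ?B" if k: "k \<in> \<kappa> ` A" for k
  proof -
    obtain f1 where f1: "f1 \<in> A" "\<kappa> f1 = k" using k by auto
    define w where "w u v = block_density n (b f1) f1 (b f1 u) (b f1 v)" for u v
    have w_eq: "block_density n (b f) f (b f u) (b f v) = w u v" if "f \<in> {f\<in>A. \<kappa> f = k}" "u \<in> {1..n}" "v \<in> {1..n}" for f u v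
      unfolding w_def by (intro ext block_type_determines[OF _ b b that(2,3)]) (use that f1 in \<open>simp add: \<kappa>_def\<close>)
    have e: "fst e \<in> {1..n}" "snd e \<in> {1..n}" if "e \<in> edges n" for e using that by (auto simp: edges_def)
    have "cochain_prob (\<lambda>_ _. \<nu>) n f \<le> cochain_prob w n f * ?B" if f: "f \<in> {f\<in>A. \<kappa> f = k}" for f
    proof -
      have "cochain_prob (\<lambda>u v. block_density n (b f) f (b f u) (b f v)) n f = cochain_prob w n f"
        unfolding cochain_prob_def by (intro prod.cong refl) (simp add: w_eq[OF f e])
      then have "cochain_prob (\<lambda>_ _. \<nu>) n f \<le> cochain_prob w n f * exp (real n * (ln (1 / \<nu> 0) / 2) - (real n)\<^sup>2 * block_rate \<nu> n (b f) f)"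
        using cochain_prob_tilt_le[OF \<nu> n, of f "b f"] f A by auto
      also have "\<dots> \<le> cochain_prob w n f * ?B"
      proof (rule mult_left_mono)
        show "0 \<le> cochain_prob w n f" unfolding cochain_prob_def w_def by (intro prod_nonneg ballI block_density_01)
        have "(real n)\<^sup>2 * block_rate \<nu> n (b f0) f0 \<le> (real n)\<^sup>2 * block_rate \<nu> n (b f) f"
          using f0(2) f by (intro mult_left_mono) auto
        then show "exp (real n * (ln (1 / \<nu> 0) / 2) - (real n)\<^sup>2 * block_rate \<nu> n (b f) f) \<le> ?B" by simp
      qed
      finally show ?thesis .
    qed
    then have "(\<Sum>f\<in>{f\<in>A. \<kappa> f = k}. cochain_prob (\<lambda>_ _. \<nu>) n f) \<le> (\<Sum>f\<in>{f\<in>A. \<kappa> f = k}. cochain_prob w n f * ?B)"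
      by (rule sum_mono)
    \<comment> \<open>The weights \<open>w\<close> are common to the whole type, so the sum may be
      enlarged to all cochains, where \<open>cochain_prob w n\<close> has total mass one.\<close>
    also have "\<dots> \<le> (\<Sum>f\<in>cochains n. cochain_prob w n f * ?B)"
      by (rule sum_mono2) (use A in \<open>auto intro!: mult_nonneg_nonneg prod_nonneg simp: cochain_prob_def w_def block_density_01\<close>)
    also have "\<dots> = ?B"
      unfolding sum_distrib_right[symmetric]
      by (subst cochain_prob_sum) (auto simp: w_def edges_def intro!: block_density_sum)
    finally show ?thesis .
  qed
  have "(\<Sum>f\<in>A. cochain_prob (\<lambda>_ _. \<nu>) n f) = (\<Sum>k\<in>\<kappa> ` A. \<Sum>f\<in>{f\<in>A. \<kappa> f = k}. cochain_prob (\<lambda>_ _. \<nu>) n f)"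
    by (rule sum.group[symmetric]) (use fin in auto)
  also have "\<dots> \<le> real (card (\<kappa> ` A)) * ?B" by (intro sum_bounded_above group)
  also have "\<dots> \<le> real K ^ n * (real n ^ 2 + 1) ^ (K * (K * CARD('g))) * ?B" by (intro mult_right_mono card) simp
  finally show ?thesis using f0(1) by blast
qed

lemma AE_square_pos: "AE p in square_leb. 0 < fst p \<and> 0 < snd p"
proof -
  interpret prob_space square_leb by (rule prob_space_square_leb)
  have 0: "{0::real} \<in> sets unit_leb" "{0..1::real} \<in> sets unit_leb" by (auto simp: sets_unit_leb_iff)
  have m0: "measure unit_leb {0::real} = 0" by (subst measure_unit_leb) auto
  have "{0::real} \<times> {0..1} \<in> null_sets square_leb" "{0..1} \<times> {0::real} \<in> null_sets square_leb"
    using rectangle_sets[OF 0] rectangle_sets[OF 0(2,1)] measure_rectangle[OF 0] measure_rectangle[OF 0(2,1)] m0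
    by (auto simp: null_sets_def emeasure_eq_measure)
  then have "({0::real} \<times> {0..1}) \<union> ({0..1} \<times> {0::real}) \<in> null_sets square_leb" by (rule null_sets.Un)
  then show ?thesis by (rule AE_I') auto
qed

text \<open>Up to the null set where a coordinate vanishes, the two differ only in the slice of the
  group element 0, on n diagonal cells of area \<open>1 / n^2\<close> each.\<close>

lemma cut_distance_graphon_of_filled:
  fixes f :: "nat \<times> nat \<Rightarrow> 'g::{finite,ab_group_add}"
  assumes n: "n \<ge> 1" and f: "f \<in> cochains n"
  shows "cut_distance (graphon_of n f) (filled_graphon n f) \<le> 1 / real n"
proof -
  note G = graphon_of_in_graphons[OF f] filled_graphon_in[OF n f]
  define \<psi> where "\<psi> g u v = (if u = v \<and> g = 0 then 1 else 0 :: real)" for g :: 'g and u v :: nat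
  have "(LINT p|square_leb. \<bar>slice (graphon_of n f) g p - slice (filled_graphon n f) g p\<bar>) = (LINT p|square_leb. grid_fun n (\<psi> g) p)" for g
  proof (rule integral_cong_AE)
    show "AE p in square_leb. \<bar>slice (graphon_of n f) g p - slice (filled_graphon n f) g p\<bar> = grid_fun n (\<psi> g) p"
      using AE_square_pos
    proof eventually_elim
      case (elim p)
      obtain x y where p: "p = (x, y)" by force
      have "0 < real n * x" "0 < real n * y" using elim p n by auto
      then have c: "0 < \<lceil>real n * x\<rceil>" "0 < \<lceil>real n * y\<rceil>" by simp_all
      then have cc: "cell n x = nat \<lceil>real n * x\<rceil>" "cell n y = nat \<lceil>real n * y\<rceil>"
        unfolding cell_def by (intro max_absorb2; linarith)+
      then have "cell n x = cell n y \<longleftrightarrow> \<lceil>real n * x\<rceil> = \<lceil>real n * y\<rceil>"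
        unfolding cc using c by linarith
      then show ?case using elim p cc
        by (auto simp: slice_def graphon_of_def filled_graphon_def grid_graphon_def cochain_weight_def grid_fun_def \<psi>_def)
    qed
  qed (use cochain_graphonsD(1)[OF G(1)] cochain_graphonsD(1)[OF G(2)] in measurable)
  then have "(\<Sum>g\<in>UNIV. LINT p|square_leb. \<bar>slice (graphon_of n f) g p - slice (filled_graphon n f) g p\<bar>)
      = (\<Sum>g\<in>UNIV. (\<Sum>u\<in>{1..n}. \<Sum>v\<in>{1..n}. \<psi> g u v) / (real n)\<^sup>2)"
    by (simp add: integral_grid_fun[OF n])
  also have "\<dots> = (\<Sum>g\<in>(UNIV::'g set). if g = 0 then 1 / real n else 0)"
  proof (intro sum.cong refl)
    fix g :: 'g
    have "(\<Sum>u\<in>{1..n}. \<Sum>v\<in>{1..n}. \<psi> g u v) = (if g = 0 then real n else 0)"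
      by (simp add: \<psi>_def)
    then show "(\<Sum>u\<in>{1..n}. \<Sum>v\<in>{1..n}. \<psi> g u v) / (real n)\<^sup>2 = (if g = 0 then 1 / real n else 0)"
      using n by (simp add: power2_eq_square)
  qed
  also have "\<dots> = 1 / real n" by simp
  finally show ?thesis using cut_distance_le_L1[OF G] by simp
qed

lemma ldp_scaled_gt:
  assumes n: "n \<ge> 1" and gt: "ereal (1 / (real n)\<^sup>2) * ln_ereal P > ereal r" and P: "P \<ge> 0"
  shows "P > 0" "ln P > r * (real n)\<^sup>2"
proof -
  have n2: "0 < 1 / (real n)\<^sup>2" using n by simp
  have "P \<noteq> 0"
  proof
    assume "P = 0"
    then have "ereal (1 / (real n)\<^sup>2) * ln_ereal P = - \<infinity>" using n2 n by (simp add: ln_ereal_def)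
    then show False using gt by simp
  qed
  then show "P > 0" using P by simp
  have "r < 1 / (real n)\<^sup>2 * ln P" using gt \<open>P \<noteq> 0\<close> by (simp add: ln_ereal_def)
  then show "ln P > r * (real n)\<^sup>2" using n by (simp add: field_simps)
qed

section \<open>From large probabilities to block graphons of small rate\<close>

text \<open>A probability above \<open>exp (r * n^2)\<close> must leave some cochain of the event
  with block rate at most \<open>- r + e\<close>, because the remaining factors of the type bound
  are \<open>exp\<close> of order less than \<open>n^2\<close>. Infinitely many n suffice, as the
  hypothesis comes from a limsup that is too large.\<close>

lemma ldp_upper_witness:
  fixes \<nu> :: "'g::{finite,ab_group_add} \<Rightarrow> real"
  assumes \<nu>: "symmetric_nondegenerate \<nu>" and rc: "\<And>n. random_cochain \<nu> n (M n) (F n)"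
    and freq: "\<exists>\<^sub>F n in sequentially. ereal r < ereal (1 / (real n)\<^sup>2) *
        ln_ereal (measure (M n) {\<omega> \<in> space (M n). graphon_class (graphon_of n (F n \<omega>)) \<in> \<C>})"
    and e: "e > 0"
  shows "\<exists>n f b. n \<ge> 1 \<and> f \<in> cochains n \<and> 1 / real n < e \<and> graphon_class (graphon_of n f) \<in> \<C>
    \<and> cut_distance (filled_graphon n f) (block_graphon n b f) \<le> e \<and> rate \<nu> (block_graphon n b f) \<le> ereal (- r + e)"
proof -
  obtain K where K: "\<And>n f. n \<ge> 1 \<Longrightarrow> f \<in> (cochains n :: (nat \<times> nat \<Rightarrow> 'g) set) \<Longrightarrow>
    \<exists>b. (\<forall>u. b u < K) \<and> cut_distance (filled_graphon n f) (block_graphon n b f) \<le> e"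
    using regular_blocks_exist[OF e, where 'g='g] by blast
  \<comment> \<open>Positivity serves the logarithm of \<open>K'\<close> and the default labelling
    \<open>\<lambda>_. 0\<close> below.\<close>
  define K' where "K' = max 1 K"
  define c where "c = ln (1 / \<nu> 0) / 2"
  let ?T = "K' * (K' * CARD('g))"
  \<comment> \<open>The logarithm of all factors of the type bound except the rate term, divided by
    \<open>n^2\<close>.\<close>
  have "(\<lambda>n::nat. (real n * ln (real K') + real ?T * ln (real n ^ 2 + 1) + real n * c) / (real n)\<^sup>2) \<longlonglongrightarrow> 0"
    by real_asymp
  then have "\<forall>\<^sub>F n in sequentially. (real n * ln (real K') + real ?T * ln (real n ^ 2 + 1) + real n * c) / (real n)\<^sup>2 < e"
    using e by (rule order_tendstoD)
  moreover have "\<forall>\<^sub>F n in sequentially. 1 / real n < e"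
    using e by (rule order_tendstoD(2)[OF lim_1_over_n])
  ultimately have "\<forall>\<^sub>F n in sequentially. n \<ge> 1 \<and> 1 / real n < e \<and>
      (real n * ln (real K') + real ?T * ln (real n ^ 2 + 1) + real n * c) / (real n)\<^sup>2 < e"
    using eventually_ge_at_top[of 1] by eventually_elim auto
  from frequently_eventually_frequently[OF freq this] obtain n where n: "n \<ge> 1" "1 / real n < e"
    "(real n * ln (real K') + real ?T * ln (real n ^ 2 + 1) + real n * c) / (real n)\<^sup>2 < e"
    and gt: "ereal r < ereal (1 / (real n)\<^sup>2) * ln_ereal (measure (M n) {\<omega> \<in> space (M n). graphon_class (graphon_of n (F n \<omega>)) \<in> \<C>})"
    by (auto dest!: frequently_ex)
  define A where "A = {f \<in> cochains n. graphon_class (graphon_of n f) \<in> \<C>}"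
  define P where "P = (\<Sum>f\<in>A. cochain_prob (\<lambda>_ _. \<nu>) n f)"
  have "{\<omega> \<in> space (M n). graphon_class (graphon_of n (F n \<omega>)) \<in> \<C>} = {\<omega> \<in> space (M n). F n \<omega> \<in> A}"
    using rc[of n] by (auto simp: A_def random_cochain_def)
  also have "measure (M n) \<dots> = P" unfolding P_def by (rule random_cochain_prob[OF rc]) (auto simp: A_def)
  finally have P_eq: "measure (M n) {\<omega> \<in> space (M n). graphon_class (graphon_of n (F n \<omega>)) \<in> \<C>} = P" .
  have P: "P > 0" "ln P > r * (real n)\<^sup>2"
    using ldp_scaled_gt[OF n(1) gt] unfolding P_eq[symmetric] by auto
  then have "A \<noteq> {}" by (auto simp: P_def)
  have "\<forall>f\<in>cochains n :: (nat \<times> nat \<Rightarrow> 'g) set. \<exists>b. (\<forall>u. b u < K') \<and> cut_distance (filled_graphon n f) (block_graphon n b f) \<le> e"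
    using K[OF n(1)] unfolding K'_def by (meson less_le_trans max.cobounded2)
  then obtain b' where b': "\<And>f. f \<in> (cochains n :: (nat \<times> nat \<Rightarrow> 'g) set) \<Longrightarrow> (\<forall>u. b' f u < K') \<and> cut_distance (filled_graphon n f) (block_graphon n (b' f) f) \<le> e"
    by metis
  define b where "b f = (if f \<in> cochains n then b' f else (\<lambda>_. 0))" for f :: "nat \<times> nat \<Rightarrow> 'g"
  have b: "b f u < K'" for f u using b' by (auto simp: b_def K'_def)
  have bd: "cut_distance (filled_graphon n f) (block_graphon n (b f) f) \<le> e" if "f \<in> cochains n" for f
    using b'[OF that] that by (simp add: b_def)
  have AA: "A \<subseteq> cochains n" by (auto simp: A_def)
  obtain f where f: "f \<in> A" and Pf: "P \<le> real K' ^ n * (real n ^ 2 + 1) ^ ?T * exp (real n * c - (real n)\<^sup>2 * block_rate \<nu> n (b f) f)"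
    using cochain_event_prob_le[where b=b, OF \<nu> n(1) AA \<open>A \<noteq> {}\<close> b] unfolding P_def c_def by blast
  have K1: "real K' > 0" by (simp add: K'_def)
  have "ln P \<le> ln (real K' ^ n * (real n ^ 2 + 1) ^ ?T * exp (real n * c - (real n)\<^sup>2 * block_rate \<nu> n (b f) f))"
    using P(1) Pf by simp
  also have "\<dots> = real n * ln (real K') + real ?T * ln (real n ^ 2 + 1) + (real n * c - (real n)\<^sup>2 * block_rate \<nu> n (b f) f)"
  proof -
    have "0 < (real n)\<^sup>2 + 1" by (simp add: add_nonneg_pos)
    then show ?thesis using K1 by (simp add: ln_mult ln_realpow)
  qed
  finally have "r * (real n)\<^sup>2 + (real n)\<^sup>2 * block_rate \<nu> n (b f) f < real n * ln (real K') + real ?T * ln (real n ^ 2 + 1) + real n * c"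
    using P(2) by simp
  then have "(real n)\<^sup>2 * (r + block_rate \<nu> n (b f) f) < e * (real n)\<^sup>2"
    using n(1,3) by (simp add: divide_less_eq algebra_simps)
  then have "block_rate \<nu> n (b f) f < - r + e"
    using n(1) by (simp add: mult.commute[of e])
  then have "rate \<nu> (block_graphon n (b f) f) \<le> ereal (- r + e)"
    using rate_block_graphon[OF n(1), of f \<nu> "b f"] f by (simp add: A_def)
  then show ?thesis using n(1,2) f bd by (intro exI[of _ n] exI[of _ f] exI[of _ "b f"]) (auto simp: A_def)
qed

lemma ldp_upper_bound:
  fixes \<nu> :: "'g::{finite,ab_group_add} \<Rightarrow> real"
  assumes \<nu>: "symmetric_nondegenerate \<nu>" and rc: "\<And>n. random_cochain \<nu> n (M n) (F n)"
    and closed: "closedin cut_topology \<C>"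
  shows "limsup (\<lambda>n. ereal (1 / (real n)\<^sup>2) *
        ln_ereal (measure (M n) {\<omega> \<in> space (M n). graphon_class (graphon_of n (F n \<omega>)) \<in> \<C>}))
      \<le> - (INF A\<in>\<C>. class_rate \<nu> A)" (is "limsup ?s \<le> - ?I")
proof (rule ccontr)
  have \<nu>0: "0 < \<nu> g" for g using \<nu> by (simp add: symmetric_nondegenerate_def)
  assume "\<not> limsup ?s \<le> - ?I"
  then obtain r where r: "- ?I < ereal r" "ereal r < limsup ?s" using ereal_dense2 by (auto simp: not_le)
  have "\<exists>\<^sub>F n in sequentially. ereal r < ?s n"
  proof (rule ccontr)
    assume "\<not> (\<exists>\<^sub>F n in sequentially. ereal r < ?s n)"
    then have "\<forall>\<^sub>F n in sequentially. ?s n \<le> ereal r" by (simp add: not_frequently not_less)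
    then have "limsup ?s \<le> ereal r" by (rule Limsup_bounded)
    then show False using r(2) by simp
  qed
  note wit = ldp_upper_witness[OF \<nu> rc this]
  have "\<forall>k. \<exists>n f b. n \<ge> 1 \<and> f \<in> cochains n \<and> 1 / real n < 1 / real (Suc k) \<and> graphon_class (graphon_of n f) \<in> \<C>
    \<and> cut_distance (filled_graphon n f) (block_graphon n b f) \<le> 1 / real (Suc k)
    \<and> rate \<nu> (block_graphon n b f) \<le> ereal (- r + 1 / real (Suc k))"
    by (intro allI wit) simp
  then obtain n f b where w: "\<And>k. n k \<ge> 1" "\<And>k. f k \<in> cochains (n k)" "\<And>k. 1 / real (n k) < 1 / real (Suc k)"
    "\<And>k. graphon_class (graphon_of (n k) (f k)) \<in> \<C>"
    "\<And>k. cut_distance (filled_graphon (n k) (f k)) (block_graphon (n k) (b k) (f k)) \<le> 1 / real (Suc k)"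
    "\<And>k. rate \<nu> (block_graphon (n k) (b k) (f k)) \<le> ereal (- r + 1 / real (Suc k))"
    by metis
  \<comment> \<open>Three sequences with one limit V: \<open>X\<close> stays in a totally bounded
    set and produces V, \<open>Z\<close> puts the class of V into the closed set, and
    \<open>Y\<close> carries the bound on the rate.\<close>
  define X where "X k = filled_graphon (n k) (f k)" for k
  define Y where "Y k = block_graphon (n k) (b k) (f k)" for k
  define Z where "Z k = graphon_of (n k) (f k)" for k
  have X: "X k \<in> cochain_graphons" and Y: "Y k \<in> cochain_graphons" and Z: "Z k \<in> cochain_graphons" for k
    unfolding X_def Y_def Z_def using w(1,2) by (auto intro: filled_graphon_in block_graphon_in graphon_of_in_graphons)
  have "\<exists>s V. strict_mono s \<and> V \<in> cochain_graphons \<and> (\<lambda>k. cut_distance (X (s k)) V) \<longlonglongrightarrow> 0"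
  proof (rule cut_distance_convergent_subsequence[where S="\<Union>n\<in>{1..}. filled_graphon n ` cochains n"])
    show "(\<Union>n\<in>{1..}. filled_graphon n ` cochains n :: 'g cochain_fun set) \<subseteq> cochain_graphons"
      by (intro UN_least image_subsetI filled_graphon_in) auto
    show "X k \<in> (\<Union>n\<in>{1..}. filled_graphon n ` cochains n)" for k unfolding X_def using w(1,2) by blast
  qed (rule filled_graphons_net)
  then obtain s V where s: "strict_mono s" and V: "V \<in> cochain_graphons" and XV: "(\<lambda>k. cut_distance (X (s k)) V) \<longlonglongrightarrow> 0"
    by blast
  have small: "(\<lambda>k. 1 / real (Suc (s k))) \<longlonglongrightarrow> 0"
    using LIMSEQ_subseq_LIMSEQ[OF LIMSEQ_Suc[OF lim_1_over_n] s] by (simp add: comp_def)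
  have YV: "(\<lambda>k. cut_distance V (Y (s k))) \<longlonglongrightarrow> 0"
  proof (rule tendsto_sandwich[OF _ _ tendsto_const])
    show "(\<lambda>k. cut_distance (X (s k)) V + 1 / real (Suc (s k))) \<longlonglongrightarrow> 0" by (rule tendsto_add_zero[OF XV small])
    show "\<forall>\<^sub>F k in sequentially. cut_distance V (Y (s k)) \<le> cut_distance (X (s k)) V + 1 / real (Suc (s k))"
    proof (rule always_eventually, rule allI)
      fix k
      have "cut_distance V (Y (s k)) \<le> cut_distance V (X (s k)) + cut_distance (X (s k)) (Y (s k))" by (rule cut_distance_triangle[OF V X Y])
      then show "cut_distance V (Y (s k)) \<le> cut_distance (X (s k)) V + 1 / real (Suc (s k))"
        using w(5)[of "s k"] cut_distance_sym[OF X V, of "s k"] unfolding X_def Y_def by linarith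
    qed
  qed (auto intro!: always_eventually cut_distance_nonneg V Y)
  have ZV: "(\<lambda>k. cut_distance (Z (s k)) V) \<longlonglongrightarrow> 0"
  proof (rule tendsto_sandwich[OF _ _ tendsto_const])
    show "(\<lambda>k. cut_distance (X (s k)) V + 1 / real (Suc (s k))) \<longlonglongrightarrow> 0" by (rule tendsto_add_zero[OF XV small])
    show "\<forall>\<^sub>F k in sequentially. cut_distance (Z (s k)) V \<le> cut_distance (X (s k)) V + 1 / real (Suc (s k))"
    proof (rule always_eventually, rule allI)
      fix k
      have "cut_distance (Z (s k)) V \<le> cut_distance (Z (s k)) (X (s k)) + cut_distance (X (s k)) V" by (rule cut_distance_triangle[OF Z X V])
      then show "cut_distance (Z (s k)) V \<le> cut_distance (X (s k)) V + 1 / real (Suc (s k))"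
        using w(3)[of "s k"] cut_distance_graphon_of_filled[OF w(1,2), of "s k"] unfolding X_def Z_def by linarith
    qed
  qed (auto intro!: always_eventually cut_distance_nonneg V Z)
  interpret Metric_space "graphon_classes :: 'g cochain_fun set set" class_distance by (rule Metric_space_graphon_classes)
  have "graphon_class V \<in> \<C>"
  proof -
    have "limitin mtopology (\<lambda>k. graphon_class (Z (s k))) (graphon_class V) sequentially"
      unfolding limitin_metric
      using V Z order_tendstoD(2)[OF ZV] by (simp add: graphon_class_in_classes class_distance_eq)
    moreover have "range (\<lambda>k. graphon_class (Z (s k))) \<subseteq> \<C>" unfolding Z_def using w(4) by auto
    ultimately show ?thesis using closed unfolding cut_topology_def metric_closedin_iff_sequentially_closed by blast
  qed
  \<comment> \<open>\<open>rate_lsc\<close> wants one bound along the whole sequence. The tail from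
    J on has the bound stated here, and J tends to infinity afterwards.\<close>
  have "rate \<nu> V \<le> ereal (- r + 1 / real (Suc J))" for J
  proof (rule rate_lsc[OF \<nu>0 _ V])
    show "(\<lambda>k. cut_distance V (Y (s (k + J)))) \<longlonglongrightarrow> 0" by (rule LIMSEQ_ignore_initial_segment[OF YV])
    show "rate \<nu> (Y (s (k + J))) \<le> ereal (- r + 1 / real (Suc J))" for k
    proof -
      have "J \<le> s (k + J)" using seq_suble[OF s, of "k + J"] by simp
      then have "1 / real (Suc (s (k + J))) \<le> 1 / real (Suc J)" by (intro divide_left_mono) auto
      then show ?thesis using w(6)[of "s (k + J)"] unfolding Y_def by (meson ereal_less_eq(3) add_left_mono order_trans)
    qed
  qed (rule Y)
  moreover have "(\<lambda>J. ereal (- r + 1 / real (Suc J))) \<longlonglongrightarrow> ereal (- r + 0)"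
    by (intro tendsto_ereal tendsto_add tendsto_const LIMSEQ_Suc[OF lim_1_over_n])
  ultimately have "rate \<nu> V \<le> ereal (- r)"
    by (intro LIMSEQ_le_const[of "\<lambda>J. ereal (- r + 1 / real (Suc J))"]) auto
  moreover have "?I \<le> rate \<nu> V"
    using INF_lower[OF \<open>graphon_class V \<in> \<C>\<close>, of "class_rate \<nu>"] class_rate_graphon_class[OF \<nu>0 V] by simp
  ultimately have "?I \<le> ereal (- r)" by simp
  then have "ereal r \<le> - ?I" by (metis ereal_minus_le_minus ereal_uminus_uminus uminus_ereal.simps(1))
  then show False using r(1) by simp
qed

subsection \<open>Averaging over the cells of a grid\<close>

text \<open>Conditional expectation given the label. A cell of measure zero gets the value 0 through
  division by zero.\<close>

definition cell_avg :: "'a measure \<Rightarrow> ('a \<Rightarrow> 'l) \<Rightarrow> ('a \<Rightarrow> real) \<Rightarrow> 'a \<Rightarrow> real" where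
  "cell_avg M \<l> f x = (LINT y|M. indicator (\<l> -` {\<l> x} \<inter> space M) y * f y) / measure M (\<l> -` {\<l> x} \<inter> space M)"

lemma integrable_indicator_mult:
  fixes f :: "'a \<Rightarrow> real"
  shows "A \<in> sets M \<Longrightarrow> integrable M f \<Longrightarrow> integrable M (\<lambda>y. indicator A y * f y)"
  using integrable_mult_indicator[of A M f] by simp

text \<open>The triangle inequality inside each of the finitely many cells; cells of measure zero
  contribute nothing to the left-hand side.\<close>

lemma cell_avg_L1:
  assumes M: "finite_measure M" and \<l>: "\<l> \<in> M \<rightarrow>\<^sub>M count_space UNIV" "finite (\<l> ` space M)" and f: "integrable M f"
  shows "integrable M (cell_avg M \<l> f)" "(LINT x|M. \<bar>cell_avg M \<l> f x\<bar>) \<le> (LINT x|M. \<bar>f x\<bar>)"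
proof -
  interpret finite_measure M by fact
  define C where "C l = \<l> -` {l} \<inter> space M" for l
  define I where "I l = (LINT y|M. indicator (C l) y * f y)" for l
  let ?L = "\<l> ` space M"
  have C: "C l \<in> sets M" for l unfolding C_def by (rule measurable_sets[OF \<l>(1)]) simp
  have ind: "(\<Sum>l\<in>?L. h l * indicator (C l) x) = h (\<l> x)" if "x \<in> space M" for x and h :: "_ \<Rightarrow> real"
  proof -
    have "(\<Sum>l\<in>?L. h l * indicator (C l) x) = (\<Sum>l\<in>?L. if l = \<l> x then h l else 0)"
      using that by (intro sum.cong refl) (auto simp: C_def indicator_def)
    then show ?thesis using that \<l>(2) by simp
  qed
  have Ci: "integrable M (indicator (C l) :: _ \<Rightarrow> real)" for l
    using C[of l] by (simp add: integrable_indicator_iff emeasure_eq_measure)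
  have eq: "cell_avg M \<l> f x = (\<Sum>l\<in>?L. I l / measure M (C l) * indicator (C l) x)" if "x \<in> space M" for x
    unfolding ind[OF that] by (simp add: cell_avg_def I_def C_def)
  show "integrable M (cell_avg M \<l> f)"
    by (subst Bochner_Integration.integrable_cong[OF refl eq]) (use Ci in auto)
  have "(LINT x|M. \<bar>cell_avg M \<l> f x\<bar>) = (LINT x|M. (\<Sum>l\<in>?L. \<bar>I l / measure M (C l)\<bar> * indicator (C l) x))"
  proof (intro Bochner_Integration.integral_cong refl)
    fix x assume "x \<in> space M"
    then show "\<bar>cell_avg M \<l> f x\<bar> = (\<Sum>l\<in>?L. \<bar>I l / measure M (C l)\<bar> * indicator (C l) x)"
      by (subst ind) (simp_all add: cell_avg_def I_def C_def)
  qed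
  also have "\<dots> = (\<Sum>l\<in>?L. \<bar>I l / measure M (C l)\<bar> * measure M (C l))"
    using Ci C by (simp add: sets.Int_space_eq2)
  also have "\<dots> \<le> (\<Sum>l\<in>?L. (LINT y|M. indicator (C l) y * \<bar>f y\<bar>))"
  proof (rule sum_mono)
    fix l
    have "\<bar>I l / measure M (C l)\<bar> * measure M (C l) \<le> \<bar>I l\<bar>"
      by (cases "measure M (C l) = 0") (auto simp: abs_mult)
    also have "\<dots> \<le> (LINT y|M. \<bar>indicator (C l) y * f y\<bar>)" unfolding I_def by (rule integral_abs_bound)
    also have "\<dots> = (LINT y|M. indicator (C l) y * \<bar>f y\<bar>)" by (simp add: abs_mult)
    finally show "\<bar>I l / measure M (C l)\<bar> * measure M (C l) \<le> (LINT y|M. indicator (C l) y * \<bar>f y\<bar>)" .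
  qed
  also have "\<dots> = (LINT y|M. (\<Sum>l\<in>?L. \<bar>f y\<bar> * indicator (C l) y))"
    using integrable_indicator_mult[OF C integrable_abs[OF f]] by (simp add: mult.commute)
  also have "\<dots> = (LINT y|M. \<bar>f y\<bar>)" by (intro Bochner_Integration.integral_cong refl) (simp add: ind)
  finally show "(LINT x|M. \<bar>cell_avg M \<l> f x\<bar>) \<le> (LINT x|M. \<bar>f x\<bar>)" .
qed

text \<open>Averaging is an L1 contraction, so the distance of a function to its average is a
  seminorm of at most twice the L1 norm. Convergence on a generator therefore extends to all
  integrable functions.\<close>

lemma cell_avg_tendsto:
  fixes \<l> :: "nat \<Rightarrow> 'a \<Rightarrow> 'l"
  assumes M: "finite_measure M" and \<l>: "\<And>n. \<l> n \<in> M \<rightarrow>\<^sub>M count_space UNIV" "\<And>n. finite (\<l> n ` space M)"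
    and G: "sets M = sigma_sets (space M) G" "Int_stable G" "G \<subseteq> Pow (space M)" "space M \<in> G"
    and base: "\<And>A. A \<in> G \<Longrightarrow> (\<lambda>n. LINT x|M. \<bar>cell_avg M (\<l> n) (indicator A) x - indicator A x\<bar>) \<longlonglongrightarrow> 0"
    and f: "integrable M f"
  shows "(\<lambda>n. LINT x|M. \<bar>cell_avg M (\<l> n) f x - f x\<bar>) \<longlonglongrightarrow> 0"
proof (rule seminorm_tendsto_zero[OF M G, where N="\<lambda>n f. LINT x|M. \<bar>cell_avg M (\<l> n) f x - f x\<bar>" and C=2])
  fix n and f g :: "'a \<Rightarrow> real" and c :: real assume f: "integrable M f"
  note a = cell_avg_L1[OF M \<l>(1) \<l>(2)]
  have sc: "cell_avg M (\<l> n) (\<lambda>x. c * f x) x = c * cell_avg M (\<l> n) f x" for x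
    by (simp add: cell_avg_def mult.left_commute)
  show "(LINT x|M. \<bar>cell_avg M (\<l> n) (\<lambda>x. c * f x) x - c * f x\<bar>) \<le> \<bar>c\<bar> * (LINT x|M. \<bar>cell_avg M (\<l> n) f x - f x\<bar>)"
    unfolding sc by (simp add: right_diff_distrib[symmetric] abs_mult)
  have "(LINT x|M. \<bar>cell_avg M (\<l> n) f x - f x\<bar>) \<le> (LINT x|M. \<bar>cell_avg M (\<l> n) f x\<bar> + \<bar>f x\<bar>)"
    using a(1)[OF f] f by (intro integral_mono) auto
  also have "\<dots> \<le> 2 * (LINT x|M. \<bar>f x\<bar>)" using a[OF f, of n] f by simp
  finally show "(LINT x|M. \<bar>cell_avg M (\<l> n) f x - f x\<bar>) \<le> 2 * (LINT x|M. \<bar>f x\<bar>)" .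
  assume g: "integrable M g"
  have add: "cell_avg M (\<l> n) (\<lambda>x. f x + g x) x = cell_avg M (\<l> n) f x + cell_avg M (\<l> n) g x" for x
    unfolding cell_avg_def distrib_left
    using integrable_indicator_mult[OF measurable_sets[OF \<l>(1)] f] integrable_indicator_mult[OF measurable_sets[OF \<l>(1)] g]
    by (simp add: add_divide_distrib)
  have "(LINT x|M. \<bar>cell_avg M (\<l> n) (\<lambda>x. f x + g x) x - (f x + g x)\<bar>)
     \<le> (LINT x|M. \<bar>cell_avg M (\<l> n) f x - f x\<bar> + \<bar>cell_avg M (\<l> n) g x - g x\<bar>)"
    unfolding add using a(1)[OF f, of n] a(1)[OF g, of n] f g by (intro integral_mono) auto
  also have "\<dots> = (LINT x|M. \<bar>cell_avg M (\<l> n) f x - f x\<bar>) + (LINT x|M. \<bar>cell_avg M (\<l> n) g x - g x\<bar>)"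
    using a(1)[OF f, of n] a(1)[OF g, of n] f g by simp
  finally show "(LINT x|M. \<bar>cell_avg M (\<l> n) (\<lambda>x. f x + g x) x - (f x + g x)\<bar>)
    \<le> (LINT x|M. \<bar>cell_avg M (\<l> n) f x - f x\<bar>) + (LINT x|M. \<bar>cell_avg M (\<l> n) g x - g x\<bar>)" .
qed (use base f in auto)

lemma cell_avg_indicator:
  "A \<in> sets M \<Longrightarrow> cell_avg M \<l> (indicator A) x = measure M (A \<inter> (\<l> -` {\<l> x} \<inter> space M)) / measure M (\<l> -` {\<l> x} \<inter> space M)"
  unfolding cell_avg_def using sets.sets_into_space[of A M]
  by (simp add: indicator_inter_arith[symmetric] Int_ac Int_absorb2)

lemma cell_avg_indicator_01:
  assumes "finite_measure M" "A \<in> sets M" "\<l> \<in> M \<rightarrow>\<^sub>M count_space UNIV"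
  shows "0 \<le> cell_avg M \<l> (indicator A) x \<and> cell_avg M \<l> (indicator A) x \<le> 1"
proof -
  interpret finite_measure M by fact
  have "\<l> -` {\<l> x} \<inter> space M \<in> sets M" by (rule measurable_sets[OF assms(3)]) simp
  then have "measure M (A \<inter> (\<l> -` {\<l> x} \<inter> space M)) \<le> measure M (\<l> -` {\<l> x} \<inter> space M)"
    by (intro finite_measure_mono) auto
  then show ?thesis by (simp add: cell_avg_indicator[OF assms(2)] divide_le_eq_1) (smt (verit) measure_nonneg)
qed

lemma finite_measure_unit_leb: "finite_measure unit_leb"
  using prob_space_unit_leb by (rule prob_space.finite_measure)

definition initial_segments :: "real set set" where
  "initial_segments = {A \<in> sets unit_leb. \<exists>a. AE x in unit_leb. x \<in> A \<longleftrightarrow> x \<le> a}"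

text \<open>Null sets are included in the generator since \<^const>\<open>unit_leb\<close> is complete.\<close>

lemma initial_segments_generate:
  "sets unit_leb = sigma_sets (space unit_leb) initial_segments" "Int_stable initial_segments"
  "initial_segments \<subseteq> Pow (space unit_leb)" "space unit_leb \<in> initial_segments"
proof -
  show sub: "initial_segments \<subseteq> Pow (space unit_leb)"
    using sets.sets_into_space[of _ unit_leb] by (auto simp: initial_segments_def)
  show "space unit_leb \<in> initial_segments"
    unfolding initial_segments_def by (auto intro!: exI[of _ 1] AE_I2 simp: sets_unit_leb_iff)
  show "Int_stable initial_segments"
  proof (rule Int_stableI)
    fix A B assume "A \<in> initial_segments" "B \<in> initial_segments"
    then obtain a b where ab: "A \<in> sets unit_leb" "B \<in> sets unit_leb"
      and ae: "AE x in unit_leb. x \<in> A \<longleftrightarrow> x \<le> a" "AE x in unit_leb. x \<in> B \<longleftrightarrow> x \<le> b"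
      by (auto simp: initial_segments_def)
    have "AE x in unit_leb. x \<in> A \<inter> B \<longleftrightarrow> x \<le> min a b" using ae by eventually_elim auto
    then show "A \<inter> B \<in> initial_segments" using ab unfolding initial_segments_def by blast
  qed
  show "sets unit_leb = sigma_sets (space unit_leb) initial_segments"
  proof
    show "sigma_sets (space unit_leb) initial_segments \<subseteq> sets unit_leb"
      by (rule sets.sigma_sets_subset) (auto simp: initial_segments_def)
    show "sets unit_leb \<subseteq> sigma_sets (space unit_leb) initial_segments"
    proof
      fix A assume A: "A \<in> sets unit_leb"
      then have "A \<in> sets (completion lborel)" "A \<subseteq> {0..1}" by (auto simp: sets_unit_leb_iff)
      then obtain B N N' where BN: "A = B \<union> N" "N \<subseteq> N'" "N' \<in> null_sets lborel" "B \<in> sets lborel"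
        by (elim sets_completionE)
      \<comment> \<open>The identity is measurable from \<open>S\<close> to the Borel sets since
        half-lines pull back to initial segments. This covers the Borel part \<open>B\<close> of the
        decomposition; \<open>N\<close> is the part inside a null set.\<close>
      define S where "S = sigma {0..1::real} initial_segments"
      have S: "space S = {0..1}" "sets S = sigma_sets {0..1} initial_segments"
        using sub by (auto simp: S_def)
      have "(\<lambda>x. x) \<in> borel_measurable S"
        unfolding borel_measurable_iff_le
      proof
        fix a :: real
        have "{w \<in> space S. w \<le> a} = {0..1} \<inter> {..a}" using S by auto
        moreover have "{0..1} \<inter> {..a} \<in> initial_segments"
          unfolding initial_segments_def by (auto intro!: exI[of _ a] AE_I2 simp: sets_unit_leb_iff)
        ultimately show "{w \<in> space S. w \<le> a} \<in> sets S" unfolding S(2) by (simp add: sigma_sets.Basic)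
      qed
      from measurable_sets[OF this, of B] have "B \<inter> {0..1} \<in> sigma_sets {0..1} initial_segments"
        using BN(4) S by simp
      moreover have "N \<in> initial_segments"
      proof -
        have nl: "N' \<in> null_sets lebesgue" using BN(3) by (rule null_sets_completionI)
        have N: "N \<in> null_sets lebesgue" using BN(2) nl null_sets_completion_subset[of N N' lborel] BN(3) by blast
        have "N \<subseteq> {0..1}" using \<open>A \<subseteq> {0..1}\<close> BN(1) by auto
        then have "N \<in> null_sets unit_leb" using N unfolding unit_leb_def by (subst null_sets_restrict_space) auto
        then have "AE x in unit_leb. x \<notin> N" "N \<in> sets unit_leb" by (auto intro: AE_not_in)
        \<comment> \<open>A bound to the left of the unit interval makes a null set an initial
          segment.\<close>
        moreover have "AE x in unit_leb. x \<in> N \<longleftrightarrow> x \<le> - 1"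
          using AE_space \<open>AE x in unit_leb. x \<notin> N\<close> by eventually_elim auto
        ultimately show ?thesis unfolding initial_segments_def by blast
      qed
      moreover have "A = (B \<inter> {0..1}) \<union> N" using BN(1) \<open>A \<subseteq> {0..1}\<close> by auto
      ultimately show "A \<in> sigma_sets (space unit_leb) initial_segments"
        using sigma_sets_Un[OF _ sigma_sets.Basic] by (metis space_unit_leb)
    qed
  qed
qed

lemma vimage_cell: "cell n -` {u} \<inter> space unit_leb = cell_set n u"
  by (auto simp: cell_set_def)

lemma finite_cell_range: "finite (cell n ` {0..1})"
proof (cases "n \<ge> 1")
  case True
  then have "cell n ` {0..1} \<subseteq> {1..n}" by (intro image_subsetI cell_range)
  then show ?thesis by (rule finite_subset) simp
next
  case False
  then have "n = 0" by simp
  then have "cell n ` {0..1} \<subseteq> {1}" by (auto simp: cell_def)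
  then show ?thesis by (rule finite_subset) simp
qed

text \<open>Up to null sets, averaging alters the indicator of the points below \<open>a\<close>
  only on the cell of \<open>a\<close>, whose measure is at most \<open>1 / Suc n\<close>. The shift
  to \<open>Suc n\<close> avoids the degenerate grid.\<close>

lemma cell_avg_unit_tendsto:
  assumes "integrable unit_leb f"
  shows "(\<lambda>n. LINT x|unit_leb. \<bar>cell_avg unit_leb (cell (Suc n)) f x - f x\<bar>) \<longlonglongrightarrow> 0"
proof (rule cell_avg_tendsto[OF finite_measure_unit_leb measurable_cell _ initial_segments_generate _ assms])
  interpret finite_measure unit_leb by (rule finite_measure_unit_leb)
  fix A assume "A \<in> initial_segments"
  then obtain a where A: "A \<in> sets unit_leb" and ae: "AE x in unit_leb. x \<in> A \<longleftrightarrow> x \<le> a"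
    by (auto simp: initial_segments_def)
  have "(LINT x|unit_leb. \<bar>cell_avg unit_leb (cell (Suc n)) (indicator A) x - indicator A x\<bar>) \<le> 1 / real (Suc n)" for n
  proof -
    let ?n = "Suc n" and ?u = "cell (Suc n) a"
    have n: "?n \<ge> 1" by simp
    have "AE x in unit_leb. \<bar>cell_avg unit_leb (cell ?n) (indicator A) x - indicator A x\<bar> \<le> indicator (cell_set ?n ?u) x"
      using ae AE_space
    proof eventually_elim
      case (elim x)
      show ?case
      proof (cases "cell ?n x = ?u")
        case True
        then show ?thesis
          using elim cell_avg_indicator_01[OF finite_measure_unit_leb A measurable_cell, of ?n x]
          by (auto simp: cell_set_def indicator_def)
      next
        case False
        have same: "y \<le> a \<longleftrightarrow> x \<le> a" if "y \<in> cell_set ?n (cell ?n x)" for y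
        proof -
          have "cell ?n y = cell ?n x" using that by (simp add: cell_set_def)
          then show ?thesis using False cell_mono[of x a ?n] cell_mono[of a x ?n] cell_mono[of y a ?n] cell_mono[of a y ?n]
            by (smt (verit) le_antisym)
        qed
        have ux: "cell ?n x \<in> {1..?n}" using cell_range[OF n, of x] elim by simp
        have "measure unit_leb (A \<inter> cell_set ?n (cell ?n x)) = indicator A x * measure unit_leb (cell_set ?n (cell ?n x))"
        proof -
          have "measure unit_leb (A \<inter> cell_set ?n (cell ?n x)) = measure unit_leb (if x \<le> a then cell_set ?n (cell ?n x) else {})"
          proof (rule measure_eq_AE)
            show "AE y in unit_leb. y \<in> A \<inter> cell_set ?n (cell ?n x) \<longleftrightarrow> y \<in> (if x \<le> a then cell_set ?n (cell ?n x) else {})"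
              using ae by eventually_elim (use same in auto)
          qed (use A in auto)
          then show ?thesis using elim by (auto simp: indicator_def)
        qed
        then have "cell_avg unit_leb (cell ?n) (indicator A) x = indicator A x"
          unfolding cell_avg_indicator[OF A] vimage_cell using measure_cell_set[OF n ux] by simp
        then show ?thesis by simp
      qed
    qed
    then have "(LINT x|unit_leb. \<bar>cell_avg unit_leb (cell ?n) (indicator A) x - indicator A x\<bar>) \<le> (LINT x|unit_leb. indicator (cell_set ?n ?u) x)"
      using cell_avg_L1(1)[OF finite_measure_unit_leb measurable_cell, of ?n "indicator A"] finite_cell_range[of ?n] A
      by (intro integral_mono_AE integrable_abs Bochner_Integration.integrable_diff integrable_real_indicator) (auto simp: emeasure_eq_measure)
    also have "\<dots> \<le> 1 / real ?n"
    proof (cases "?u \<in> {1..?n}")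
      case True
      then show ?thesis using measure_cell_set[OF n True] by (simp add: Int_commute[of _ "{0..1}"])
    next
      \<comment> \<open>This happens for \<open>a > 1\<close>, when the index of the cell exceeds
        the grid.\<close>
      case False
      have "?u \<in> {1..?n}" if "x \<in> cell_set ?n ?u" for x
        using that cell_range[OF n, of x] unfolding cell_set_def by (metis (mono_tags, lifting) mem_Collect_eq)
      then have "cell_set ?n ?u = {}" using False by blast
      then show ?thesis by simp
    qed
    finally show ?thesis .
  qed
  then show "(\<lambda>n. LINT x|unit_leb. \<bar>cell_avg unit_leb (cell (Suc n)) (indicator A) x - indicator A x\<bar>) \<longlonglongrightarrow> 0"
    by (intro tendsto_sandwich[OF _ _ tendsto_const LIMSEQ_Suc[OF lim_1_over_n]]) (auto intro!: always_eventually)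
qed (simp add: finite_cell_range)

section \<open>Grid averages on the square\<close>

definition cell2 :: "nat \<Rightarrow> real \<times> real \<Rightarrow> nat \<times> nat" where
  "cell2 n p = (cell n (fst p), cell n (snd p))"

lemma measurable_cell2: "cell2 n \<in> square_leb \<rightarrow>\<^sub>M count_space UNIV"
proof -
  have "cell2 n \<in> square_leb \<rightarrow>\<^sub>M count_space UNIV \<Otimes>\<^sub>M count_space UNIV"
    unfolding square_leb_def cell2_def[abs_def] by measurable
  then show ?thesis by (simp add: pair_measure_countable)
qed

lemma vimage_cell2: "cell2 n -` {cell2 n p} \<inter> space square_leb = cell_set n (cell n (fst p)) \<times> cell_set n (cell n (snd p))"
  by (auto simp: cell2_def cell_set_def)

lemma finite_cell2_range: "finite (cell2 n ` space square_leb)"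
  by (rule finite_subset[of _ "cell n ` {0..1} \<times> cell n ` {0..1}"]) (auto simp: cell2_def finite_cell_range)

lemma integral_fst_snd_square:
  fixes h :: "real \<Rightarrow> real"
  assumes "integrable unit_leb h"
  shows "integrable square_leb (\<lambda>p. h (fst p))" "(LINT p|square_leb. h (fst p)) = (LINT x|unit_leb. h x)"
    "integrable square_leb (\<lambda>p. h (snd p))" "(LINT p|square_leb. h (snd p)) = (LINT x|unit_leb. h x)"
proof -
  interpret prob_space unit_leb by (rule prob_space_unit_leb)
  have d: "distr square_leb unit_leb fst = unit_leb" unfolding square_leb_def by (rule distr_pair_fst)
  have f: "fst \<in> square_leb \<rightarrow>\<^sub>M unit_leb" unfolding square_leb_def by measurable
  have i: "integrable square_leb (\<lambda>p. h (fst p))"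
    using integrable_distr[OF f, of h] assms by (simp add: d)
  then show "integrable square_leb (\<lambda>p. h (fst p))" .
  show e: "(LINT p|square_leb. h (fst p)) = (LINT x|unit_leb. h x)"
    using integral_distr[OF f, of h] assms by (simp add: d)
  have h: "(\<lambda>p. h (fst p)) \<in> borel_measurable square_leb" using i by simp
  have si: "integrable (distr square_leb square_leb prod.swap) (\<lambda>p. h (fst p))" using i by (simp add: distr_swap_square)
  show "integrable square_leb (\<lambda>p. h (snd p))"
    using integrable_distr[OF measurable_swap_square si] by simp
  show "(LINT p|square_leb. h (snd p)) = (LINT x|unit_leb. h x)"
    using integral_distr[OF measurable_swap_square h] by (simp add: distr_swap_square e)
qed

lemma abs_prod_diff_le:
  fixes a b s t :: real
  assumes "0 \<le> a" "a \<le> 1" "0 \<le> t" "t \<le> 1"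
  shows "\<bar>a * b - s * t\<bar> \<le> \<bar>a - s\<bar> + \<bar>b - t\<bar>"
proof -
  have "a * b - s * t = (a - s) * t + a * (b - t)" by (simp add: algebra_simps)
  also have "\<bar>\<dots>\<bar> \<le> \<bar>(a - s) * t\<bar> + \<bar>a * (b - t)\<bar>" by (rule abs_triangle_ineq)
  also have "\<dots> \<le> \<bar>a - s\<bar> + \<bar>b - t\<bar>" using assms by (auto simp: abs_mult intro!: add_mono mult_left_le mult_left_le_one_le)
  finally show ?thesis .
qed

text \<open>The average of the indicator of a rectangle is a product of two one-dimensional
  averages, so its error is at most the sum of two errors on the interval.\<close>

lemma cell_avg_square_tendsto:
  assumes f: "integrable square_leb f"
  shows "(\<lambda>n. LINT p|square_leb. \<bar>cell_avg square_leb (cell2 (Suc n)) f p - f p\<bar>) \<longlonglongrightarrow> 0"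
proof (rule cell_avg_tendsto[OF finite_measure_square_leb measurable_cell2 finite_cell2_range rectangle_generator _ f])
  fix A assume "A \<in> {S \<times> T |S T. S \<in> sets unit_leb \<and> T \<in> sets unit_leb}"
  then obtain S T where A: "A = S \<times> T" "S \<in> sets unit_leb" "T \<in> sets unit_leb" by auto
  interpret finite_measure unit_leb by (rule finite_measure_unit_leb)
  note ST = rectangle_sets[OF A(2,3)]
  have int: "integrable unit_leb (indicator B :: _ \<Rightarrow> real)" if "B \<in> sets unit_leb" for B
    using that by (intro integrable_real_indicator) (auto simp: emeasure_eq_measure)
  define h where "h B n x = \<bar>cell_avg unit_leb (cell (Suc n)) (indicator B) x - indicator B x\<bar>" for B n x
  have h: "integrable unit_leb (h B n)" if "B \<in> sets unit_leb" for B n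
    unfolding h_def using int[OF that] cell_avg_L1(1)[OF finite_measure_unit_leb measurable_cell _ int[OF that]] finite_cell_range[of "Suc n"]
    by (intro integrable_abs Bochner_Integration.integrable_diff) auto
  have le: "(LINT p|square_leb. \<bar>cell_avg square_leb (cell2 (Suc n)) (indicator A) p - indicator A p\<bar>)
     \<le> (LINT x|unit_leb. h S n x) + (LINT x|unit_leb. h T n x)" for n
  proof -
    have "(LINT p|square_leb. \<bar>cell_avg square_leb (cell2 (Suc n)) (indicator A) p - indicator A p\<bar>)
      \<le> (LINT p|square_leb. h S n (fst p) + h T n (snd p))"
    proof (rule integral_mono)
      show "integrable square_leb (\<lambda>p. \<bar>cell_avg square_leb (cell2 (Suc n)) (indicator A) p - indicator A p\<bar>)"
        using integrable_indicator_square[OF ST] unfolding A(1)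
        by (intro integrable_abs Bochner_Integration.integrable_diff cell_avg_L1(1)[OF finite_measure_square_leb measurable_cell2 finite_cell2_range])
      show "integrable square_leb (\<lambda>p. h S n (fst p) + h T n (snd p))"
        using integral_fst_snd_square[OF h[OF A(2)]] integral_fst_snd_square[OF h[OF A(3)]] by simp
      fix p assume "p \<in> space square_leb"
      have "cell_avg square_leb (cell2 (Suc n)) (indicator A) p
         = cell_avg unit_leb (cell (Suc n)) (indicator S) (fst p) * cell_avg unit_leb (cell (Suc n)) (indicator T) (snd p)"
        unfolding A(1) cell_avg_indicator[OF ST] cell_avg_indicator[OF A(2)] cell_avg_indicator[OF A(3)] vimage_cell vimage_cell2 Times_Int_Times
        by (simp add: measure_rectangle measure_rectangle[OF sets.Int[OF A(2) cell_set_sets] sets.Int[OF A(3) cell_set_sets]])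
      moreover have "indicator A p = (indicator S (fst p) * indicator T (snd p) :: real)"
        unfolding A(1) by (auto simp: indicator_def mem_Times_iff)
      ultimately show "\<bar>cell_avg square_leb (cell2 (Suc n)) (indicator A) p - indicator A p\<bar> \<le> h S n (fst p) + h T n (snd p)"
        unfolding h_def using cell_avg_indicator_01[OF finite_measure_unit_leb A(2) measurable_cell]
        by (simp only:) (rule abs_prod_diff_le, auto)
    qed
    also have "\<dots> = (LINT x|unit_leb. h S n x) + (LINT x|unit_leb. h T n x)"
      using integral_fst_snd_square[OF h[OF A(2)]] integral_fst_snd_square[OF h[OF A(3)]] by simp
    finally show ?thesis .
  qed
  have lim: "(\<lambda>n. (LINT x|unit_leb. h S n x) + (LINT x|unit_leb. h T n x)) \<longlonglongrightarrow> 0"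
    unfolding h_def by (intro tendsto_add_zero cell_avg_unit_tendsto int A)
  show "(\<lambda>n. LINT p|square_leb. \<bar>cell_avg square_leb (cell2 (Suc n)) (indicator A) p - indicator A p\<bar>) \<longlonglongrightarrow> 0"
    by (rule tendsto_sandwich[OF _ _ tendsto_const lim]) (auto intro!: always_eventually le)
qed

section \<open>Step approximations of a stochastic graphon\<close>

text \<open>For indices in \<open>{1..n}\<close> the factor \<open>n^2\<close> is the inverse area
  of the cell, so this is the mean of the slice over it.\<close>

definition grid_density :: "nat \<Rightarrow> 'g cochain_fun \<Rightarrow> nat \<Rightarrow> nat \<Rightarrow> 'g \<Rightarrow> real" where
  "grid_density n W u v g = (real n)\<^sup>2 * set_lebesgue_integral square_leb (cell_set n u \<times> cell_set n v) (slice W g)"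

lemma measure_cell_rectangle:
  "n \<ge> 1 \<Longrightarrow> u \<in> {1..n} \<Longrightarrow> v \<in> {1..n} \<Longrightarrow> measure square_leb (cell_set n u \<times> cell_set n v) = 1 / (real n)\<^sup>2"
  by (simp add: measure_rectangle measure_cell_set power2_eq_square)

lemma cell_rectangle_integral_sum:
  fixes f :: "real \<times> real \<Rightarrow> real"
  assumes n: "n \<ge> 1" and f: "integrable square_leb f"
  shows "(\<Sum>u\<in>{1..n}. \<Sum>v\<in>{1..n}. set_lebesgue_integral square_leb (cell_set n u \<times> cell_set n v) f) = (LINT p|square_leb. f p)"
proof -
  have i: "integrable square_leb (\<lambda>p. indicator (cell_set n u \<times> cell_set n v) p * f p)" for u v
    by (rule integrable_indicator_mult[OF rectangle_sets f]) simp_all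
  have "(\<Sum>u\<in>{1..n}. \<Sum>v\<in>{1..n}. set_lebesgue_integral square_leb (cell_set n u \<times> cell_set n v) f)
     = (LINT p|square_leb. (\<Sum>u\<in>{1..n}. \<Sum>v\<in>{1..n}. indicator (cell_set n u \<times> cell_set n v) p * f p))"
  proof -
    have "(\<Sum>u\<in>{1..n}. \<Sum>v\<in>{1..n}. LINT p|square_leb. h u v p) = (LINT p|square_leb. (\<Sum>u\<in>{1..n}. \<Sum>v\<in>{1..n}. h u v p))"
      if "\<And>u v. integrable square_leb (h u v)" for h :: "nat \<Rightarrow> nat \<Rightarrow> real \<times> real \<Rightarrow> real" using that by simp
    from this[OF i] show ?thesis unfolding set_lebesgue_integral_def real_scaleR_def .
  qed
  also have "\<dots> = (LINT p|square_leb. f p)"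
  proof (intro Bochner_Integration.integral_cong refl)
    fix p assume p: "p \<in> space square_leb"
    have "(\<Sum>u\<in>{1..n}. \<Sum>v\<in>{1..n}. 1 * indicator (({0..1} \<inter> cell_set n u) \<times> ({0..1} \<inter> cell_set n v)) p) = (1 :: real)"
      using grid_fun_decomp[OF n p, of "{0..1}" "{0..1}" "\<lambda>_ _. 1", symmetric] p by (auto simp: grid_fun_def split_beta' mem_Times_iff)
    then have 1: "(\<Sum>u\<in>{1..n}. \<Sum>v\<in>{1..n}. indicator (cell_set n u \<times> cell_set n v) p) = (1 :: real)" by (simp only: Int_cell_set mult_1)
    have "(\<Sum>u\<in>{1..n}. \<Sum>v\<in>{1..n}. indicator (cell_set n u \<times> cell_set n v) p * f p)
       = (\<Sum>u\<in>{1..n}. \<Sum>v\<in>{1..n}. indicator (cell_set n u \<times> cell_set n v) p) * f p" by (simp only: sum_distrib_right)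
    then show "(\<Sum>u\<in>{1..n}. \<Sum>v\<in>{1..n}. indicator (cell_set n u \<times> cell_set n v) p * f p) = f p" by (simp only: 1 mult_1)
  qed
  finally show ?thesis .
qed

context
  fixes W :: "'g::{finite,ab_group_add} cochain_fun" and n :: nat
  assumes W: "W \<in> stochastic_graphons" and n: "n \<ge> 1"
begin

lemma stochastic_graphonD: "W \<in> cochain_graphons" "AE p in square_leb. (\<Sum>g\<in>UNIV. slice W g p) = 1"
  using W by (auto simp: stochastic_graphons_def)

lemma set_integrable_cell_slice: "set_integrable square_leb (cell_set n u \<times> cell_set n v) (slice W g)"
  by (rule bounded_kernel_set_integrable[OF slice_bounded_kernel[OF stochastic_graphonD(1)]]) simp_all

lemma grid_density_01:
  assumes "u \<in> {1..n}" "v \<in> {1..n}"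
  shows "0 \<le> grid_density n W u v g" "grid_density n W u v g \<le> 1"
proof -
  let ?C = "cell_set n u \<times> cell_set n v"
  have C: "?C \<in> sets square_leb" by (rule rectangle_sets) simp_all
  note s = cochain_graphonsD(2)[OF stochastic_graphonD(1)]
  show "0 \<le> grid_density n W u v g" unfolding grid_density_def set_lebesgue_integral_def
    by (intro mult_nonneg_nonneg integral_nonneg_AE AE_I2) (use s in \<open>auto simp: indicator_def\<close>)
  have "set_lebesgue_integral square_leb ?C (slice W g) \<le> (LINT p|square_leb. indicator ?C p)"
    unfolding set_lebesgue_integral_def
    using set_integrable_cell_slice[of u v g] integrable_indicator_square[OF C] unfolding set_integrable_def
    by (rule integral_mono) (use s in \<open>auto simp: indicator_def\<close>)
  also have "\<dots> = 1 / (real n)\<^sup>2" using measure_cell_rectangle[OF n assms] by (simp add: sets.Int_space_eq2[OF C] del: space_square_leb)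
  finally show "grid_density n W u v g \<le> 1" using n by (simp add: grid_density_def field_simps)
qed

lemma grid_density_sym: "grid_density n W u v g = grid_density n W v u (- g)"
proof -
  have "set_lebesgue_integral square_leb (cell_set n u \<times> cell_set n v) (slice W g)
     = set_lebesgue_integral square_leb (cell_set n u \<times> cell_set n v) (\<lambda>p. slice W (- g) (prod.swap p))"
    unfolding set_lebesgue_integral_def
  proof (intro Bochner_Integration.integral_cong refl arg_cong2[where f=scaleR])
    fix p assume "p \<in> space square_leb"
    then show "slice W g p = slice W (- g) (prod.swap p)"
      using cochain_graphonsD(3)[OF stochastic_graphonD(1), of "fst p" "snd p" g] by (auto simp: slice_def)
  qed
  also have "\<dots> = set_lebesgue_integral square_leb (cell_set n v \<times> cell_set n u) (slice W (- g))"
    by (rule rectangle_integral_swap) (use cochain_graphonsD(1)[OF stochastic_graphonD(1)] in auto)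
  finally show ?thesis by (simp add: grid_density_def)
qed

lemma grid_density_sum:
  assumes "u \<in> {1..n}" "v \<in> {1..n}"
  shows "(\<Sum>g\<in>UNIV. grid_density n W u v g) = 1"
proof -
  let ?C = "cell_set n u \<times> cell_set n v"
  have C: "?C \<in> sets square_leb" by (rule rectangle_sets) simp_all
  have "(\<Sum>g\<in>UNIV. set_lebesgue_integral square_leb ?C (slice W g)) = (LINT p|square_leb. (\<Sum>g\<in>UNIV. indicator ?C p *\<^sub>R slice W g p))"
    unfolding set_lebesgue_integral_def using set_integrable_cell_slice[of u v]
    by (intro Bochner_Integration.integral_sum[symmetric]) (simp add: set_integrable_def)
  also have "\<dots> = (LINT p|square_leb. indicator ?C p)"
  proof (rule integral_cong_AE)
    show "AE p in square_leb. (\<Sum>g\<in>UNIV. indicator ?C p *\<^sub>R slice W g p) = indicator ?C p"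
      using stochastic_graphonD(2) by eventually_elim (simp add: sum_distrib_left[symmetric])
  qed (use C cochain_graphonsD(1)[OF stochastic_graphonD(1)] in measurable)
  also have "\<dots> = 1 / (real n)\<^sup>2" using measure_cell_rectangle[OF n assms] by (simp add: sets.Int_space_eq2[OF C] del: space_square_leb)
  finally show ?thesis using n by (simp add: grid_density_def sum_distrib_left[symmetric])
qed

lemma grid_graphon_density_in: "grid_graphon n (grid_density n W) \<in> cochain_graphons"
  by (rule grid_graphon_in_graphons[OF n]) (auto intro: grid_density_01 grid_density_sym)

text \<open>Jensen's inequality on each cell.\<close>

lemma grid_density_entropy_le:
  assumes \<nu>: "\<And>g. 0 < \<nu> g"
  shows "(\<Sum>u\<in>{1..n}. \<Sum>v\<in>{1..n}. \<Sum>g\<in>UNIV. grid_density n W u v g * ln (grid_density n W u v g / \<nu> g))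
    \<le> (real n)\<^sup>2 * (LINT p|square_leb. entropy_density \<nu> W p)"
proof -
  note s = cochain_graphonsD(1,2)[OF stochastic_graphonD(1)]
  note ei = integrable_slice_ln_slice[OF stochastic_graphonD(1)]
  have jensen: "grid_density n W u v g * ln (grid_density n W u v g)
     \<le> (real n)\<^sup>2 * set_lebesgue_integral square_leb (cell_set n u \<times> cell_set n v) (\<lambda>p. slice W g p * ln (slice W g p))"
    if uv: "u \<in> {1..n}" "v \<in> {1..n}" for u v g
  proof -
    let ?C = "cell_set n u \<times> cell_set n v" and ?q = "grid_density n W u v g"
    let ?J = "set_lebesgue_integral square_leb ?C (\<lambda>p. slice W g p * ln (slice W g p))"
    have C: "?C \<in> sets square_leb" by (rule rectangle_sets) simp_all
    have mC: "(LINT p|square_leb. indicator ?C p) = 1 / (real n)\<^sup>2"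
      using measure_cell_rectangle[OF n uv] by (simp add: sets.Int_space_eq2[OF C] del: space_square_leb)
    \<comment> \<open>The tangent inequality integrated over the cell, for every base point
      \<open>c\<close>. Taking \<open>c\<close> to be the mean gives Jensen's inequality; if the
      mean is 0, \<open>c\<close> tends to 0 instead.\<close>
    have tang: "?q * ln c + ?q - c \<le> (real n)\<^sup>2 * ?J" if c: "c > 0" for c
    proof -
      have i: "integrable square_leb (\<lambda>p. indicator ?C p * slice W g p)"
        using set_integrable_cell_slice[of u v g] by (simp add: set_integrable_def)
      have ic: "integrable square_leb (\<lambda>p. indicator ?C p * c)" using integrable_indicator_square[OF C] by simp
      have "(LINT p|square_leb. (ln c + 1) * (indicator ?C p * slice W g p) - indicator ?C p * c)
         \<le> (LINT p|square_leb. indicator ?C p * (slice W g p * ln (slice W g p)))"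
      proof (rule integral_mono)
        show "integrable square_leb (\<lambda>p. (ln c + 1) * (indicator ?C p * slice W g p) - indicator ?C p * c)" using i ic by simp
        show "integrable square_leb (\<lambda>p. indicator ?C p * (slice W g p * ln (slice W g p)))"
          by (rule integrable_indicator_mult[OF C ei])
        fix p assume "p \<in> space square_leb"
        then have "slice W g p * ln c + slice W g p - c \<le> slice W g p * ln (slice W g p)"
          using s(2)[where p=p and g=g] c by (intro tangent_x_ln_x) auto
        then show "(ln c + 1) * (indicator ?C p * slice W g p) - indicator ?C p * c \<le> indicator ?C p * (slice W g p * ln (slice W g p))"
          by (simp add: indicator_def algebra_simps)
      qed
      also have "(LINT p|square_leb. (ln c + 1) * (indicator ?C p * slice W g p) - indicator ?C p * c)
         = (ln c + 1) * (?q / (real n)\<^sup>2) - c / (real n)\<^sup>2"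
        using i ic mC n by (simp add: grid_density_def set_lebesgue_integral_def)
      also have "(LINT p|square_leb. indicator ?C p * (slice W g p * ln (slice W g p))) = ?J"
        by (simp add: set_lebesgue_integral_def)
      finally have "((ln c + 1) * ?q - c) / (real n)\<^sup>2 \<le> ?J" by (simp add: diff_divide_distrib)
      then show ?thesis using n by (simp add: divide_le_eq algebra_simps)
    qed
    show ?thesis
    proof (cases "?q = 0")
      case True
      have "0 \<le> (real n)\<^sup>2 * ?J"
      proof (rule field_le_epsilon)
        fix e :: real assume "e > 0"
        from tang[OF this] True show "0 \<le> (real n)\<^sup>2 * ?J + e" by simp
      qed
      then show ?thesis using True by simp
    next
      case False
      then show ?thesis using tang[of ?q] grid_density_01(1)[OF uv, of g] by simp
    qed
  qed
  have "(\<Sum>u\<in>{1..n}. \<Sum>v\<in>{1..n}. \<Sum>g\<in>UNIV. grid_density n W u v g * ln (grid_density n W u v g / \<nu> g))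
     = (\<Sum>u\<in>{1..n}. \<Sum>v\<in>{1..n}. \<Sum>g\<in>UNIV. grid_density n W u v g * ln (grid_density n W u v g) - ln (\<nu> g) * grid_density n W u v g)"
  proof (intro sum.cong refl)
    fix u v g assume "u \<in> {1..n}" "v \<in> {1..n}"
    then show "grid_density n W u v g * ln (grid_density n W u v g / \<nu> g)
      = grid_density n W u v g * ln (grid_density n W u v g) - ln (\<nu> g) * grid_density n W u v g"
      using grid_density_01(1)[of u v g] \<nu>[of g] by (cases "grid_density n W u v g = 0") (auto simp: ln_div algebra_simps)
  qed
  also have "\<dots> \<le> (\<Sum>u\<in>{1..n}. \<Sum>v\<in>{1..n}. \<Sum>g\<in>UNIV.
      (real n)\<^sup>2 * set_lebesgue_integral square_leb (cell_set n u \<times> cell_set n v) (\<lambda>p. slice W g p * ln (slice W g p))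
      - ln (\<nu> g) * ((real n)\<^sup>2 * set_lebesgue_integral square_leb (cell_set n u \<times> cell_set n v) (slice W g)))"
    using jensen by (intro sum_mono diff_mono) (auto simp: grid_density_def)
  also have "\<dots> = (real n)\<^sup>2 * (\<Sum>g\<in>UNIV. (\<Sum>u\<in>{1..n}. \<Sum>v\<in>{1..n}. set_lebesgue_integral square_leb (cell_set n u \<times> cell_set n v) (\<lambda>p. slice W g p * ln (slice W g p)))
      - ln (\<nu> g) * (\<Sum>u\<in>{1..n}. \<Sum>v\<in>{1..n}. set_lebesgue_integral square_leb (cell_set n u \<times> cell_set n v) (slice W g)))"
  proof -
    have "(\<Sum>u\<in>U. \<Sum>v\<in>U. \<Sum>g\<in>UNIV. a * x u v g - l g * (a * y u v g)) = a * (\<Sum>g\<in>UNIV. (\<Sum>u\<in>U. \<Sum>v\<in>U. x u v g) - l g * (\<Sum>u\<in>U. \<Sum>v\<in>U. y u v g))"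
      for U :: "nat set" and a :: real and x y :: "nat \<Rightarrow> nat \<Rightarrow> 'g \<Rightarrow> real" and l :: "'g \<Rightarrow> real"
    proof -
      have "(\<Sum>u\<in>U. \<Sum>v\<in>U. \<Sum>g\<in>UNIV. a * x u v g - l g * (a * y u v g)) = (\<Sum>g\<in>UNIV. \<Sum>u\<in>U. \<Sum>v\<in>U. a * x u v g - l g * (a * y u v g))"
        by (subst (2) sum.swap) (subst sum.swap, rule refl)
      then show ?thesis by (simp add: sum_distrib_left sum_subtractf right_diff_distrib mult.left_commute)
    qed
    then show ?thesis .
  qed
  also have "\<dots> = (real n)\<^sup>2 * (LINT p|square_leb. entropy_density \<nu> W p)"
    unfolding cell_rectangle_integral_sum[OF n ei] cell_rectangle_integral_sum[OF n bounded_kernel_integrable[OF slice_bounded_kernel[OF stochastic_graphonD(1)]]]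
      integral_entropy_density(2)[OF \<nu> stochastic_graphonD(1)] ..
  finally show ?thesis .
qed

end

text \<open>On the unit square the slices of these step graphons are cell averages of the slices of
  W, so they converge even in L1.\<close>

lemma grid_density_tendsto:
  assumes W: "W \<in> stochastic_graphons"
  shows "(\<lambda>n. cut_distance (grid_graphon (Suc n) (grid_density (Suc n) W)) W) \<longlonglongrightarrow> 0"
proof -
  have Wg: "W \<in> cochain_graphons" using W by (simp add: stochastic_graphons_def)
  have g: "grid_graphon (Suc n) (grid_density (Suc n) W) \<in> cochain_graphons" for n by (rule grid_graphon_density_in[OF W]) simp
  have eq: "slice (grid_graphon (Suc n) (grid_density (Suc n) W)) g p = cell_avg square_leb (cell2 (Suc n)) (slice W g) p"
    if p: "p \<in> space square_leb" for n g p
  proof -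
    have "cell (Suc n) (fst p) \<in> {1..Suc n}" "cell (Suc n) (snd p) \<in> {1..Suc n}" 
      using p cell_range[of "Suc n" "fst p"] cell_range[of "Suc n" "snd p"] by (auto simp: mem_Times_iff)
    from measure_cell_rectangle[OF _ this] show ?thesis
      unfolding cell_avg_def vimage_cell2 by (simp add: slice_grid_graphon grid_fun_def split_beta' grid_density_def set_lebesgue_integral_def mult.commute)
  qed
  have "(\<lambda>n. \<Sum>g\<in>UNIV. LINT p|square_leb. \<bar>cell_avg square_leb (cell2 (Suc n)) (slice W g) p - slice W g p\<bar>) \<longlonglongrightarrow> 0"
    by (intro tendsto_null_sum cell_avg_square_tendsto bounded_kernel_integrable slice_bounded_kernel Wg)
  moreover have "(LINT p|square_leb. \<bar>slice (grid_graphon (Suc n) (grid_density (Suc n) W)) g p - slice W g p\<bar>)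
      = (LINT p|square_leb. \<bar>cell_avg square_leb (cell2 (Suc n)) (slice W g) p - slice W g p\<bar>)" for n g
    by (intro Bochner_Integration.integral_cong refl) (simp only: eq)
  ultimately have lim: "(\<lambda>n. \<Sum>g\<in>UNIV. LINT p|square_leb. \<bar>slice (grid_graphon (Suc n) (grid_density (Suc n) W)) g p - slice W g p\<bar>) \<longlonglongrightarrow> 0"
    by simp
  show ?thesis
    by (rule tendsto_sandwich[OF _ _ tendsto_const lim]) (auto intro!: always_eventually cut_distance_le_L1 cut_distance_nonneg g Wg)
qed

subsection \<open>Concentration of tilted cochains\<close>

lemma exp_le_quadratic:
  fixes x :: real assumes "\<bar>x\<bar> \<le> 1" shows "exp x \<le> 1 + x + x\<^sup>2"
proof (cases "x \<ge> 0")
  case True then show ?thesis using exp_bound[of x] assms by simp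
next
  case False
  define y where "y = - x"
  have y: "0 \<le> y" "y \<le> 1" using False assms by (auto simp: y_def)
  \<comment> \<open>For negative \<open>x\<close> the claim is multiplied by \<open>1 + y\<close>:
    here \<open>exp (- y) * (1 + y) \<le> 1\<close>, while
    \<open>(1 - y + y^2) * (1 + y) = 1 + y^3\<close>.\<close>
  have "exp x * (1 + y) \<le> exp x * exp y" using exp_ge_add_one_self[of y] by (intro mult_left_mono) auto
  also have "\<dots> = 1" by (simp add: y_def exp_minus)
  also have "\<dots> \<le> 1 + y ^ 3" using y by simp
  also have "\<dots> = (1 + x + x\<^sup>2) * (1 + y)" by (simp add: y_def algebra_simps power2_eq_square power3_eq_cube)
  finally show ?thesis using y by (subst (asm) mult_le_cancel_right) auto
qed

text \<open>Quadratic expansion of the exponential: the linear term vanishes by centring, and the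
  second moment is at most 4.\<close>

lemma centered_exponential_moment:
  fixes q \<xi> :: "'g::finite \<Rightarrow> real"
  assumes q: "\<And>g. 0 \<le> q g" "(\<Sum>g\<in>UNIV. q g) = 1" and \<xi>: "(\<Sum>g\<in>UNIV. q g * \<xi> g) = 0" "\<And>g. \<bar>\<xi> g\<bar> \<le> 2"
    and l: "\<bar>l\<bar> \<le> 1 / 2"
  shows "(\<Sum>g\<in>UNIV. q g * exp (l * \<xi> g)) \<le> exp (4 * l\<^sup>2)"
proof -
  have "q g * exp (l * \<xi> g) \<le> q g + l * (q g * \<xi> g) + q g * (4 * l\<^sup>2)" for g
  proof -
    have "\<bar>l\<bar> * \<bar>\<xi> g\<bar> \<le> 1 / 2 * 2" using l \<xi>(2)[of g] by (intro mult_mono) auto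
    then have "exp (l * \<xi> g) \<le> 1 + l * \<xi> g + (l * \<xi> g)\<^sup>2" by (intro exp_le_quadratic) (simp add: abs_mult)
    also have "(l * \<xi> g)\<^sup>2 \<le> 4 * l\<^sup>2"
    proof -
      have "(\<xi> g)\<^sup>2 \<le> 2\<^sup>2" using \<xi>(2)[of g] by (subst abs_le_square_iff[symmetric]) simp
      then show ?thesis by (simp add: power_mult_distrib mult.commute[of "l\<^sup>2"] mult_right_mono)
    qed
    finally have "q g * exp (l * \<xi> g) \<le> q g * (1 + l * \<xi> g + 4 * l\<^sup>2)" using q(1) by (intro mult_left_mono) auto
    then show ?thesis by (simp add: algebra_simps)
  qed
  then have "(\<Sum>g\<in>UNIV. q g * exp (l * \<xi> g)) \<le> (\<Sum>g\<in>UNIV. q g + l * (q g * \<xi> g) + q g * (4 * l\<^sup>2))" by (rule sum_mono)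
  also have "\<dots> = 1 + 4 * l\<^sup>2"
    using q(2) \<xi>(1) by (simp add: sum.distrib sum_distrib_left[symmetric] sum_distrib_right[symmetric])
  also have "\<dots> \<le> exp (4 * l\<^sup>2)" by (rule exp_ge_add_one_self)
  finally show ?thesis .
qed

lemma card_edges_le: "real (card (edges n)) \<le> (real n)\<^sup>2"
proof -
  have "card (edges n) \<le> card ({1..n} \<times> {1..n})" by (rule card_mono) (auto simp: edges_def)
  then have "real (card (edges n)) \<le> real (card ({1..n} \<times> {1..n}))" by (rule of_nat_mono)
  then show ?thesis by (simp add: power2_eq_square)
qed

lemma cochain_chernoff:
  fixes q :: "nat \<Rightarrow> nat \<Rightarrow> 'g::{finite,ab_group_add} \<Rightarrow> real" and \<xi> :: "nat \<times> nat \<Rightarrow> 'g \<Rightarrow> real"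
  assumes q: "\<And>u v g. (u, v) \<in> edges n \<Longrightarrow> 0 \<le> q u v g" "\<And>u v. (u, v) \<in> edges n \<Longrightarrow> (\<Sum>g\<in>UNIV. q u v g) = 1"
    and \<xi>: "\<And>u v. (u, v) \<in> edges n \<Longrightarrow> (\<Sum>g\<in>UNIV. q u v g * \<xi> (u, v) g) = 0" "\<And>e g. e \<in> edges n \<Longrightarrow> \<bar>\<xi> e g\<bar> \<le> 2"
    and t: "0 < t" "t \<le> 4"
  shows "(\<Sum>f\<in>{f\<in>cochains n. (\<Sum>e\<in>edges n. \<xi> e (f e)) > t * (real n)\<^sup>2}. cochain_prob q n f) \<le> exp (- (t\<^sup>2 / 16) * (real n)\<^sup>2)"
proof -
  \<comment> \<open>\<open>t / 8\<close> minimises \<open>4 * l^2 - l * t\<close>, with value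
    \<open>- t^2 / 16\<close>; the hypothesis \<open>t \<le> 4\<close> keeps it in the range of the
    moment bound.\<close>
  define l where "l = t / 8"
  define X where "X f = (\<Sum>e\<in>edges n. \<xi> e (f e))" for f
  have l: "0 < l" "\<bar>l\<bar> \<le> 1 / 2" using t by (auto simp: l_def)
  have Q: "0 \<le> cochain_prob q n f" for f
    unfolding cochain_prob_def by (intro prod_nonneg) (use q(1) in auto)
  have "(\<Sum>f\<in>{f\<in>cochains n. X f > t * (real n)\<^sup>2}. cochain_prob q n f)
     \<le> (\<Sum>f\<in>{f\<in>cochains n. X f > t * (real n)\<^sup>2}. cochain_prob q n f * exp (l * X f - l * t * (real n)\<^sup>2))"
  proof (rule sum_mono)
    fix f assume "f \<in> {f\<in>cochains n. X f > t * (real n)\<^sup>2}"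
    then have "l * (t * (real n)\<^sup>2) \<le> l * X f" using l by (intro mult_left_mono) auto
    then have "1 \<le> exp (l * X f - l * t * (real n)\<^sup>2)" by (simp add: mult.assoc)
    then show "cochain_prob q n f \<le> cochain_prob q n f * exp (l * X f - l * t * (real n)\<^sup>2)"
      using Q[of f] by (simp add: mult_le_cancel_left1)
  qed
  also have "\<dots> \<le> (\<Sum>f\<in>cochains n. cochain_prob q n f * exp (l * X f - l * t * (real n)\<^sup>2))"
    by (rule sum_mono2) (auto intro: mult_nonneg_nonneg Q)
  also have "\<dots> = exp (- (l * t * (real n)\<^sup>2)) * (\<Sum>f\<in>cochains n. cochain_prob q n f * exp (l * X f))"
    by (simp add: sum_distrib_left exp_diff exp_minus divide_inverse mult_ac)
  also have "(\<Sum>f\<in>cochains n. cochain_prob q n f * exp (l * X f))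
     = (\<Sum>f\<in>cochains n. \<Prod>e\<in>edges n. q (fst e) (snd e) (f e) * exp (l * \<xi> e (f e)))"
    by (simp add: cochain_prob_def X_def sum_distrib_left exp_sum prod.distrib)
  also have "\<dots> = (\<Prod>e\<in>edges n. \<Sum>g\<in>UNIV. q (fst e) (snd e) g * exp (l * \<xi> e g))"
    by (rule sum_cochains_prod)
  also have "\<dots> \<le> (\<Prod>e\<in>edges n. exp (4 * l\<^sup>2))"
  proof (rule prod_mono)
    fix e assume "e \<in> edges n"
    then have e: "(fst e, snd e) \<in> edges n" by simp
    show "0 \<le> (\<Sum>g\<in>UNIV. q (fst e) (snd e) g * exp (l * \<xi> e g)) \<and> (\<Sum>g\<in>UNIV. q (fst e) (snd e) g * exp (l * \<xi> e g)) \<le> exp (4 * l\<^sup>2)"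
      using q(1)[OF e] q(2)[OF e] \<xi>(1)[OF e] \<xi>(2)[OF e] l
      by (intro conjI sum_nonneg mult_nonneg_nonneg centered_exponential_moment) auto
  qed
  also have "\<dots> = exp (real (card (edges n)) * (4 * l\<^sup>2))" by (simp add: exp_of_nat_mult)
  also have "\<dots> \<le> exp ((real n)\<^sup>2 * (4 * l\<^sup>2))" using card_edges_le[of n] by (simp add: mult_right_mono)
  finally have "(\<Sum>f\<in>{f\<in>cochains n. X f > t * (real n)\<^sup>2}. cochain_prob q n f) \<le> exp (- (l * t * (real n)\<^sup>2)) * exp ((real n)\<^sup>2 * (4 * l\<^sup>2))"
    by simp
  also have "\<dots> = exp (- (t\<^sup>2 / 16) * (real n)\<^sup>2)"
    unfolding exp_add[symmetric] l_def by (simp add: power2_eq_square algebra_simps)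
  finally show ?thesis unfolding X_def .
qed

lemma cochain_concentration:
  fixes q :: "nat \<Rightarrow> nat \<Rightarrow> 'g::{finite,ab_group_add} \<Rightarrow> real"
  assumes q: "\<And>u v g. u \<in> {1..n} \<Longrightarrow> v \<in> {1..n} \<Longrightarrow> 0 \<le> q u v g \<and> q u v g \<le> 1"
     "\<And>u v. u \<in> {1..n} \<Longrightarrow> v \<in> {1..n} \<Longrightarrow> (\<Sum>g\<in>UNIV. q u v g) = 1"
     "\<And>u v g. u \<in> {1..n} \<Longrightarrow> v \<in> {1..n} \<Longrightarrow> q u v g = q v u (- g)"
    and t: "0 < t" "t \<le> 4"
  defines "bad \<equiv> {f\<in>cochains n. \<exists>g S T. S \<subseteq> {1..n} \<and> T \<subseteq> {1..n} \<and>
     \<bar>\<Sum>u\<in>S. \<Sum>v\<in>T. cochain_weight f u v g - q u v g\<bar> > t * (real n)\<^sup>2 + real n}"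
  shows "(\<Sum>f\<in>bad. cochain_prob q n f) \<le> 2 * real CARD('g) * 4 ^ n * exp (- (t\<^sup>2 / 16) * (real n)\<^sup>2)"
proof -
  \<comment> \<open>The contribution of one edge to the error on the rectangle S times T. Both
    orientations of the edge may lie in the rectangle, and the reversed one takes the value g
    exactly when the edge takes \<open>- g\<close>. The sign \<tau> accounts for the absolute
    value.\<close>
  define \<xi> where "\<xi> \<tau> g S T e h = \<tau> * ((if fst e \<in> S \<and> snd e \<in> T then (if h = g then 1 else 0) - q (fst e) (snd e) g else 0)
     + (if snd e \<in> S \<and> fst e \<in> T then (if h = - g then 1 else 0) - q (fst e) (snd e) (- g) else 0))"
    for \<tau> :: real and g :: 'g and S T :: "nat set" and e :: "nat \<times> nat" and h :: 'g
  define B where "B = (\<lambda>(\<tau>, g, S, T). {f\<in>cochains n. (\<Sum>e\<in>edges n. \<xi> \<tau> g S T e (f e)) > t * (real n)\<^sup>2})"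
  \<comment> \<open>The union bound runs over signs, group elements and pairs of subsets,
    \<open>2 * CARD('g) * 4 ^ n\<close> cases in all.\<close>
  let ?I = "{1, -1 :: real} \<times> (UNIV :: 'g set) \<times> Pow {1..n} \<times> Pow {1..n}"
  have e: "u \<in> {1..n}" "v \<in> {1..n}" "u \<noteq> v" if "(u, v) \<in> edges n" for u v using that by (auto simp: edges_def)
  have Q: "0 \<le> cochain_prob q n f" for f
    unfolding cochain_prob_def by (intro prod_nonneg) (use q(1) e in auto)
  have one: "(\<Sum>f\<in>B i. cochain_prob q n f) \<le> exp (- (t\<^sup>2 / 16) * (real n)\<^sup>2)" if i: "i \<in> ?I" for i
  proof -
    obtain \<tau> g S T where i': "i = (\<tau>, g, S, T)" "\<tau> = 1 \<or> \<tau> = -1" using i by (cases i) auto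
    show ?thesis unfolding i'(1) B_def prod.case
    proof (rule cochain_chernoff[OF _ _ _ _ t])
      fix u v assume uv: "(u, v) \<in> edges n"
      show "0 \<le> q u v h" for h using q(1)[OF e(1,2)[OF uv]] by simp
      show s1: "(\<Sum>h\<in>UNIV. q u v h) = 1" by (rule q(2)[OF e(1,2)[OF uv]])
      have c: "(\<Sum>h\<in>UNIV. q u v h * ((if h = k then 1 else 0) - q u v k)) = 0" for k
        by (simp add: right_diff_distrib sum_subtractf sum_distrib_right[symmetric] s1 if_distrib[of "\<lambda>x. _ * x"] cong: if_cong)
      have "(\<Sum>h\<in>UNIV. q u v h * \<xi> \<tau> g S T (u, v) h)
        = \<tau> * ((if u \<in> S \<and> v \<in> T then (\<Sum>h\<in>UNIV. q u v h * ((if h = g then 1 else 0) - q u v g)) else 0)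
          + (if v \<in> S \<and> u \<in> T then (\<Sum>h\<in>UNIV. q u v h * ((if h = - g then 1 else 0) - q u v (- g))) else 0))"
        by (auto simp: \<xi>_def sum_distrib_left sum.distrib[symmetric] algebra_simps)
      then show "(\<Sum>h\<in>UNIV. q u v h * \<xi> \<tau> g S T (u, v) h) = 0" unfolding c by simp
    next
      fix e' h assume "e' \<in> edges n"
      then have "(fst e', snd e') \<in> edges n" by simp
      from q(1)[OF e(1,2)[OF this]] have "0 \<le> q (fst e') (snd e') k \<and> q (fst e') (snd e') k \<le> 1" for k .
      from this[of g] this[of "- g"] show "\<bar>\<xi> \<tau> g S T e' h\<bar> \<le> 2"
        using i'(2) by (auto simp: \<xi>_def)
    qed
  qed
  have "bad \<subseteq> (\<Union>i\<in>?I. B i)"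
  proof
    fix f assume "f \<in> bad"
    then obtain g S T where f: "f \<in> cochains n" and st: "S \<subseteq> {1..n}" "T \<subseteq> {1..n}"
      and big: "\<bar>\<Sum>u\<in>S. \<Sum>v\<in>T. cochain_weight f u v g - q u v g\<bar> > t * (real n)\<^sup>2 + real n" unfolding bad_def by blast
    define s where "s u v = (if u \<in> S \<and> v \<in> T then cochain_weight f u v g - q u v g else 0)" for u v
    have "(\<Sum>u\<in>S. \<Sum>v\<in>T. cochain_weight f u v g - q u v g) = (\<Sum>u\<in>{1..n}. if u \<in> S then (\<Sum>v\<in>{1..n}. if v \<in> T then cochain_weight f u v g - q u v g else 0) else 0)"
      using st by (simp add: sum.inter_restrict[symmetric] Int_absorb1)
    also have "\<dots> = (\<Sum>u\<in>{1..n}. \<Sum>v\<in>{1..n}. s u v)"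
      by (intro sum.cong refl) (auto simp: s_def intro!: sum.cong)
    also have "\<dots> = (\<Sum>e\<in>edges n. s (fst e) (snd e) + s (snd e) (fst e)) + (\<Sum>u\<in>{1..n}. s u u)" by (rule sum_square_edges)
    also have "(\<Sum>e\<in>edges n. s (fst e) (snd e) + s (snd e) (fst e)) = (\<Sum>e\<in>edges n. \<xi> 1 g S T e (f e))"
    proof (rule sum.cong[OF refl])
      fix e' assume "e' \<in> edges n"
      then obtain u v where uv: "e' = (u, v)" "(u, v) \<in> edges n" by (cases e') auto
      have "s v u = (if v \<in> S \<and> u \<in> T then cochain_weight f u v (- g) - q u v (- g) else 0)"
        using cochain_weight_sym[OF f e(2,1)[OF uv(2)], of g] q(3)[OF e(2,1)[OF uv(2)], of g] by (simp add: s_def)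
      then show "s (fst e') (snd e') + s (snd e') (fst e') = \<xi> 1 g S T e' (f e')"
        using e(3)[OF uv(2)] by (simp add: uv(1) \<xi>_def s_def cochain_weight_def)
    qed
    finally have eq: "(\<Sum>u\<in>S. \<Sum>v\<in>T. cochain_weight f u v g - q u v g) = (\<Sum>e\<in>edges n. \<xi> 1 g S T e (f e)) + (\<Sum>u\<in>{1..n}. s u u)" .
    \<comment> \<open>The diagonal does not depend on the cochain and is at most n in absolute
      value; the summand \<open>real n\<close> in \<open>bad\<close> pays for it.\<close>
    have "\<bar>\<Sum>u\<in>{1..n}. s u u\<bar> \<le> (\<Sum>u\<in>{1..n}. \<bar>s u u\<bar>)" by (rule sum_abs)
    also have "\<dots> \<le> (\<Sum>u\<in>{1..n}. 1)"
    proof (rule sum_mono)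
      fix u assume "u \<in> {1..n}"
      from q(1)[OF this this, of g] show "\<bar>s u u\<bar> \<le> 1" by (auto simp: s_def cochain_weight_def)
    qed
    finally have "\<bar>\<Sum>e\<in>edges n. \<xi> 1 g S T e (f e)\<bar> > t * (real n)\<^sup>2" using big unfolding eq by simp
    moreover have "(\<Sum>e\<in>edges n. \<xi> (-1) g S T e (f e)) = - (\<Sum>e\<in>edges n. \<xi> 1 g S T e (f e))"
      unfolding sum_negf[symmetric] by (simp add: \<xi>_def)
    ultimately have "f \<in> B (1, g, S, T) \<or> f \<in> B (-1, g, S, T)" using f by (auto simp: B_def)
    then show "f \<in> (\<Union>i\<in>?I. B i)" using st by blast
  qed
  moreover have "finite (\<Union>i\<in>?I. B i)" by (rule finite_subset[OF _ finite_cochains[of n]]) (auto simp: B_def)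
  ultimately have "(\<Sum>f\<in>bad. cochain_prob q n f) \<le> (\<Sum>f\<in>(\<Union>i\<in>?I. B i). cochain_prob q n f)"
    by (intro sum_mono2) (auto intro: Q)
  also have "\<dots> \<le> (\<Sum>i\<in>?I. \<Sum>f\<in>B i. cochain_prob q n f)"
  proof -
    have "(\<Sum>f\<in>(\<Union>i\<in>I. C i). h f) \<le> (\<Sum>i\<in>I. \<Sum>f\<in>C i. h f)"
      if "finite I" "\<And>i. finite (C i)" "\<And>f. 0 \<le> h f" for I :: "'x set" and C :: "'x \<Rightarrow> 'y set" and h :: "'y \<Rightarrow> real"
      using that(1)
    proof (induction I)
      case (insert i I)
      have "(\<Sum>f\<in>(\<Union>i\<in>insert i I. C i). h f) \<le> (\<Sum>f\<in>C i. h f) + (\<Sum>f\<in>(\<Union>i\<in>I. C i). h f)"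
        using that(2,3) insert(1) by (simp add: sum_Un sum_nonneg)
      then show ?case using insert by simp
    qed simp
    from this[of ?I B "cochain_prob q n"] show ?thesis
      using Q by (auto simp: B_def split: prod.splits)
  qed
  also have "\<dots> \<le> real (card ?I) * exp (- (t\<^sup>2 / 16) * (real n)\<^sup>2)" by (rule sum_bounded_above[OF one])
  also have "card ?I = 2 * (CARD('g) * (2 ^ n * 2 ^ n))"
    by (simp add: card_cartesian_product card_Pow)
  also have "real (2 * (CARD('g) * (2 ^ n * 2 ^ n))) = 2 * real CARD('g) * 4 ^ n"
    by (simp add: power_mult_distrib[symmetric])
  finally show ?thesis .
qed

subsection \<open>Relative entropy\<close>

text \<open>\<open>ln y \<le> y - 1\<close> at \<open>y = P x * r / Q x\<close>, with
  \<open>r\<close> the ratio of the two totals; after summation the linear corrections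
  cancel.\<close>

lemma log_sum_inequality:
  fixes Q P :: "'a \<Rightarrow> real"
  assumes A: "finite A" and Q: "\<And>x. x \<in> A \<Longrightarrow> 0 \<le> Q x" and P: "\<And>x. x \<in> A \<Longrightarrow> 0 < P x"
  shows "(\<Sum>x\<in>A. Q x) * ln ((\<Sum>x\<in>A. Q x) / (\<Sum>x\<in>A. P x)) \<le> (\<Sum>x\<in>A. Q x * ln (Q x / P x))"
proof (cases "(\<Sum>x\<in>A. Q x) = 0")
  case True
  then have "Q x = 0" if "x \<in> A" for x using that A Q by (simp add: sum_nonneg_eq_0_iff)
  then show ?thesis using True by simp
next
  case False
  then have "A \<noteq> {}" by auto
  then have p: "0 < (\<Sum>x\<in>A. P x)" using A P by (intro sum_pos) auto
  define r where "r = (\<Sum>x\<in>A. Q x) / (\<Sum>x\<in>A. P x)"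
  have r: "r > 0" using p False Q by (simp add: r_def sum_nonneg order_less_le)
  have "Q x * ln r + Q x - P x * r \<le> Q x * ln (Q x / P x)" if x: "x \<in> A" for x
  proof (cases "Q x = 0")
    case True then show ?thesis using P[OF x] r by simp
  next
    case False
    then have q: "Q x > 0" using Q[OF x] by simp
    have "ln (P x * r / Q x) \<le> P x * r / Q x - 1" using q P[OF x] r by (intro ln_le_minus_one) simp
    then have "Q x * ln (P x * r / Q x) \<le> Q x * (P x * r / Q x - 1)" using q by (intro mult_left_mono) auto
    then show ?thesis using q P[OF x] r by (simp add: ln_div ln_mult algebra_simps)
  qed
  then have "(\<Sum>x\<in>A. Q x * ln r + Q x - P x * r) \<le> (\<Sum>x\<in>A. Q x * ln (Q x / P x))" by (rule sum_mono)
  moreover have "(\<Sum>x\<in>A. Q x * ln r + Q x - P x * r) = (\<Sum>x\<in>A. Q x) * ln r + (\<Sum>x\<in>A. Q x) - (\<Sum>x\<in>A. P x) * r"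
    by (simp add: sum.distrib sum_subtractf sum_distrib_right)
  moreover have "(\<Sum>x\<in>A. P x) * r = (\<Sum>x\<in>A. Q x)" using p by (simp add: r_def)
  ultimately show ?thesis unfolding r_def by simp
qed

text \<open>Coarsening to A and its complement does not increase relative entropy. The constant 2
  collects \<open>x * ln x \<ge> - 1\<close> for the masses of both sets. The gain is a lower bound
  on the probability of A under P once its probability under Q is near 1.\<close>

lemma relative_entropy_event:
  fixes Q P :: "'a \<Rightarrow> real"
  assumes \<Omega>: "finite \<Omega>" "A \<subseteq> \<Omega>" and Q: "\<And>x. x \<in> \<Omega> \<Longrightarrow> 0 \<le> Q x" "(\<Sum>x\<in>\<Omega>. Q x) = 1"
    and P: "\<And>x. x \<in> \<Omega> \<Longrightarrow> 0 < P x" "(\<Sum>x\<in>\<Omega>. P x) = 1" and a: "(\<Sum>x\<in>A. Q x) > 0"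
  shows "- (\<Sum>x\<in>\<Omega>. Q x * ln (Q x / P x)) - 2 \<le> (\<Sum>x\<in>A. Q x) * ln (\<Sum>x\<in>A. P x)"
proof -
  let ?B = "\<Omega> - A"
  have fin: "finite A" "finite ?B" using \<Omega> finite_subset by auto
  have split: "(\<Sum>x\<in>\<Omega>. h x) = (\<Sum>x\<in>?B. h x) + (\<Sum>x\<in>A. h x)" for h :: "'a \<Rightarrow> real"
    by (rule sum.subset_diff[OF \<Omega>(2,1)])
  define a p a' p' where "a = (\<Sum>x\<in>A. Q x)" and "p = (\<Sum>x\<in>A. P x)" and "a' = (\<Sum>x\<in>?B. Q x)" and "p' = (\<Sum>x\<in>?B. P x)"
  have "A \<noteq> {}" using a by auto
  then have p: "p > 0" unfolding p_def using fin(1) P(1) \<Omega>(2) by (intro sum_pos) auto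
  have nn: "0 \<le> a'" "0 \<le> p'" "0 < a"
    using a unfolding a'_def p'_def a_def by (auto intro: sum_nonneg Q(1) less_imp_le[OF P(1)])
  have le1: "a \<le> 1" "a' \<le> 1" "p' \<le> 1" using split[of Q] split[of P] Q(2) P(2) nn p by (auto simp: a_def a'_def p_def p'_def)
  have "a * ln (a / p) \<le> (\<Sum>x\<in>A. Q x * ln (Q x / P x))"
    unfolding a_def p_def by (rule log_sum_inequality[OF fin(1)]) (use Q P \<Omega>(2) in auto)
  moreover have "a * ln (a / p) \<ge> - 1 - a * ln p"
    using abs_x_ln_x_le[of a] nn le1 p by (simp add: ln_div algebra_simps abs_le_iff)
  moreover have "a' * ln (a' / p') \<le> (\<Sum>x\<in>?B. Q x * ln (Q x / P x))"
    unfolding a'_def p'_def by (rule log_sum_inequality[OF fin(2)]) (use Q P in auto)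
  moreover have "- 1 \<le> a' * ln (a' / p')"
  proof (cases "a' = 0 \<or> p' = 0")
    case False
    then have "ln p' \<le> 0" "0 < p'" "0 < a'" using nn le1 by auto
    then have "a' * ln p' \<le> 0" using nn by (intro mult_nonneg_nonpos) auto
    moreover have "- 1 \<le> a' * ln a'" using abs_x_ln_x_le[of a'] nn le1 by (simp add: abs_le_iff)
    ultimately show ?thesis using \<open>0 < p'\<close> \<open>0 < a'\<close> by (simp add: ln_div right_diff_distrib)
  qed auto
  ultimately show ?thesis using split[of "\<lambda>x. Q x * ln (Q x / P x)"] unfolding a_def p_def by linarith
qed

text \<open>The function \<open>c\<close> is absorbed into the factor of the edge \<open>d\<close>;
  all other factors sum to one.\<close>

lemma cochain_prob_marginal:
  fixes q :: "nat \<Rightarrow> nat \<Rightarrow> 'g::{finite,ab_group_add} \<Rightarrow> real"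
  assumes q: "\<And>u v. (u, v) \<in> edges n \<Longrightarrow> (\<Sum>g\<in>UNIV. q u v g) = 1" and d: "d \<in> edges n"
  shows "(\<Sum>f\<in>cochains n. cochain_prob q n f * c (f d)) = (\<Sum>g\<in>UNIV. q (fst d) (snd d) g * c g)"
proof -
  define k where "k e g = q (fst e) (snd e) g * (if e = d then c g else 1)" for e g
  have "(\<Sum>f\<in>cochains n. \<Prod>e\<in>edges n. k e (f e)) = (\<Prod>e\<in>edges n. \<Sum>g\<in>UNIV. k e g)" by (rule sum_cochains_prod)
  moreover have "(\<Prod>e\<in>edges n. k e (f e)) = cochain_prob q n f * c (f d)" for f
  proof -
    have "(\<Prod>e\<in>edges n. if e = d then c (f e) else 1) = c (f d)" using d by (simp add: prod.delta)
    then show ?thesis by (simp add: k_def prod.distrib cochain_prob_def)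
  qed
  moreover have "(\<Prod>e\<in>edges n. \<Sum>g\<in>UNIV. k e g) = (\<Prod>e\<in>edges n. if e = d then (\<Sum>g\<in>UNIV. q (fst d) (snd d) g * c g) else 1)"
    by (intro prod.cong refl) (use q in \<open>auto simp: k_def\<close>)
  ultimately show ?thesis using d by (simp add: prod.delta)
qed

text \<open>Relative entropy of product laws is additive over the edges. Cochains of tilted
  probability 0 are harmless since that probability multiplies every term.\<close>

lemma cochain_prob_entropy:
  fixes q :: "nat \<Rightarrow> nat \<Rightarrow> 'g::{finite,ab_group_add} \<Rightarrow> real"
  assumes q: "\<And>u v g. (u, v) \<in> edges n \<Longrightarrow> 0 \<le> q u v g" "\<And>u v. (u, v) \<in> edges n \<Longrightarrow> (\<Sum>g\<in>UNIV. q u v g) = 1"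
    and \<nu>: "\<And>g. 0 < \<nu> g"
  shows "(\<Sum>f\<in>cochains n. cochain_prob q n f * ln (cochain_prob q n f / cochain_prob (\<lambda>_ _. \<nu>) n f))
    = (\<Sum>e\<in>edges n. \<Sum>g\<in>UNIV. q (fst e) (snd e) g * ln (q (fst e) (snd e) g / \<nu> g))"
proof -
  have "cochain_prob q n f * ln (cochain_prob q n f / cochain_prob (\<lambda>_ _. \<nu>) n f)
     = (\<Sum>e\<in>edges n. cochain_prob q n f * ln (q (fst e) (snd e) (f e) / \<nu> (f e)))" for f
  proof (cases "cochain_prob q n f = 0")
    case False
    then have nz: "q (fst e) (snd e) (f e) \<noteq> 0" if "e \<in> edges n" for e
      using that by (auto simp: cochain_prob_def)
    have pos: "q (fst e) (snd e) (f e) / \<nu> (f e) > 0" if "e \<in> edges n" for e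
      using nz[OF that] q(1)[of "fst e" "snd e" "f e"] \<nu>[of "f e"] that by (intro divide_pos_pos) auto
    have "ln (\<Prod>e\<in>edges n. q (fst e) (snd e) (f e) / \<nu> (f e)) = (\<Sum>e\<in>edges n. ln (q (fst e) (snd e) (f e) / \<nu> (f e)))"
      by (rule ln_prod[OF finite_edges]) (metis less_irrefl pos)
    then show ?thesis by (simp add: cochain_prob_def prod_dividef sum_distrib_left)
  qed simp
  then have "(\<Sum>f\<in>cochains n. cochain_prob q n f * ln (cochain_prob q n f / cochain_prob (\<lambda>_ _. \<nu>) n f))
     = (\<Sum>e\<in>edges n. \<Sum>f\<in>cochains n. cochain_prob q n f * ln (q (fst e) (snd e) (f e) / \<nu> (f e)))"
    by simp (rule sum.swap)
  also have "\<dots> = (\<Sum>e\<in>edges n. \<Sum>g\<in>UNIV. q (fst e) (snd e) g * ln (q (fst e) (snd e) g / \<nu> g))"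
  proof (rule sum.cong[OF refl])
    fix e assume e: "e \<in> edges n"
    show "(\<Sum>f\<in>cochains n. cochain_prob q n f * ln (q (fst e) (snd e) (f e) / \<nu> (f e))) = (\<Sum>g\<in>UNIV. q (fst e) (snd e) g * ln (q (fst e) (snd e) g / \<nu> g))"
      by (rule cochain_prob_marginal[OF q(2) e])
  qed
  finally show ?thesis .
qed

subsection \<open>The lower bound\<close>

text \<open>Twice the sum over edges is the sum over the square minus the diagonal, and diagonal
  terms are relative entropies with respect to \<nu>, hence nonnegative. The sum over the square is
  controlled by Jensen's inequality on the cells.\<close>

lemma grid_density_cochain_entropy:
  assumes \<nu>: "symmetric_nondegenerate \<nu>" and W: "W \<in> stochastic_graphons" and n: "n \<ge> 1"
  defines "q \<equiv> grid_density n W"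
  shows "(\<Sum>f\<in>cochains n. cochain_prob q n f * ln (cochain_prob q n f / cochain_prob (\<lambda>_ _. \<nu>) n f))
    \<le> (real n)\<^sup>2 * (1 / 2 * (LINT p|square_leb. entropy_density \<nu> W p))"
proof -
  have \<nu>0: "0 < \<nu> g" and \<nu>s: "\<nu> (- g) = \<nu> g" for g using \<nu> by (auto simp: symmetric_nondegenerate_def)
  have e: "u \<in> {1..n}" "v \<in> {1..n}" if "(u, v) \<in> edges n" for u v using that by (auto simp: edges_def)
  define k where "k u v = (\<Sum>g\<in>UNIV. q u v g * ln (q u v g / \<nu> g))" for u v
  have sym: "k u v = k v u" for u v
  proof -
    have "k u v = (\<Sum>g\<in>UNIV. q u v (- g) * ln (q u v (- g) / \<nu> (- g)))"
      unfolding k_def by (rule sum.reindex_bij_betw[symmetric]) (auto intro!: bij_betwI[where g=uminus])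
    also have "\<dots> = k v u"
      unfolding k_def q_def using grid_density_sym[OF W n, of v u] by (simp add: \<nu>s)
    finally show ?thesis .
  qed
  have diag: "0 \<le> k u u" if "u \<in> {1..n}" for u
  proof -
    have "(\<Sum>g\<in>UNIV. q u u g) * ln ((\<Sum>g\<in>UNIV. q u u g) / (\<Sum>g\<in>UNIV. \<nu> g)) \<le> k u u"
      unfolding k_def q_def by (rule log_sum_inequality) (use grid_density_01[OF W n that that] \<nu>0 in auto)
    then show ?thesis using \<nu> grid_density_sum[OF W n that that] by (simp add: q_def symmetric_nondegenerate_def)
  qed
  have "(\<Sum>f\<in>cochains n. cochain_prob q n f * ln (cochain_prob q n f / cochain_prob (\<lambda>_ _. \<nu>) n f)) = (\<Sum>e\<in>edges n. k (fst e) (snd e))"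
    unfolding k_def by (rule cochain_prob_entropy) (use grid_density_01[OF W n e] grid_density_sum[OF W n e] \<nu>0 in \<open>auto simp: q_def\<close>)
  also have "2 * \<dots> \<le> (\<Sum>u\<in>{1..n}. \<Sum>v\<in>{1..n}. k u v)"
    unfolding sum_symmetric_square[OF sym] using sum_nonneg[of "{1..n}" "\<lambda>u. k u u", OF diag] by simp
  also have "\<dots> \<le> (real n)\<^sup>2 * (LINT p|square_leb. entropy_density \<nu> W p)"
    unfolding k_def q_def by (rule grid_density_entropy_le[OF W n \<nu>0])
  finally show ?thesis by simp
qed

lemma ldp_lower_bound_at:
  fixes \<nu> :: "'g::{finite,ab_group_add} \<Rightarrow> real"
  assumes \<nu>: "symmetric_nondegenerate \<nu>" and rc: "\<And>n. random_cochain \<nu> n (M n) (F n)"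
    and W: "W \<in> stochastic_graphons" and \<eta>: "\<eta> > 0"
    and ball: "\<And>V. V \<in> cochain_graphons \<Longrightarrow> cut_distance V W < \<eta> \<Longrightarrow> graphon_class V \<in> \<E>"
  shows "- rate \<nu> W \<le> liminf (\<lambda>n. ereal (1 / (real n)\<^sup>2) *
        ln_ereal (measure (M n) {\<omega> \<in> space (M n). graphon_class (graphon_of n (F n \<omega>)) \<in> \<E>}))"
proof -
  define H where "H = 1 / 2 * (LINT p|square_leb. entropy_density \<nu> W p)"
  have rate: "rate \<nu> W = ereal H" using W by (simp add: rate_eq H_def)
  have \<nu>0: "0 < \<nu> g" for g using \<nu> by (simp add: symmetric_nondegenerate_def)
  have \<nu>1: "(\<Sum>g\<in>UNIV. \<nu> g) = 1" using \<nu> by (simp add: symmetric_nondegenerate_def)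
  have Wg: "W \<in> cochain_graphons" using W by (simp add: stochastic_graphons_def)
  \<comment> \<open>Error budget: a quarter of \<eta> for the fluctuation, through
    \<open>CARD('g) * t \<le> \<eta> / 4\<close>, a quarter for the grid average, and a quarter for
    the terms of order \<open>1 / n\<close>.\<close>
  define t where "t = min 1 (\<eta> / (4 * real CARD('g)))"
  have t: "0 < t" "t \<le> 4" "real CARD('g) * t \<le> \<eta> / 4"
    using \<eta> by (auto simp: t_def min_def field_simps)
  define \<kappa> where "\<kappa> = t\<^sup>2 / 16"
  have \<kappa>: "\<kappa> > 0" using t by (simp add: \<kappa>_def)
  \<comment> \<open>A lower bound for the tilted probability of the event. It tends to 1 since the
    \<open>4 ^ n\<close> of the union bound loses against an exponential in
    \<open>n^2\<close>.\<close>
  define b where "b n = 1 - 2 * real CARD('g) * 4 ^ n * exp (- \<kappa> * (real n)\<^sup>2)" for n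
  have b: "b \<longlonglongrightarrow> 1" unfolding b_def using \<kappa> by real_asymp
  have "(\<lambda>n. cut_distance (grid_graphon n (grid_density n W)) W) \<longlonglongrightarrow> 0"
    by (rule LIMSEQ_imp_Suc[OF grid_density_tendsto[OF W]])
  then have "\<forall>\<^sub>F n in sequentially. cut_distance (grid_graphon n (grid_density n W)) W < \<eta> / 4"
    using \<eta> by (intro order_tendstoD) auto
  moreover have "\<forall>\<^sub>F n in sequentially. (1 + real CARD('g)) / real n < \<eta> / 4"
  proof (rule order_tendstoD(2))
    show "(\<lambda>n. (1 + real CARD('g)) / real n) \<longlonglongrightarrow> 0" by (rule lim_const_over_n)
  qed (use \<eta> in simp)
  moreover have "\<forall>\<^sub>F n in sequentially. b n > 0" by (rule order_tendstoD(1)[OF b]) simp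
  ultimately have "\<forall>\<^sub>F n in sequentially. ereal (- (H + 2 / (real n)\<^sup>2) / b n) \<le> ereal (1 / (real n)\<^sup>2) *
        ln_ereal (measure (M n) {\<omega> \<in> space (M n). graphon_class (graphon_of n (F n \<omega>)) \<in> \<E>})"
    using eventually_ge_at_top[of 1]
  proof eventually_elim
    case (elim n)
    then have n: "n \<ge> 1" and bn: "b n > 0" by auto
    define q where "q = grid_density n W"
    define A where "A = {f \<in> cochains n. graphon_class (graphon_of n f) \<in> \<E>}"
    define bad where "bad = {f\<in>cochains n. \<exists>g S T. S \<subseteq> {1..n} \<and> T \<subseteq> {1..n} \<and>
       \<bar>\<Sum>u\<in>S. \<Sum>v\<in>T. cochain_weight f u v g - q u v g\<bar> > t * (real n)\<^sup>2 + real n}"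
    have e: "u \<in> {1..n}" "v \<in> {1..n}" if "(u, v) \<in> edges n" for u v using that by (auto simp: edges_def)
    note q01 = grid_density_01[OF W n, folded q_def] and q1 = grid_density_sum[OF W n, folded q_def]
      and qs = grid_density_sym[OF W n, folded q_def]
    have Q0: "0 \<le> cochain_prob q n f" for f
      unfolding cochain_prob_def by (intro prod_nonneg) (use q01 e in auto)
    have Q1: "(\<Sum>f\<in>cochains n. cochain_prob q n f) = 1" by (rule cochain_prob_sum) (use q1 e in blast)
    have P0: "0 < cochain_prob (\<lambda>_ _. \<nu>) n f" for f
      unfolding cochain_prob_def by (intro prod_pos) (use \<nu>0 in auto)
    have P1: "(\<Sum>f\<in>cochains n. cochain_prob (\<lambda>_ _. \<nu>) n f) = 1" by (rule cochain_prob_sum) (rule \<nu>1)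
    have qg: "grid_graphon n q \<in> cochain_graphons" unfolding q_def by (rule grid_graphon_density_in[OF W n])
    have good: "cochains n - bad \<subseteq> A"
    proof
      fix f assume f: "f \<in> cochains n - bad"
      then have fc: "f \<in> cochains n" by simp
      note fg = filled_graphon_in[OF n fc] and gg = graphon_of_in_graphons[OF fc]
      have "cut_distance (filled_graphon n f) (grid_graphon n q) \<le> real CARD('g) * (t + 1 / real n)"
        unfolding filled_graphon_def
      proof (rule cut_distance_grid_graphons_le[OF n])
        fix S T g assume st: "S \<subseteq> {1..n}" "T \<subseteq> {1..n}"
        then have "\<bar>\<Sum>u\<in>S. \<Sum>v\<in>T. cochain_weight f u v g - q u v g\<bar> \<le> t * (real n)\<^sup>2 + real n"
          using f unfolding bad_def by (auto simp: not_less)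
        also have "\<dots> = (t + 1 / real n) * (real n)\<^sup>2" using n by (simp add: field_simps power2_eq_square)
        finally show "\<bar>\<Sum>u\<in>S. \<Sum>v\<in>T. cochain_weight f u v g - q u v g\<bar> \<le> (t + 1 / real n) * (real n)\<^sup>2" .
      qed (use fg qg in \<open>simp_all add: filled_graphon_def\<close>)
      moreover have "cut_distance (graphon_of n f) (filled_graphon n f) \<le> 1 / real n"
        by (rule cut_distance_graphon_of_filled[OF n fc])
      moreover have "cut_distance (graphon_of n f) W \<le> cut_distance (graphon_of n f) (filled_graphon n f) + cut_distance (filled_graphon n f) W"
        by (rule cut_distance_triangle[OF gg fg Wg])
      moreover have "cut_distance (filled_graphon n f) W \<le> cut_distance (filled_graphon n f) (grid_graphon n q) + cut_distance (grid_graphon n q) W"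
        by (rule cut_distance_triangle[OF fg qg Wg])
      moreover have "real CARD('g) * (t + 1 / real n) + 1 / real n \<le> \<eta> / 4 + (1 + real CARD('g)) / real n"
        using t(3) by (simp add: distrib_left add_divide_distrib)
      ultimately have "cut_distance (graphon_of n f) W < \<eta>" using elim \<eta> unfolding q_def by linarith
      then show "f \<in> A" using ball[OF gg] fc by (simp add: A_def)
    qed
    define a where "a = (\<Sum>f\<in>A. cochain_prob q n f)"
    have fin: "finite A" and AA: "A \<subseteq> cochains n" unfolding A_def by auto
    have "(\<Sum>f\<in>bad. cochain_prob q n f) \<le> 2 * real CARD('g) * 4 ^ n * exp (- (t\<^sup>2 / 16) * (real n)\<^sup>2)"
      unfolding bad_def by (rule cochain_concentration[OF _ q1 qs t(1,2)]) (use q01 in blast)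
    then have "(\<Sum>f\<in>bad. cochain_prob q n f) \<le> 1 - b n" by (simp add: b_def \<kappa>_def)
    moreover have "(\<Sum>f\<in>cochains n. cochain_prob q n f) = (\<Sum>f\<in>cochains n - bad. cochain_prob q n f) + (\<Sum>f\<in>bad. cochain_prob q n f)"
      by (rule sum.subset_diff) (auto simp: bad_def)
    moreover have "(\<Sum>f\<in>cochains n - bad. cochain_prob q n f) \<le> a"
      unfolding a_def by (rule sum_mono2[OF fin good]) (rule Q0)
    ultimately have a: "b n \<le> a" using Q1 by linarith
    define D where "D = (\<Sum>f\<in>cochains n. cochain_prob q n f * ln (cochain_prob q n f / cochain_prob (\<lambda>_ _. \<nu>) n f))"
    define P where "P = (\<Sum>f\<in>A. cochain_prob (\<lambda>_ _. \<nu>) n f)"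
    have DH: "D \<le> (real n)\<^sup>2 * H" unfolding D_def q_def H_def by (rule grid_density_cochain_entropy[OF \<nu> W n])
    \<comment> \<open>Nonnegativity of the relative entropy allows the denominator \<open>a\<close>
      to be lowered to \<open>b n\<close>.\<close>
    have D0: "0 \<le> D"
      using log_sum_inequality[where A="cochains n" and Q="cochain_prob q n" and P="cochain_prob (\<lambda>_ _. \<nu>) n", OF finite_cochains Q0 P0] Q1 P1
      by (simp add: D_def)
    have "- D - 2 \<le> a * ln P"
      unfolding D_def a_def P_def
      by (rule relative_entropy_event[OF finite_cochains AA Q0 Q1 P0 P1]) (use a bn in \<open>simp add: a_def\<close>)
    then have "ln P \<ge> (- D - 2) / a" using a bn by (simp add: divide_le_eq mult.commute)
    also have "(- D - 2) / a \<ge> - ((real n)\<^sup>2 * H + 2) / b n"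
    proof -
      have "(D + 2) / a \<le> ((real n)\<^sup>2 * H + 2) / b n" using DH D0 a bn by (intro frac_le) auto
      then show ?thesis by (simp add: minus_divide_left[symmetric] diff_divide_distrib add_divide_distrib)
    qed
    finally have lnP: "- ((real n)\<^sup>2 * H + 2) / b n \<le> ln P" .
    have "A \<noteq> {}" using a bn by (auto simp: a_def)
    then have P: "P > 0" unfolding P_def using fin P0 by (intro sum_pos) auto
    have "{\<omega> \<in> space (M n). graphon_class (graphon_of n (F n \<omega>)) \<in> \<E>} = {\<omega> \<in> space (M n). F n \<omega> \<in> A}"
      using rc[of n] by (auto simp: A_def random_cochain_def)
    also have "measure (M n) \<dots> = P" unfolding P_def by (rule random_cochain_prob[OF rc AA])
    finally have P_eq: "measure (M n) {\<omega> \<in> space (M n). graphon_class (graphon_of n (F n \<omega>)) \<in> \<E>} = P" .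
    have "- (H + 2 / (real n)\<^sup>2) / b n = 1 / (real n)\<^sup>2 * (- ((real n)\<^sup>2 * H + 2) / b n)"
      using n bn by (simp add: field_simps)
    also have "\<dots> \<le> 1 / (real n)\<^sup>2 * ln P" by (rule mult_left_mono[OF lnP]) simp
    finally show ?case unfolding P_eq using P by (simp add: ln_ereal_def)
  qed
  from Liminf_mono[OF this]
  have "liminf (\<lambda>n. ereal (- (H + 2 / (real n)\<^sup>2) / b n)) \<le> liminf (\<lambda>n. ereal (1 / (real n)\<^sup>2) *
        ln_ereal (measure (M n) {\<omega> \<in> space (M n). graphon_class (graphon_of n (F n \<omega>)) \<in> \<E>}))" .
  moreover have "(\<lambda>n. ereal (- (H + 2 / (real n)\<^sup>2) / b n)) \<longlonglongrightarrow> ereal (- (H + 0) / 1)"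
  proof (intro tendsto_ereal tendsto_divide tendsto_minus tendsto_add tendsto_const b)
    show "(\<lambda>n. 2 / (real n)\<^sup>2) \<longlonglongrightarrow> 0" by real_asymp
  qed simp
  then have "liminf (\<lambda>n. ereal (- (H + 2 / (real n)\<^sup>2) / b n)) = ereal (- H)"
    by (simp add: lim_imp_Liminf)
  ultimately show ?thesis by (simp add: rate)
qed

text \<open>Classes of infinite rate give a trivial bound. For the others a ball inside the open set
  reduces the claim to a single stochastic graphon.\<close>

lemma ldp_lower_bound:
  fixes \<nu> :: "'g::{finite,ab_group_add} \<Rightarrow> real"
  assumes \<nu>: "symmetric_nondegenerate \<nu>" and rc: "\<And>n. random_cochain \<nu> n (M n) (F n)"
    and op: "openin cut_topology \<E>"
  shows "- (INF A\<in>\<E>. class_rate \<nu> A) \<le> liminf (\<lambda>n. ereal (1 / (real n)\<^sup>2) *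
        ln_ereal (measure (M n) {\<omega> \<in> space (M n). graphon_class (graphon_of n (F n \<omega>)) \<in> \<E>}))" (is "_ \<le> ?L")
proof -
  interpret Metric_space "graphon_classes :: 'g cochain_fun set set" class_distance by (rule Metric_space_graphon_classes)
  have \<nu>0: "0 < \<nu> g" for g using \<nu> by (simp add: symmetric_nondegenerate_def)
  have "- ?L \<le> class_rate \<nu> A" if A: "A \<in> \<E>" for A
  proof -
    obtain \<eta> where \<eta>: "\<eta> > 0" "mball A \<eta> \<subseteq> \<E>" and "\<E> \<subseteq> graphon_classes"
      using op A unfolding cut_topology_def openin_mtopology by blast
    then obtain W where W: "W \<in> cochain_graphons" "A = graphon_class W" using graphon_classes_rep A by blast
    show ?thesis
    proof (cases "W \<in> stochastic_graphons")
      case True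
      have "- rate \<nu> W \<le> ?L"
      proof (rule ldp_lower_bound_at[OF \<nu> rc True \<eta>(1)])
        fix V assume V: "V \<in> cochain_graphons" "cut_distance V W < \<eta>"
        then have "graphon_class V \<in> mball A \<eta>"
          using W cut_distance_sym[OF V(1) W(1)] by (simp add: graphon_class_in_classes class_distance_eq)
        then show "graphon_class V \<in> \<E>" using \<eta>(2) by blast
      qed
      then show ?thesis unfolding W(2) class_rate_graphon_class[OF \<nu>0 W(1)] by (simp add: ereal_uminus_le_reorder)
    next
      case False
      then show ?thesis unfolding W(2) class_rate_graphon_class[OF \<nu>0 W(1)] by (simp add: rate_def)
    qed
  qed
  then have "- ?L \<le> (INF A\<in>\<E>. class_rate \<nu> A)" by (rule INF_greatest)
  then show ?thesis by (simp add: ereal_uminus_le_reorder)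
qed

subsection \<open>The large deviation principle\<close>

theorem theorem6:
  fixes \<nu> :: "'g::{finite,ab_group_add} \<Rightarrow> real"
    and M :: "nat \<Rightarrow> 'w measure"
    and F :: "nat \<Rightarrow> 'w \<Rightarrow> nat \<times> nat \<Rightarrow> 'g"
  assumes "symmetric_nondegenerate \<nu>"
    and "\<And>n. random_cochain \<nu> n (M n) (F n)"
  shows "(\<forall>\<C>. closedin cut_topology \<C> \<longrightarrow>
      limsup (\<lambda>n. ereal (1 / (real n)\<^sup>2) *
        ln_ereal (measure (M n) {\<omega> \<in> space (M n). graphon_class (graphon_of n (F n \<omega>)) \<in> \<C>}))
      \<le> - (INF A\<in>\<C>. class_rate \<nu> A))
    \<and> (\<forall>\<E>. openin cut_topology \<E> \<longrightarrow>
      liminf (\<lambda>n. ereal (1 / (real n)\<^sup>2) *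
        ln_ereal (measure (M n) {\<omega> \<in> space (M n). graphon_class (graphon_of n (F n \<omega>)) \<in> \<E>}))
      \<ge> - (INF A\<in>\<E>. class_rate \<nu> A))"
  using ldp_upper_bound[OF assms] ldp_lower_bound[OF assms] by blast

end
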